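(* For every $n\in\mathbb{N}$ one has $\mathcal{H}(n+1)\geqslant\mathcal{H}(n)+1$ (with the convention $\infty+1=\infty$). In particular, if $\mathcal{H}(n_0)=\infty$ for some $n_0$, then $\mathcal{H}(n)=\infty$ for all $n\geqslant n_0$.
   Context: For $n\in\mathbb{N}$, $\mathcal{X}^n$ denotes the set of planar polynomial vector fields $X=(P,Q)$, i.e. systems $\dot x=P(x,y)$, $\dot y=Q(x,y)$ with $P,Q\in\mathbb{R}[x,y]$ of degree at most $n$, endowed with the topology given by the coefficients. A limit cycle is an isolated periodic orbit. For $X\in\mathcal{X}^n$, $\pi(X)\in\mathbb{Z}_{\geqslant0}\cup\{\infty\}$ is the number of limit cycles of $X$, and $\mathcal{H}(n)=\sup\{\pi(X): X\in\mathcal{X}^n\}\in\mathbb{Z}_{\geqslant0}\cup\{\infty\}$. *)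

theory Defs
  imports "HOL-Analysis.Analysis" "HOL-Library.Extended_Nat"
begin

definition poly2_deg_le :: "nat \<Rightarrow> (real \<Rightarrow> real \<Rightarrow> real) \<Rightarrow> bool" where
  "poly2_deg_le n P \<longleftrightarrow>
     (\<exists>c :: nat \<Rightarrow> nat \<Rightarrow> real. \<forall>x y. P x y = (\<Sum>i\<le>n. \<Sum>j\<le>n - i. c i j * x ^ i * y ^ j))"

definition vfield :: "(real \<Rightarrow> real \<Rightarrow> real) \<Rightarrow> (real \<Rightarrow> real \<Rightarrow> real) \<Rightarrow> real \<times> real \<Rightarrow> real \<times> real" where
  "vfield P Q = (\<lambda>(x, y). (P x y, Q x y))"

definition periodic_orbit :: "(real \<times> real \<Rightarrow> real \<times> real) \<Rightarrow> (real \<times> real) set \<Rightarrow> bool" where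
  "periodic_orbit F \<Gamma> \<longleftrightarrow>
     (\<exists>\<gamma> :: real \<Rightarrow> real \<times> real. \<exists>T > 0.
        (\<forall>t. (\<gamma> has_vector_derivative F (\<gamma> t)) (at t)) \<and>
        (\<forall>t. \<gamma> (t + T) = \<gamma> t) \<and>
        (\<exists>t. \<gamma> t \<noteq> \<gamma> 0) \<and>
        \<Gamma> = range \<gamma>)"

definition limit_cycle :: "(real \<times> real \<Rightarrow> real \<times> real) \<Rightarrow> (real \<times> real) set \<Rightarrow> bool" where
  "limit_cycle F \<Gamma> \<longleftrightarrow> periodic_orbit F \<Gamma> \<and>
     (\<exists>U. open U \<and> \<Gamma> \<subseteq> U \<and> (\<forall>\<Gamma>'. periodic_orbit F \<Gamma>' \<and> \<Gamma>' \<subseteq> U \<longrightarrow> \<Gamma>' = \<Gamma>))"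

definition num_limit_cycles :: "(real \<times> real \<Rightarrow> real \<times> real) \<Rightarrow> enat" where
  "num_limit_cycles F =
     (if finite {\<Gamma>. limit_cycle F \<Gamma>} then enat (card {\<Gamma>. limit_cycle F \<Gamma>}) else \<infinity>)"

definition hilbert_number :: "nat \<Rightarrow> enat" where
  "hilbert_number n =
     (SUP PQ \<in> {(P, Q). poly2_deg_le n P \<and> poly2_deg_le n Q}.
        num_limit_cycles (vfield (fst PQ) (snd PQ)))"

end

theory Submission
  imports Defs
begin

text \<open>
  Let a field of degree \<open>n\<close> have \<open>k\<close> limit cycles. Rotating it by a small angle splits semistable cycles,
  and for one sense of rotation and almost every small angle (Sard) at least \<open>k\<close> cycles with nonzero integral
  of the divergence remain. Such hyperbolic cycles are limit cycles and survive every small smooth perturbation.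
  For \<open>n \<ge> 2\<close>, multiplication by a linear factor that vanishes far away raises the degree, and close to the
  resulting line of singularities a further small perturbation of degree \<open>n + 1\<close> has a van der Pol field as
  blow-up limit; the hyperbolic cycle of that field is the additional one. For \<open>n = 1\<close> there are no limit
  cycles, so a quadratic field with one limit cycle suffices.

  Return maps are avoided: a closed orbit through \<open>p\<close> with period \<open>\<tau>\<close> is a zero of (time-\<open>\<tau>\<close> map of \<open>p\<close>) \<open>- p\<close>,
  which the inverse function theorem continues in parameters; hyperbolicity and transversality in the
  parameters are read off from the scalar equation for the determinant of velocity and variation.
\<close>

section \<open>Smooth fields and their flows\<close>

text \<open>Hyperbolicity has to come before the degree is raised because every later modification
  is small only on bounded sets and is controlled only through a limit: a semistable cycle could
  disappear under it, a hyperbolic one cannot. The same holds for the new cycle, which is found in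
  the blow-up limit and has to survive the passage back to a positive parameter. The old cycles stay
  in a fixed ball while the new one moves off to infinity, so they cannot coincide. The bound n >= 2
  in the construction comes from the cubic friction term, which is carried by x^(n-2) y^3: the power
  of x is large near the distant line, so that a small coefficient is enough. Smoothness is used in
  the quantitative form C^1 with a derivative that is Lipschitz on every ball. This class contains
  the polynomials, is closed under composition and products, and lets Gronwall's inequality give a
  quadratic remainder for the time-one map. The derivative is an explicit argument \<open>D\<close>,
  since the divergence along an orbit is integrated from it.\<close>

definition C11 :: "('a::real_normed_vector \<Rightarrow> 'b::real_normed_vector) \<Rightarrow> ('a \<Rightarrow> 'a \<Rightarrow>\<^sub>L 'b) \<Rightarrow> bool" where
  "C11 f D \<longleftrightarrow> (\<forall>R. \<exists>M. \<forall>x y. norm x \<le> R \<longrightarrow> norm y \<le> R \<longrightarrow>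
     norm (f y - f x - D x (y - x)) \<le> M * (norm (y - x))\<^sup>2 \<and>
     norm (D x) \<le> M \<and> norm (D y - D x) \<le> M * norm (y - x))"

text \<open>On the ball of radius \<open>R\<close> one factor \<open>norm (y - x)\<close> of the
  quadratic remainder is at most twice |R|, which yields a Lipschitz bound for \<open>f\<close>;
  comparison with \<open>f 0\<close> then bounds \<open>f\<close> itself. One constant serves all
  five estimates, so later proofs carry a single \<open>M\<close>.\<close>

lemma C11_bound:
  fixes f :: "'a::real_normed_vector \<Rightarrow> 'b::real_normed_vector"
  assumes "C11 f D"
  obtains M where "M > 0"
    "\<And>x y. norm x \<le> R \<Longrightarrow> norm y \<le> R \<Longrightarrow> norm (f y - f x - D x (y - x)) \<le> M * (norm (y - x))\<^sup>2"
    "\<And>x. norm x \<le> R \<Longrightarrow> norm (D x) \<le> M"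
    "\<And>x y. norm x \<le> R \<Longrightarrow> norm y \<le> R \<Longrightarrow> norm (D y - D x) \<le> M * norm (y - x)"
    "\<And>x y. norm x \<le> R \<Longrightarrow> norm y \<le> R \<Longrightarrow> norm (f y - f x) \<le> M * norm (y - x)"
    "\<And>x. norm x \<le> R \<Longrightarrow> norm (f x) \<le> M"
proof -
  obtain M where M: "\<And>x y. norm x \<le> R \<Longrightarrow> norm y \<le> R \<Longrightarrow>
     norm (f y - f x - D x (y - x)) \<le> M * (norm (y - x))\<^sup>2 \<and>
     norm (D x) \<le> M \<and> norm (D y - D x) \<le> M * norm (y - x)"
    using assms unfolding C11_def by meson
  define M' where "M' = \<bar>M\<bar> * (2 * \<bar>R\<bar>) + \<bar>M\<bar>"
  define N where "N = M' + M' * (2 * \<bar>R\<bar>) + norm (f 0) + 1"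
  have M'0: "M' \<ge> 0" "\<bar>M\<bar> \<le> M'" by (auto simp: M'_def)
  have N: "\<bar>M\<bar> \<le> N" "M' \<le> N" "N > 0"
  proof -
    have "0 \<le> M' * (2 * \<bar>R\<bar>)" "0 \<le> norm (f 0)" using M'0 by auto
    then show "\<bar>M\<bar> \<le> N" "M' \<le> N" "N > 0" using M'0 unfolding N_def by linarith+
  qed
  have lip: "norm (f y - f x) \<le> M' * norm (y - x)" if "norm x \<le> R" "norm y \<le> R" for x y
  proof -
    have "norm (f y - f x) \<le> norm (f y - f x - D x (y - x)) + norm (D x (y - x))"
      by (metis add.commute diff_add_cancel norm_triangle_ineq)
    also have "\<dots> \<le> M * (norm (y - x))\<^sup>2 + M * norm (y - x)"
    proof (rule add_mono)
      show "norm (f y - f x - D x (y - x)) \<le> M * (norm (y - x))\<^sup>2" using M[OF that] by simp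
      have "norm (D x) * norm (y - x) \<le> M * norm (y - x)" using M[OF that] by (intro mult_right_mono) auto
      then show "norm (D x (y - x)) \<le> M * norm (y - x)" using norm_blinfun[of "D x" "y - x"] by linarith
    qed
    also have "\<dots> \<le> \<bar>M\<bar> * ((2 * \<bar>R\<bar>) * norm (y - x)) + \<bar>M\<bar> * norm (y - x)"
    proof (intro add_mono mult_mono)
      have "norm (y - x) \<le> 2 * \<bar>R\<bar>" using norm_triangle_ineq4[of y x] that by linarith
      thus "(norm (y - x))\<^sup>2 \<le> (2 * \<bar>R\<bar>) * norm (y - x)"
        by (simp add: power2_eq_square mult_right_mono)
    qed auto
    also have "\<dots> = M' * norm (y - x)" by (simp add: M'_def algebra_simps)
    finally show ?thesis .
  qed
  show ?thesis
  proof (rule that[of N])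
    show "0 < N" by fact
    fix x y :: 'a assume x: "norm x \<le> R"
    show "norm (D x) \<le> N" using M[OF x x] N by linarith
    have "norm (f x) \<le> norm (f 0) + norm (f x - f 0)"
      by (metis add.commute diff_add_cancel norm_triangle_ineq)
    also have "norm (f x - f 0) \<le> M' * norm (x - 0)" using lip[of 0 x] x norm_ge_zero[of x] by (smt (verit) norm_zero)
    also have "\<dots> \<le> M' * (2 * \<bar>R\<bar>)" using M'0 x by (intro mult_left_mono) auto
    finally show "norm (f x) \<le> N" using M'0 by (simp add: N_def)
    assume y: "norm y \<le> R"
    have "norm (f y - f x - D x (y - x)) \<le> M * (norm (y - x))\<^sup>2" using M[OF x y] by simp
    also have "\<dots> \<le> N * (norm (y - x))\<^sup>2" using N by (intro mult_right_mono) auto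
    finally show "norm (f y - f x - D x (y - x)) \<le> N * (norm (y - x))\<^sup>2" .
    have "norm (D y - D x) \<le> M * norm (y - x)" using M[OF x y] by simp
    also have "\<dots> \<le> N * norm (y - x)" using N by (intro mult_right_mono) auto
    finally show "norm (D y - D x) \<le> N * norm (y - x)" .
    show "norm (f y - f x) \<le> N * norm (y - x)"
      using lip[OF x y] N by (meson mult_right_mono norm_ge_zero order_trans)
  qed
qed

text \<open>A quadratic remainder on some small ball suffices. It serves for \<open>C11\<close> maps
  and for the time-one map in \<open>flow_C1\<close>, where the estimate holds only near the base
  orbit.\<close>

lemma has_derivative_quadratic:
  fixes f :: "'a::real_normed_vector \<Rightarrow> 'b::real_normed_vector"
  assumes "bounded_linear A" "r > 0" "\<And>y. dist y x < r \<Longrightarrow> norm (f y - f x - A (y - x)) \<le> M * (norm (y - x))\<^sup>2"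
  shows "(f has_derivative A) (at x)"
proof -
  have "((\<lambda>y. norm (f y - f x - A (y - x)) / norm (y - x)) \<longlongrightarrow> 0) (at x)"
  proof (rule Lim_null_comparison)
    show "\<forall>\<^sub>F y in at x. norm (norm (f y - f x - A (y - x)) / norm (y - x)) \<le> \<bar>M\<bar> * norm (y - x)"
      unfolding eventually_at
    proof (intro exI conjI ballI impI)
      show "r > 0" by fact
      fix y assume "y \<noteq> x \<and> dist y x < r"
      then have "norm (f y - f x - A (y - x)) \<le> M * (norm (y - x))\<^sup>2" "norm (y - x) > 0" using assms(3) by auto
      moreover have "M * (norm (y - x))\<^sup>2 \<le> \<bar>M\<bar> * (norm (y - x))\<^sup>2" by (intro mult_right_mono) auto
      ultimately have "norm (f y - f x - A (y - x)) \<le> \<bar>M\<bar> * (norm (y - x))\<^sup>2" by linarith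
      then have "norm (f y - f x - A (y - x)) \<le> \<bar>M\<bar> * norm (y - x) * norm (y - x)"
        by (simp add: power2_eq_square mult.assoc)
      then show "norm (norm (f y - f x - A (y - x)) / norm (y - x)) \<le> \<bar>M\<bar> * norm (y - x)"
        using \<open>norm (y - x) > 0\<close> by (simp add: pos_divide_le_eq)
    qed
    have "((\<lambda>y. \<bar>M\<bar> * norm (y - x)) \<longlongrightarrow> \<bar>M\<bar> * norm (x - x)) (at x)" by (intro tendsto_intros)
    thus "((\<lambda>y. \<bar>M\<bar> * norm (y - x)) \<longlongrightarrow> 0) (at x)" by simp
  qed
  then have "((\<lambda>y. norm ((f y - f x - A (y - x)) /\<^sub>R norm (y - x))) \<longlongrightarrow> 0) (at x)"
    by (simp add: divide_inverse mult.commute)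
  then show ?thesis using assms(1)
    unfolding has_derivative_iff_norm by (simp add: divide_inverse mult.commute)
qed

lemma C11_deriv:
  assumes "C11 f D" shows "(f has_derivative D x) (at x)"
proof -
  obtain M where M: "\<And>x' y. norm x' \<le> norm x + 1 \<Longrightarrow> norm y \<le> norm x + 1 \<Longrightarrow> norm (f y - f x' - D x' (y - x')) \<le> M * (norm (y - x'))\<^sup>2"
    using C11_bound[OF assms, of "norm x + 1"] by metis
  show ?thesis
  proof (rule has_derivative_quadratic[of _ 1])
    fix y assume "dist y x < 1"
    then have "norm y \<le> norm x + 1" using norm_triangle_ineq2[of y x] by (simp add: dist_norm)
    then show "norm (f y - f x - D x (y - x)) \<le> M * (norm (y - x))\<^sup>2" using M by auto
  qed (auto simp: blinfun.bounded_linear_right)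
qed

lemma C11_cont_deriv:
  assumes "C11 f D" shows "continuous_on S D"
proof -
  have "isCont D x" for x
  proof -
    obtain M where M: "M > 0" "\<And>x' y. norm x' \<le> norm x + 1 \<Longrightarrow> norm y \<le> norm x + 1 \<Longrightarrow> norm (D y - D x') \<le> M * norm (y - x')"
      using C11_bound[OF assms, of "norm x + 1"] by metis
    show ?thesis unfolding isCont_def
    proof (rule Lim_transform)
      show "((\<lambda>y. D x) \<longlongrightarrow> D x) (at x)" by simp
      show "((\<lambda>y. D y - D x) \<longlongrightarrow> 0) (at x)"
      proof (rule Lim_null_comparison)
        show "\<forall>\<^sub>F y in at x. norm (D y - D x) \<le> M * norm (y - x)"
          unfolding eventually_at
        proof (intro exI[of _ 1] conjI ballI impI)
          fix y assume "y \<noteq> x \<and> dist y x < 1"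
          then have "norm y \<le> norm x + 1" using norm_triangle_ineq2[of y x] by (simp add: dist_norm)
          then show "norm (D y - D x) \<le> M * norm (y - x)" using M(2)[of x y] by simp
        qed auto
        have "((\<lambda>y. M * norm (y - x)) \<longlongrightarrow> M * norm (x - x)) (at x)" by (intro tendsto_intros)
        thus "((\<lambda>y. M * norm (y - x)) \<longlongrightarrow> 0) (at x)" by simp
      qed
    qed
  qed
  then show ?thesis by (simp add: continuous_at_imp_continuous_on)
qed

lemma C11_cont: "C11 f D \<Longrightarrow> continuous_on S f"
  by (meson C11_deriv continuous_at_imp_continuous_on has_derivative_continuous)

definition smooth :: "('a::real_normed_vector \<Rightarrow> 'b::real_normed_vector) \<Rightarrow> bool" where
  "smooth f \<longleftrightarrow> (\<exists>D. C11 f D)"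

text \<open>\<open>M\<close> plays two roles: Lipschitz constant of \<open>f\<close>, and bound of
  \<open>f\<close> on the ball, hence the radius on which the constants of \<open>g\<close> are
  taken. The remainder splits into that of \<open>g\<close> at \<open>f x\<close> and the image
  under \<open>Dg (f x)\<close> of that of \<open>f\<close>.\<close>

lemma C11_compose:
  fixes f :: "'a::real_normed_vector \<Rightarrow> 'b::real_normed_vector" and g :: "'b \<Rightarrow> 'c::real_normed_vector"
  assumes f: "C11 f Df" and g: "C11 g Dg"
  shows "C11 (\<lambda>x. g (f x)) (\<lambda>x. Dg (f x) o\<^sub>L Df x)"
  unfolding C11_def
proof
  fix R
  obtain M where M: "M > 0"
    "\<And>x y. norm x \<le> R \<Longrightarrow> norm y \<le> R \<Longrightarrow> norm (f y - f x - Df x (y - x)) \<le> M * (norm (y - x))\<^sup>2"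
    "\<And>x. norm x \<le> R \<Longrightarrow> norm (Df x) \<le> M"
    "\<And>x y. norm x \<le> R \<Longrightarrow> norm y \<le> R \<Longrightarrow> norm (Df y - Df x) \<le> M * norm (y - x)"
    "\<And>x y. norm x \<le> R \<Longrightarrow> norm y \<le> R \<Longrightarrow> norm (f y - f x) \<le> M * norm (y - x)"
    "\<And>x. norm x \<le> R \<Longrightarrow> norm (f x) \<le> M"
    using C11_bound[OF f] by blast
  obtain N where N: "N > 0"
    "\<And>x y. norm x \<le> M \<Longrightarrow> norm y \<le> M \<Longrightarrow> norm (g y - g x - Dg x (y - x)) \<le> N * (norm (y - x))\<^sup>2"
    "\<And>x. norm x \<le> M \<Longrightarrow> norm (Dg x) \<le> N"
    "\<And>x y. norm x \<le> M \<Longrightarrow> norm y \<le> M \<Longrightarrow> norm (Dg y - Dg x) \<le> N * norm (y - x)"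
    using C11_bound[OF g] by metis
  define K where "K = N * M\<^sup>2 + N * M + N * M * M + N * M"
  have K: "N * M\<^sup>2 + N * M \<le> K" "N * M \<le> K" "N * M * M + N * M \<le> K"
    using M(1) N(1) by (auto simp: K_def)
  show "\<exists>M. \<forall>x y. norm x \<le> R \<longrightarrow> norm y \<le> R \<longrightarrow>
     norm (g (f y) - g (f x) - (Dg (f x) o\<^sub>L Df x) (y - x)) \<le> M * (norm (y - x))\<^sup>2 \<and>
     norm (Dg (f x) o\<^sub>L Df x) \<le> M \<and> norm ((Dg (f y) o\<^sub>L Df y) - (Dg (f x) o\<^sub>L Df x)) \<le> M * norm (y - x)"
  proof (intro exI[of _ K] allI impI conjI)
    fix x y :: 'a assume x: "norm x \<le> R" and y: "norm y \<le> R"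
    have fx: "norm (f x) \<le> M" and fy: "norm (f y) \<le> M" using M x y by auto
    have "norm (g (f y) - g (f x) - (Dg (f x) o\<^sub>L Df x) (y - x))
      = norm ((g (f y) - g (f x) - Dg (f x) (f y - f x)) + Dg (f x) (f y - f x - Df x (y - x)))"
      by (rule arg_cong[of _ _ norm]) (simp add: blinfun.diff_right)
    also have "\<dots> \<le> N * (norm (f y - f x))\<^sup>2 + norm (Dg (f x)) * norm (f y - f x - Df x (y - x))"
      by (intro norm_triangle_le add_mono N(2) fx fy norm_blinfun)
    also have "\<dots> \<le> N * (M * norm (y - x))\<^sup>2 + N * (M * (norm (y - x))\<^sup>2)"
      using N M(1) by (intro add_mono mult_mono mult_left_mono power_mono M(2,5) x y N(3) fx) auto
    also have "\<dots> = (N * M\<^sup>2 + N * M) * (norm (y - x))\<^sup>2" by (simp add: algebra_simps power2_eq_square)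
    also have "\<dots> \<le> K * (norm (y - x))\<^sup>2" using K by (intro mult_right_mono) auto
    finally show "norm (g (f y) - g (f x) - (Dg (f x) o\<^sub>L Df x) (y - x)) \<le> K * (norm (y - x))\<^sup>2" .
    have "norm (Dg (f x) o\<^sub>L Df x) \<le> norm (Dg (f x)) * norm (Df x)" by (rule norm_blinfun_compose)
    also have "\<dots> \<le> N * M" using N(1) by (intro mult_mono N M x fx) auto
    finally show "norm (Dg (f x) o\<^sub>L Df x) \<le> K" using K by simp
    have "(Dg (f y) o\<^sub>L Df y) - (Dg (f x) o\<^sub>L Df x) = ((Dg (f y) - Dg (f x)) o\<^sub>L Df y) + (Dg (f x) o\<^sub>L (Df y - Df x))"
      by (rule blinfun_eqI) (simp add: blinfun.diff_left blinfun.diff_right blinfun.add_left)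
    also have "norm \<dots> \<le> norm (Dg (f y) - Dg (f x)) * norm (Df y) + norm (Dg (f x)) * norm (Df y - Df x)"
      by (intro norm_triangle_le add_mono norm_blinfun_compose)
    also have "\<dots> \<le> (N * (M * norm (y - x))) * M + N * (M * norm (y - x))"
    proof (intro add_mono mult_mono)
      show "norm (Dg (f y) - Dg (f x)) \<le> N * (M * norm (y - x))"
        using N(4)[OF fx fy] M(5)[OF x y] N(1) by (meson mult_left_mono less_imp_le order_trans)
    qed (use M N x y fx fy in \<open>auto intro!: mult_nonneg_nonneg\<close>)
    also have "\<dots> = (N * M * M + N * M) * norm (y - x)" by (simp add: algebra_simps)
    also have "\<dots> \<le> K * norm (y - x)" using K by (intro mult_right_mono) auto
    finally show "norm ((Dg (f y) o\<^sub>L Df y) - (Dg (f x) o\<^sub>L Df x)) \<le> K * norm (y - x)" .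
  qed
qed

lemma C11_linear: "bounded_linear f \<Longrightarrow> C11 f (\<lambda>_. Blinfun f)"
  unfolding C11_def
  by (intro allI exI[of _ "norm (Blinfun f)"]) (auto simp: bounded_linear_Blinfun_apply linear_diff bounded_linear.linear)

lemma C11_const: "C11 (\<lambda>_. c) (\<lambda>_. 0)"
  unfolding C11_def by (intro allI exI[of _ 0]) auto

lemma C11_add:
  fixes f g :: "'a::real_normed_vector \<Rightarrow> 'b::real_normed_vector"
  assumes f: "C11 f Df" and g: "C11 g Dg"
  shows "C11 (\<lambda>x. f x + g x) (\<lambda>x. Df x + Dg x)"
  unfolding C11_def
proof
  fix R
  obtain M where M: "M > 0"
    "\<And>x y. norm x \<le> R \<Longrightarrow> norm y \<le> R \<Longrightarrow> norm (f y - f x - Df x (y - x)) \<le> M * (norm (y - x))\<^sup>2"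
    "\<And>x. norm x \<le> R \<Longrightarrow> norm (Df x) \<le> M"
    "\<And>x y. norm x \<le> R \<Longrightarrow> norm y \<le> R \<Longrightarrow> norm (Df y - Df x) \<le> M * norm (y - x)"
    using C11_bound[OF f] by metis
  obtain N where N: "N > 0"
    "\<And>x y. norm x \<le> R \<Longrightarrow> norm y \<le> R \<Longrightarrow> norm (g y - g x - Dg x (y - x)) \<le> N * (norm (y - x))\<^sup>2"
    "\<And>x. norm x \<le> R \<Longrightarrow> norm (Dg x) \<le> N"
    "\<And>x y. norm x \<le> R \<Longrightarrow> norm y \<le> R \<Longrightarrow> norm (Dg y - Dg x) \<le> N * norm (y - x)"
    using C11_bound[OF g] by metis
  show "\<exists>M. \<forall>x y. norm x \<le> R \<longrightarrow> norm y \<le> R \<longrightarrow>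
     norm (f y + g y - (f x + g x) - (Df x + Dg x) (y - x)) \<le> M * (norm (y - x))\<^sup>2 \<and>
     norm (Df x + Dg x) \<le> M \<and> norm (Df y + Dg y - (Df x + Dg x)) \<le> M * norm (y - x)"
  proof (intro exI[of _ "M + N"] allI impI conjI)
    fix x y :: 'a assume x: "norm x \<le> R" and y: "norm y \<le> R"
    show "norm (f y + g y - (f x + g x) - (Df x + Dg x) (y - x)) \<le> (M + N) * (norm (y - x))\<^sup>2"
      using norm_triangle_ineq[of "f y - f x - Df x (y - x)" "g y - g x - Dg x (y - x)"] M(2)[OF x y] N(2)[OF x y]
      by (simp add: blinfun.add_left algebra_simps)
    show "norm (Df x + Dg x) \<le> M + N" using M(3)[OF x] N(3)[OF x] by (rule norm_triangle_mono)
    show "norm (Df y + Dg y - (Df x + Dg x)) \<le> (M + N) * norm (y - x)"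
      using norm_triangle_ineq[of "Df y - Df x" "Dg y - Dg x"] M(4)[OF x y] N(4)[OF x y]
      by (simp add: algebra_simps)
  qed
qed

lemma smooth_compose: "smooth f \<Longrightarrow> smooth g \<Longrightarrow> smooth (\<lambda>x. g (f x))"
  unfolding smooth_def using C11_compose by blast
lemma smooth_linear: "bounded_linear f \<Longrightarrow> smooth f" unfolding smooth_def using C11_linear by blast
lemma smooth_const: "smooth (\<lambda>_. c)" unfolding smooth_def using C11_const by blast
lemma smooth_add: "smooth f \<Longrightarrow> smooth g \<Longrightarrow> smooth (\<lambda>x. f x + g x)"
  unfolding smooth_def using C11_add by blast
lemma smooth_ident: "smooth (\<lambda>x. x)" by (rule smooth_linear) (rule bounded_linear_ident)
lemma smooth_fst: "smooth f \<Longrightarrow> smooth (\<lambda>x. fst (f x))"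
  by (rule smooth_compose[OF _ smooth_linear[OF bounded_linear_fst]])
lemma smooth_snd: "smooth f \<Longrightarrow> smooth (\<lambda>x. snd (f x))"
  by (rule smooth_compose[OF _ smooth_linear[OF bounded_linear_snd]])
lemma smooth_minus: "smooth f \<Longrightarrow> smooth (\<lambda>x. - f x)"
  by (rule smooth_compose[OF _ smooth_linear[OF bounded_linear_minus[OF bounded_linear_ident]]])
lemma smooth_diff: "smooth f \<Longrightarrow> smooth g \<Longrightarrow> smooth (\<lambda>x. f x - g x)"
  using smooth_add[of f "\<lambda>x. - g x"] smooth_minus[of g] by simp

lemma smooth_Pair: assumes "smooth f" "smooth g" shows "smooth (\<lambda>x. (f x, g x))"
proof -
  have "smooth (\<lambda>x. (f x, 0) + (0, g x))"
    by (intro smooth_add smooth_compose[OF assms(1), of "\<lambda>y. (y, 0)"] smooth_compose[OF assms(2), of "\<lambda>y. (0, y)"]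
        smooth_linear bounded_linear_Pair bounded_linear_ident bounded_linear_zero)
  then show ?thesis by simp
qed

text \<open>Products reduce to squares by polarisation.\<close>

lemma smooth_square: "smooth (\<lambda>x::real. x * x)"
  unfolding smooth_def C11_def
proof (intro exI[of _ "\<lambda>x. blinfun_scaleR_right (2 * x)"] allI)
  fix R :: real
  have eq: "y * y - x * x - 2 * x * (y - x) = (y - x)\<^sup>2" for x y :: real
    by (simp add: power2_eq_square algebra_simps)
  have nb: "norm (blinfun_scaleR_right c :: real \<Rightarrow>\<^sub>L real) \<le> \<bar>c\<bar>" for c
    by (rule norm_blinfun_bound) (auto simp: abs_mult)
  have d: "blinfun_scaleR_right a - blinfun_scaleR_right b = (blinfun_scaleR_right (a - b) :: real \<Rightarrow>\<^sub>L real)" for a b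
    by (rule blinfun_eqI) (simp add: blinfun.diff_left algebra_simps)
  show "\<exists>M. \<forall>x y. norm x \<le> R \<longrightarrow> norm y \<le> R \<longrightarrow>
     norm (y * y - x * x - blinfun_scaleR_right (2 * x) (y - x)) \<le> M * (norm (y - x))\<^sup>2 \<and>
     norm (blinfun_scaleR_right (2 * x) :: real \<Rightarrow>\<^sub>L real) \<le> M \<and>
     norm (blinfun_scaleR_right (2 * y) - (blinfun_scaleR_right (2 * x) :: real \<Rightarrow>\<^sub>L real)) \<le> M * norm (y - x)"
  proof (intro exI[of _ "2 * \<bar>R\<bar> + 2"] allI impI conjI)
    fix x y :: real assume x: "norm x \<le> R" and y: "norm y \<le> R"
    have "1 * (y - x)\<^sup>2 \<le> (2 * \<bar>R\<bar> + 2) * (y - x)\<^sup>2" by (intro mult_right_mono) auto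
    then show "norm (y * y - x * x - blinfun_scaleR_right (2 * x) (y - x)) \<le> (2 * \<bar>R\<bar> + 2) * (norm (y - x))\<^sup>2"
      using eq[of y x] by simp
    show "norm (blinfun_scaleR_right (2 * x) :: real \<Rightarrow>\<^sub>L real) \<le> 2 * \<bar>R\<bar> + 2" using nb[of "2*x"] x by simp
    have "\<bar>2 * y - 2 * x\<bar> \<le> (2 * \<bar>R\<bar> + 2) * \<bar>y - x\<bar>"
    proof -
      have "2 * \<bar>y - x\<bar> \<le> (2 * \<bar>R\<bar> + 2) * \<bar>y - x\<bar>" by (rule mult_right_mono) auto
      moreover have "\<bar>2 * y - 2 * x\<bar> = 2 * \<bar>y - x\<bar>" by (simp add: abs_if)
      ultimately show ?thesis by linarith
    qed
    then show "norm (blinfun_scaleR_right (2 * y) - (blinfun_scaleR_right (2 * x) :: real \<Rightarrow>\<^sub>L real)) \<le> (2 * \<bar>R\<bar> + 2) * norm (y - x)"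
      unfolding d using nb[of "2 * y - 2 * x"] by simp
  qed
qed

lemma smooth_mult:
  fixes f g :: "_ \<Rightarrow> real"
  assumes "smooth f" "smooth g" shows "smooth (\<lambda>x. f x * g x)"
proof -
  have "smooth (\<lambda>x. (1/4) *\<^sub>R ((f x + g x) * (f x + g x) - (f x - g x) * (f x - g x)))"
    by (intro smooth_compose[OF _ smooth_linear[OF bounded_linear_scaleR_right]] smooth_diff
        smooth_compose[OF _ smooth_square] smooth_add assms)
  then show ?thesis by (simp add: algebra_simps)
qed

lemma smooth_power: "smooth f \<Longrightarrow> smooth (\<lambda>x. f x ^ k :: real)"
  by (induction k) (auto intro: smooth_const smooth_mult)

lemma smooth_sum: "(\<And>i. i \<in> A \<Longrightarrow> smooth (f i)) \<Longrightarrow> smooth (\<lambda>x. \<Sum>i\<in>A. f i x)"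
  by (induction A rule: infinite_finite_induct) (auto intro: smooth_const smooth_add)

lemmas smooth_intros = smooth_const smooth_ident smooth_fst smooth_snd smooth_add smooth_minus smooth_diff
  smooth_Pair smooth_mult smooth_power smooth_sum

lemma smooth_scaleR:
  fixes g :: "_ \<Rightarrow> real \<times> real"
  assumes "smooth f" "smooth g" shows "smooth (\<lambda>x. f x *\<^sub>R g x)"
proof -
  have "smooth (\<lambda>x. (f x * fst (g x), f x * snd (g x)))" by (intro smooth_intros assms)
  then show ?thesis by (simp add: scaleR_prod_def)
qed


section \<open>Gronwall's inequality and existence of solutions\<close>

lemma gronwall:
  fixes z :: "real \<Rightarrow> 'a::real_inner"
  assumes z: "\<And>t. t \<in> {0..1} \<Longrightarrow> (z has_vector_derivative z' t) (at t within {0..1})"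
    and b: "\<And>t. t \<in> {0..1} \<Longrightarrow> norm (z' t) \<le> K * norm (z t) + c"
    and c: "c \<ge> 0" and K: "K \<ge> 0" and t: "t \<in> {0..1}"
  shows "norm (z t) \<le> (norm (z 0) + c) * exp (K + 1)"
proof -
  \<comment> \<open>Adding the square of c absorbs the inhomogeneous term through 2 |z| c \<le>
    |z|^2 + c^2, and the squared norm is differentiable also where z vanishes. With the rate 2 K + 1
    this function decreases.\<close>
  define g where "g = (\<lambda>t. ((norm (z t))\<^sup>2 + c\<^sup>2) * exp (- (2 * K + 1) * t))"
  have zc: "continuous_on {0..1} z"
    using z by (meson continuous_on_eq_continuous_within has_vector_derivative_continuous)
  have "g t \<le> g 0"
  proof (rule DERIV_nonpos_imp_decreasing_open[of 0 t])
    show "0 \<le> t" using t by simp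
    show "continuous_on {0..t} g" unfolding g_def using t
      by (intro continuous_intros continuous_on_subset[OF zc]) auto
    fix s assume s: "0 < s" "s < t"
    then have s1: "s \<in> {0..1}" "s \<in> interior {0..1}" using t by auto
    have "(z has_vector_derivative z' s) (at s)" using z[OF s1(1)] s1(2) by (metis at_within_interior)
    then have d: "((\<lambda>t. (norm (z t))\<^sup>2) has_real_derivative 2 * (z s \<bullet> z' s)) (at s)"
      unfolding power2_norm_eq_inner has_field_derivative_def has_vector_derivative_def
      by (auto intro!: derivative_eq_intros simp: fun_eq_iff inner_commute)
    have "(g has_real_derivative 2 * (z s \<bullet> z' s) * exp (- (2 * K + 1) * s)
        - (2 * K + 1) * ((norm (z s))\<^sup>2 + c\<^sup>2) * exp (- (2 * K + 1) * s)) (at s)"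
      unfolding g_def by (rule derivative_eq_intros d refl)+ (simp add: algebra_simps)
    moreover have "2 * (z s \<bullet> z' s) \<le> (2 * K + 1) * ((norm (z s))\<^sup>2 + c\<^sup>2)"
    proof -
      have "z s \<bullet> z' s \<le> norm (z s) * norm (z' s)" by (rule norm_cauchy_schwarz)
      also have "\<dots> \<le> norm (z s) * (K * norm (z s) + c)" using b[OF s1(1)] by (intro mult_left_mono) auto
      finally have "2 * (z s \<bullet> z' s) \<le> 2 * K * (norm (z s))\<^sup>2 + 2 * norm (z s) * c"
        by (simp add: algebra_simps power2_eq_square)
      moreover have "2 * norm (z s) * c \<le> (norm (z s))\<^sup>2 + c\<^sup>2" by (rule sum_squares_bound)
      moreover have "0 \<le> 2 * K * c\<^sup>2" using K by simp
      ultimately show ?thesis by (simp add: algebra_simps)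
    qed
    then have "2 * (z s \<bullet> z' s) * exp (- (2 * K + 1) * s)
        - (2 * K + 1) * ((norm (z s))\<^sup>2 + c\<^sup>2) * exp (- (2 * K + 1) * s) \<le> 0"
      by (simp add: mult_right_mono)
    ultimately show "\<exists>y. (g has_real_derivative y) (at s) \<and> y \<le> 0" by blast
  qed
  then have "((norm (z t))\<^sup>2 + c\<^sup>2) * exp (- (2 * K + 1) * t) \<le> (norm (z 0))\<^sup>2 + c\<^sup>2"
    by (simp add: g_def)
  then have "((norm (z t))\<^sup>2 + c\<^sup>2) * exp (- (2 * K + 1) * t) * exp ((2 * K + 1) * t) \<le> ((norm (z 0))\<^sup>2 + c\<^sup>2) * exp ((2 * K + 1) * t)"
    by (intro mult_right_mono) auto
  moreover have "((norm (z t))\<^sup>2 + c\<^sup>2) * exp (- (2 * K + 1) * t) * exp ((2 * K + 1) * t) = (norm (z t))\<^sup>2 + c\<^sup>2"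
  proof -
    have h: "exp (- (2 * K + 1) * t) * exp ((2 * K + 1) * t) = 1" by (simp add: algebra_simps flip: exp_add)
    show ?thesis unfolding mult.assoc[of "(norm (z t))\<^sup>2 + c\<^sup>2"] h by simp
  qed
  ultimately have "((norm (z t))\<^sup>2 + c\<^sup>2) \<le> ((norm (z 0))\<^sup>2 + c\<^sup>2) * exp ((2 * K + 1) * t)" by linarith
  also have "\<dots> \<le> (norm (z 0) + c)\<^sup>2 * exp (2 * (K + 1))"
  proof (intro mult_mono)
    show "(norm (z 0))\<^sup>2 + c\<^sup>2 \<le> (norm (z 0) + c)\<^sup>2" using c by (simp add: power2_sum)
    have "(2 * K + 1) * t \<le> (2 * K + 1) * 1" using t K by (intro mult_left_mono) auto
    then show "exp ((2 * K + 1) * t) \<le> exp (2 * (K + 1))" by simp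
  qed auto
  also have "\<dots> = ((norm (z 0) + c) * exp (K + 1))\<^sup>2" by (simp only: power_mult_distrib exp_double)
  finally have "(norm (z t))\<^sup>2 + c\<^sup>2 \<le> ((norm (z 0) + c) * exp (K + 1))\<^sup>2" .
  then have "(norm (z t))\<^sup>2 \<le> ((norm (z 0) + c) * exp (K + 1))\<^sup>2" by (rule order_trans[rotated]) simp
  then show ?thesis by (rule power2_le_imp_le) (use c in simp)
qed

text \<open>Picard iteration in the weighted norm \<open>sup\<^sub>t exp (- 2 L t) |x t|\<close>, in which it contracts globally.\<close>

lemma picard:
  fixes G :: "real \<Rightarrow> 'a::euclidean_space \<Rightarrow> 'a"
  assumes cont: "\<And>x. continuous_on {0..1} x \<Longrightarrow> continuous_on {0..1} (\<lambda>t. G t (x t))"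
    and lip: "\<And>t x y. t \<in> {0..1} \<Longrightarrow> norm (G t x - G t y) \<le> L * norm (x - y)"
  shows "\<exists>x. x 0 = p \<and> (\<forall>t\<in>{0..1}. (x has_vector_derivative G t (x t)) (at t within {0..1}))"
proof -
  \<comment> \<open>With this rate the contraction factor \<open>\<bar>L\<bar> / K\<close> of the
    weighted integral operator is at most 1/2.\<close>
  define K where "K = 2 * \<bar>L\<bar> + 1"
  have K: "K > 0" by (simp add: K_def add_nonneg_pos)
  \<comment> \<open>Clamping time to the unit interval turns the iterates into bounded continuous
    functions on the whole line, a complete space. The unknown will be u t = exp (- K t) x t, so
    that the weight sits in the unknown and the plain supremum norm can be used.\<close>
  define c where "c = (\<lambda>t::real. max 0 (min 1 t))"
  have c01: "c t \<in> {0..1}" for t by (auto simp: c_def)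
  have cc: "continuous_on S c" for S unfolding c_def by (intro continuous_intros)
  define I where "I = (\<lambda>(u::real \<Rightarrow>\<^sub>C 'a) t. integral {0..t} (\<lambda>s. G s (exp (K * s) *\<^sub>R apply_bcontfun u s)))"
  have gc: "continuous_on {0..1} (\<lambda>s. G s (exp (K * s) *\<^sub>R apply_bcontfun u s))" for u
    by (intro cont continuous_intros) auto
  have gi: "(\<lambda>s. G s (exp (K * s) *\<^sub>R apply_bcontfun u s)) integrable_on {0..t}" if "t \<in> {0..1}" for u :: "real \<Rightarrow>\<^sub>C 'a" and t
    using that by (intro integrable_continuous_real continuous_on_subset[OF gc]) auto
  have Ic: "continuous_on {0..1} (I u)" for u
    unfolding I_def by (rule indefinite_integral_continuous_1) (rule integrable_continuous_real[OF gc])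
  define A where "A = (\<lambda>u t. exp (- K * c t) *\<^sub>R (p + I u (c t)))"
  have Ab: "A u \<in> bcontfun" for u
  proof -
    have 1: "continuous_on UNIV (A u)" unfolding A_def
      by (intro continuous_intros continuous_on_compose2[OF Ic] cc) (use c01 in auto)
    define B where "B = (\<lambda>t. exp (- K * t) *\<^sub>R (p + I u t))"
    have "continuous_on {0..1} B" unfolding B_def by (intro continuous_intros Ic)
    then have "bounded (B ` {0..1})" by (intro compact_imp_bounded compact_continuous_image) auto
    moreover have "range (A u) \<subseteq> B ` {0..1}" using c01 by (auto simp: A_def B_def)
    ultimately have "bounded (range (A u))" by (rule bounded_subset)
    with 1 show ?thesis by (simp add: bcontfun_def)
  qed
  define T where "T = (\<lambda>u. Bcontfun (A u))"
  have T: "apply_bcontfun (T u) = A u" for u unfolding T_def using Ab by (rule Bcontfun_inverse)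
  have "\<exists>!u. T u = u"
  proof (rule banach_fix_type[of "1/2"])
    show "\<forall>u v. dist (T u) (T v) \<le> 1/2 * dist u v"
    proof (intro allI dist_bound)
      fix u v :: "real \<Rightarrow>\<^sub>C 'a" and t
      define d where "d = dist u v"
      have d: "norm (apply_bcontfun u s - apply_bcontfun v s) \<le> d" for s unfolding d_def
        by (metis dist_bounded dist_norm)
      have ct: "c t \<in> {0..1}" by (rule c01)
      have "norm (I u (c t) - I v (c t)) = norm (integral {0..c t} (\<lambda>s. G s (exp (K * s) *\<^sub>R apply_bcontfun u s) - G s (exp (K * s) *\<^sub>R apply_bcontfun v s)))"
        unfolding I_def using gi[OF ct] by (subst integral_diff) auto
      also have "\<dots> \<le> integral {0..c t} (\<lambda>s. \<bar>L\<bar> * d * exp (K * s))"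
      proof (rule integral_norm_bound_integral)
        show "(\<lambda>s. \<bar>L\<bar> * d * exp (K * s)) integrable_on {0..c t}" by (intro integrable_continuous_real continuous_intros)
        fix s assume s: "s \<in> {0..c t}"
        then have "s \<in> {0..1}" using ct by auto
        then have "norm (G s (exp (K * s) *\<^sub>R apply_bcontfun u s) - G s (exp (K * s) *\<^sub>R apply_bcontfun v s)) \<le> L * norm (exp (K * s) *\<^sub>R (apply_bcontfun u s - apply_bcontfun v s))"
          using lip by (metis scaleR_diff_right)
        also have "\<dots> \<le> \<bar>L\<bar> * (exp (K * s) * d)"
          using d by (intro mult_mono) auto
        finally show "norm (G s (exp (K * s) *\<^sub>R apply_bcontfun u s) - G s (exp (K * s) *\<^sub>R apply_bcontfun v s)) \<le> \<bar>L\<bar> * d * exp (K * s)"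
          by (simp add: mult_ac)
      qed (intro integrable_diff gi ct)
      also have "\<dots> = \<bar>L\<bar> * d * (exp (K * c t) / K - exp (K * 0) / K)"
      proof -
        have "((\<lambda>s. exp (K * s)) has_integral (exp (K * c t) / K - exp (K * 0) / K)) {0..c t}"
          using K ct by (intro fundamental_theorem_of_calculus)
            (auto simp flip: has_real_derivative_iff_has_vector_derivative intro!: derivative_eq_intros)
        then show ?thesis by (simp add: integral_unique)
      qed
      also have "\<dots> \<le> \<bar>L\<bar> * d * (exp (K * c t) / K)"
        using K order_trans[OF norm_ge_zero d[of 0]] by (intro mult_left_mono mult_nonneg_nonneg) auto
      also have "\<dots> = (\<bar>L\<bar> / K) * d * exp (K * c t)" by simp
      also have "\<dots> \<le> (1/2) * d * exp (K * c t)"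
        using order_trans[OF norm_ge_zero d[of 0]] K
        by (intro mult_right_mono) (auto simp: K_def field_simps)
      finally have i: "norm (I u (c t) - I v (c t)) \<le> (1/2) * d * exp (K * c t)" .
      have "dist (A u t) (A v t) = exp (- K * c t) * norm (I u (c t) - I v (c t))"
        unfolding A_def dist_norm by (simp flip: scaleR_diff_right)
      also have "\<dots> \<le> exp (- K * c t) * ((1/2) * d * exp (K * c t))" using i by (intro mult_left_mono) auto
      also have "\<dots> = (1/2) * d" by (simp add: exp_minus)
      finally show "dist (T u t) (T v t) \<le> 1 / 2 * dist u v" unfolding T d_def .
    qed
  qed auto
  then obtain u where u: "T u = u" by blast
  define x where "x = (\<lambda>t. p + I u t)"
  have xu: "x t = exp (K * t) *\<^sub>R apply_bcontfun u t" if "t \<in> {0..1}" for t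
  proof -
    have "c t = t" using that by (auto simp: c_def)
    then have "apply_bcontfun u t = exp (- K * t) *\<^sub>R x t" using T[of u] unfolding u x_def A_def by simp
    then show ?thesis by (simp add: exp_minus)
  qed
  show ?thesis
  proof (intro exI[of _ x] conjI ballI)
    show "x 0 = p" by (simp add: x_def I_def)
    fix t :: real assume t: "t \<in> {0..1}"
    have "(I u has_vector_derivative G t (exp (K * t) *\<^sub>R apply_bcontfun u t)) (at t within {0..1})"
      unfolding I_def by (rule integral_has_vector_derivative[OF gc t])
    then have "(x has_vector_derivative 0 + G t (exp (K * t) *\<^sub>R apply_bcontfun u t)) (at t within {0..1})"
      unfolding x_def by (intro has_vector_derivative_add has_vector_derivative_const)
    then show "(x has_vector_derivative G t (x t)) (at t within {0..1})" using xu[OF t] by simp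
  qed
qed

section \<open>The time-one map and its derivative\<close>

definition ode_sol :: "('a::real_normed_vector \<Rightarrow> 'a) \<Rightarrow> (real \<Rightarrow> 'a) \<Rightarrow> bool" where
  "ode_sol F x \<longleftrightarrow> (\<forall>t\<in>{0..1}. (x has_vector_derivative F (x t)) (at t within {0..1}))"

definition var_sol :: "('a::real_normed_vector \<Rightarrow> 'a \<Rightarrow>\<^sub>L 'a) \<Rightarrow> (real \<Rightarrow> 'a) \<Rightarrow> (real \<Rightarrow> 'a) \<Rightarrow> bool" where
  "var_sol D x u \<longleftrightarrow> (\<forall>t\<in>{0..1}. (u has_vector_derivative D (x t) (u t)) (at t within {0..1}))"

lemma ode_sol_cont: "ode_sol F x \<Longrightarrow> continuous_on {0..1} x"
  unfolding ode_sol_def by (meson continuous_on_eq_continuous_within has_vector_derivative_continuous)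

text \<open>Composing the field with the projection to a large ball makes it globally Lipschitz, so
  solutions exist for every initial value; by Gronwall, those that start near \<open>x 0\<close>
  remain in the ball and solve the original equation. Gronwall again compares the difference of two
  solutions with the first variation. The error is quadratic with a constant uniform in the base
  point, and this uniformity also makes the derivative continuous.\<close>

lemma flow_C1:
  fixes F :: "'a::euclidean_space \<Rightarrow> 'a"
  assumes F: "C11 F D" and x: "ode_sol F x"
  obtains r C X \<Phi> where "r > 0" "C \<ge> 0"
    "\<And>q. q \<in> ball (x 0) r \<Longrightarrow> X q 0 = q \<and> ode_sol F (X q)"
    "\<And>t. t \<in> {0..1} \<Longrightarrow> X (x 0) t = x t"
    "\<And>q q' t. q \<in> ball (x 0) r \<Longrightarrow> q' \<in> ball (x 0) r \<Longrightarrow> t \<in> {0..1} \<Longrightarrow> norm (X q t - X q' t) \<le> C * norm (q - q')"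
    "\<And>q. q \<in> ball (x 0) r \<Longrightarrow> ((\<lambda>q. X q 1) has_derivative blinfun_apply (\<Phi> q)) (at q)"
    "continuous_on (ball (x 0) r) \<Phi>"
    "\<And>q u. q \<in> ball (x 0) r \<Longrightarrow> var_sol D (X q) u \<Longrightarrow> \<Phi> q (u 0) = u 1"
    "\<And>q h. q \<in> ball (x 0) r \<Longrightarrow> \<exists>u. u 0 = h \<and> var_sol D (X q) u"
proof -
  have "bounded (x ` {0..1})" using ode_sol_cont[OF x] by (intro compact_imp_bounded compact_continuous_image) auto
  then obtain R0 where R0: "\<And>t. t \<in> {0..1} \<Longrightarrow> norm (x t) \<le> R0" unfolding bounded_iff by blast
  define R where "R = R0 + 1"
  have R: "R > 0" using R0[of 0] norm_ge_zero[of "x 0"] unfolding R_def by (smt (verit) atLeastAtMost_iff zero_le_one)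
  obtain M where M: "M > 0"
    "\<And>x y. norm x \<le> R \<Longrightarrow> norm y \<le> R \<Longrightarrow> norm (F y - F x - D x (y - x)) \<le> M * (norm (y - x))\<^sup>2"
    "\<And>x. norm x \<le> R \<Longrightarrow> norm (D x) \<le> M"
    "\<And>x y. norm x \<le> R \<Longrightarrow> norm y \<le> R \<Longrightarrow> norm (F y - F x) \<le> M * norm (y - x)"
    using C11_bound[OF F] by metis
  define pr where "pr = closest_point (cball (0::'a) R)"
  have pr1: "norm (pr y) \<le> R" for y
    using closest_point_in_set[of "cball (0::'a) R" y] R by (auto simp: pr_def)
  have pr2: "norm y \<le> R \<Longrightarrow> pr y = y" for y by (simp add: pr_def closest_point_self)
  have pr3: "norm (pr y - pr z) \<le> norm (y - z)" for y z
    using closest_point_lipschitz[of "cball (0::'a) R" y z] R by (simp add: pr_def dist_norm)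
  define G where "G = (\<lambda>y. F (pr y))"
  have Glip: "norm (G y - G z) \<le> M * norm (y - z)" for y z
    unfolding G_def using M(4)[OF pr1 pr1, of y z] pr3[of y z] M(1) by (meson less_imp_le mult_left_mono order_trans)
  have Gc: "continuous_on UNIV G"
    by (rule lipschitz_on_continuous_on[of M]) (use Glip M(1) in \<open>auto simp: lipschitz_on_def dist_norm\<close>)
  have "\<exists>X. X 0 = q \<and> ode_sol G X" for q unfolding ode_sol_def
    by (rule picard[of "\<lambda>_. G"]) (auto intro!: continuous_on_compose2[OF Gc] Glip)
  then obtain X where X: "\<And>q. X q 0 = q" "\<And>q. ode_sol G (X q)" by metis
  define C where "C = exp (M + 1)"
  have close: "norm (y t - z t) \<le> C * norm (y 0 - z 0)" if "ode_sol G y" "ode_sol G z" "t \<in> {0..1}" for y z t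
  proof -
    have "norm (y t - z t) \<le> (norm (y 0 - z 0) + 0) * exp (M + 1)"
    proof (rule gronwall)
      show "\<And>t. t \<in> {0..1} \<Longrightarrow> ((\<lambda>t. y t - z t) has_vector_derivative G (y t) - G (z t)) (at t within {0..1})"
        using that unfolding ode_sol_def by (intro has_vector_derivative_diff) auto
      show "\<And>t. norm (G (y t) - G (z t)) \<le> M * norm (y t - z t) + 0" using Glip by simp
    qed (use M that in auto)
    then show ?thesis by (simp add: C_def mult.commute)
  qed
  have xG: "ode_sol G x" using x unfolding ode_sol_def G_def
    using R0 by (metis R_def less_add_one less_le order_trans pr2)
  have Xx: "X (x 0) t = x t" if "t \<in> {0..1}" for t
    using close[OF X(2)[of "x 0"] xG that] X(1) by simp
  \<comment> \<open>Starting within 1/C of \<open>x 0\<close>, a solution stays within distance 1 of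
    \<open>x\<close>, hence in the ball of radius \<open>R = R0 + 1\<close>, where the truncation
    changes nothing.\<close>
  define r where "r = 1 / C"
  have C: "C > 0" by (simp add: C_def)
  have r: "r > 0" using C by (simp add: r_def)
  have XR: "norm (X q t) \<le> R" if "q \<in> ball (x 0) r" "t \<in> {0..1}" for q t
  proof -
    have "norm (X q t - x t) \<le> C * norm (q - x 0)" using close[OF X(2) xG that(2), of q] X(1) by simp
    also have "\<dots> \<le> C * r" using that C by (intro mult_left_mono) (auto simp: dist_norm norm_minus_commute)
    finally show ?thesis using R0[OF that(2)] C norm_triangle_ineq2[of "X q t" "x t"] by (auto simp: R_def r_def)
  qed
  have XF: "ode_sol F (X q)" if "q \<in> ball (x 0) r" for q
    using X(2)[of q] XR[OF that] unfolding ode_sol_def G_def by (simp add: pr2)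
  \<comment> \<open>Any choice of variation will do: solutions of the variational equation are
    determined by their initial value, and this makes the end value linear in
    \<open>h\<close>.\<close>
  define U where "U = (\<lambda>q h. SOME u. u 0 = h \<and> var_sol D (X q) u)"
  have ex: "\<exists>u. u 0 = h \<and> var_sol D (X q) u" if q: "q \<in> ball (x 0) r" for q h
    unfolding var_sol_def
  proof (rule picard[of "\<lambda>t. blinfun_apply (D (X q t))" M])
    show "continuous_on {0..1} (\<lambda>t. D (X q t) (y t))" if "continuous_on {0..1} y" for y
      by (intro continuous_intros that continuous_on_compose2[OF C11_cont_deriv[OF F, of UNIV] ode_sol_cont[OF X(2)]]) auto
    fix t y z assume t: "t \<in> {0..1::real}"
    show "norm (D (X q t) y - D (X q t) z) \<le> M * norm (y - z)"
      using norm_blinfun[of "D (X q t)" "y - z"] M(3)[OF XR[OF q t]]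
      by (simp add: blinfun.diff_right) (meson mult_right_mono norm_ge_zero order_trans)
  qed
  have U: "U q h 0 = h" "var_sol D (X q) (U q h)" if "q \<in> ball (x 0) r" for q h
    using someI_ex[OF ex[OF that, of h]] unfolding U_def by auto
  have vb: "norm (u t) \<le> C * norm (u 0)" if "q \<in> ball (x 0) r" "var_sol D (X q) u" "t \<in> {0..1}" for q u t
  proof -
    have "norm (u t) \<le> (norm (u 0) + 0) * exp (M + 1)"
    proof (rule gronwall)
      show "\<And>t. t \<in> {0..1} \<Longrightarrow> (u has_vector_derivative D (X q t) (u t)) (at t within {0..1})"
        using that unfolding var_sol_def by auto
      fix t assume t: "t \<in> {0..1::real}"
      show "norm (D (X q t) (u t)) \<le> M * norm (u t) + 0"
        using norm_blinfun[of "D (X q t)" "u t"] M(3)[OF XR[OF that(1) t]]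
        by (simp) (meson mult_right_mono norm_ge_zero order_trans)
    qed (use M that in auto)
    then show ?thesis by (simp add: C_def mult.commute)
  qed
  have vadd: "var_sol D (X q) (\<lambda>t. a *\<^sub>R u t + v t)" if "var_sol D (X q) u" "var_sol D (X q) v" for q u v and a :: real
    unfolding var_sol_def
  proof
    fix t :: real assume t: "t \<in> {0..1}"
    have "((\<lambda>t. a *\<^sub>R u t + v t) has_vector_derivative a *\<^sub>R D (X q t) (u t) + D (X q t) (v t)) (at t within {0..1})"
      using that t unfolding var_sol_def
      by (intro has_vector_derivative_add bounded_linear.has_vector_derivative[OF bounded_linear_scaleR_right]) auto
    then show "((\<lambda>t. a *\<^sub>R u t + v t) has_vector_derivative D (X q t) (a *\<^sub>R u t + v t)) (at t within {0..1})"
      by (simp add: blinfun.add_right blinfun.scaleR_right)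
  qed
  have uniq: "u 1 = v 1" if "q \<in> ball (x 0) r" "var_sol D (X q) u" "var_sol D (X q) v" "u 0 = v 0" for q u v
    using vb[OF that(1) vadd[OF that(3,2), of "-1"], of 1] that(4) by simp
  have lin: "bounded_linear (\<lambda>h. U q h 1)" if q: "q \<in> ball (x 0) r" for q
  proof (rule bounded_linear_intro[where K=C])
    have *: "U q (a *\<^sub>R h + k) 1 = a *\<^sub>R U q h 1 + U q k 1" for a h k
      using uniq[OF q U(2)[OF q] vadd[OF U(2)[OF q] U(2)[OF q]], of "a *\<^sub>R h + k" a h k] U(1)[OF q] by simp
    have U0: "U q 0 1 = 0" using vb[OF q U(2)[OF q], of 1 0] U(1)[OF q] by simp
    show "U q (h + k) 1 = U q h 1 + U q k 1" for h k using *[of 1 h k] by simp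
    show "U q (a *\<^sub>R h) 1 = a *\<^sub>R U q h 1" for a h using *[of a h 0] U0 by simp
    show "norm (U q h 1) \<le> norm h * C" for h using vb[OF q U(2)[OF q], of 1 h] U(1)[OF q] by (simp add: mult.commute)
  qed
  define \<Phi> where "\<Phi> = (\<lambda>q. Blinfun (\<lambda>h. U q h 1))"
  have \<Phi>: "blinfun_apply (\<Phi> q) = (\<lambda>h. U q h 1)" if "q \<in> ball (x 0) r" for q
    unfolding \<Phi>_def by (rule bounded_linear_Blinfun_apply[OF lin[OF that]])
  define K where "K = M * C\<^sup>2 * C"
  have K0: "K \<ge> 0" using M C by (simp add: K_def)
  have quad: "norm (X q' 1 - X q 1 - \<Phi> q (q' - q)) \<le> K * (norm (q' - q))\<^sup>2"
    if q: "q \<in> ball (x 0) r" and q': "q' \<in> ball (x 0) r" for q q'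
  proof -
    let ?u = "U q (q' - q)"
    have "norm (X q' 1 - X q 1 - ?u 1) \<le> (norm (X q' 0 - X q 0 - ?u 0) + M * (C * norm (q' - q))\<^sup>2) * exp (M + 1)"
    proof (rule gronwall)
      fix t assume t: "t \<in> {0..1::real}"
      show "((\<lambda>t. X q' t - X q t - ?u t) has_vector_derivative F (X q' t) - F (X q t) - D (X q t) (?u t)) (at t within {0..1})"
        using XF[OF q] XF[OF q'] U(2)[OF q] t unfolding ode_sol_def var_sol_def
        by (intro has_vector_derivative_diff) auto
      have "norm (F (X q' t) - F (X q t) - D (X q t) (?u t)) =
         norm ((F (X q' t) - F (X q t) - D (X q t) (X q' t - X q t)) + D (X q t) (X q' t - X q t - ?u t))"
        by (simp add: blinfun.diff_right)
      also have "\<dots> \<le> M * (norm (X q' t - X q t))\<^sup>2 + norm (D (X q t)) * norm (X q' t - X q t - ?u t)"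
        by (intro norm_triangle_le add_mono norm_blinfun M(2) XR q q' t)
      also have "\<dots> \<le> M * (C * norm (q' - q))\<^sup>2 + M * norm (X q' t - X q t - ?u t)"
        using close[OF X(2) X(2) t, of q' q] M(1) C X(1)
        by (intro add_mono mult_left_mono power_mono mult_right_mono M(3) XR q t) auto
      finally show "norm (F (X q' t) - F (X q t) - D (X q t) (?u t)) \<le> M * norm (X q' t - X q t - ?u t) + M * (C * norm (q' - q))\<^sup>2"
        by simp
    qed (use M C in auto)
    then show ?thesis using X(1) U(1)[OF q] \<Phi>[OF q] by (simp add: C_def K_def power_mult_distrib mult_ac)
  qed
  have cont: "continuous_on (ball (x 0) r) \<Phi>"
    unfolding continuous_on_iff
  proof (intro ballI allI impI)
    fix q and e :: real assume q: "q \<in> ball (x 0) r" and e: "e > 0"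
    obtain \<delta> where \<delta>: "\<delta> > 0" "ball q \<delta> \<subseteq> ball (x 0) r" using q open_ball by (meson openE)
    \<comment> \<open>The factor 1/3 keeps q' + h in the ball for steps h as long as q' - q; the
      second bound makes 6 K d smaller than e.\<close>
    define d where "d = min (\<delta> / 3) (e / (12 * K + 1))"
    have d: "d > 0" using \<delta> e K0 by (simp add: d_def)
    show "\<exists>d>0. \<forall>x'\<in>ball (x 0) r. dist x' q < d \<longrightarrow> dist (\<Phi> x') (\<Phi> q) < e"
    proof (intro exI[of _ d] conjI ballI impI d)
      fix q' assume q': "q' \<in> ball (x 0) r" "dist q' q < d"
      show "dist (\<Phi> q') (\<Phi> q) < e"
      proof (cases "q' = q")
        case True then show ?thesis using e by simp
      next
        case False
        define \<rho> where "\<rho> = norm (q' - q)"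
        have \<rho>: "\<rho> > 0" "\<rho> < d" using False q' by (auto simp: \<rho>_def dist_norm)
        \<comment> \<open>The point q' + h is reached from q directly and by way of q'. Comparing
          the three quadratic remainders, with h as long as q' - q, bounds the difference of the
          derivatives on h by (1 + 1 + 4) K \<rho>^2.\<close>
        have step: "norm ((\<Phi> q' - \<Phi> q) h) \<le> 6 * K * \<rho>\<^sup>2" if h: "norm h = \<rho>" for h
        proof -
          have m: "q' + h \<in> ball (x 0) r"
          proof -
            have "norm (q' + h - q) \<le> \<rho> + \<rho>" using norm_triangle_ineq[of "q' - q" h] h by (simp add: \<rho>_def algebra_simps)
            then have "q' + h \<in> ball q \<delta>" using \<rho> d \<delta> by (auto simp: dist_norm norm_minus_commute d_def)
            then show ?thesis using \<delta> by auto
          qed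
          define A where "A = X (q' + h) 1 - X q' 1 - \<Phi> q' (q' + h - q')"
          define B where "B = X (q' + h) 1 - X q 1 - \<Phi> q (q' + h - q)"
          define E where "E = X q' 1 - X q 1 - \<Phi> q (q' - q)"
          have eq: "(\<Phi> q' - \<Phi> q) h = B - A - E"
            by (simp add: A_def B_def E_def blinfun.diff_left blinfun.diff_right blinfun.add_right)
          have "norm A \<le> K * \<rho>\<^sup>2" using quad[OF q'(1) m] h by (simp add: A_def)
          moreover have "norm E \<le> K * \<rho>\<^sup>2" using quad[OF q q'(1)] by (simp add: E_def \<rho>_def)
          moreover have "norm B \<le> 4 * K * \<rho>\<^sup>2"
          proof -
            have "norm (q' + h - q) \<le> 2 * \<rho>" using norm_triangle_ineq[of "q' - q" h] h by (simp add: \<rho>_def algebra_simps)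
            then have "(norm (q' + h - q))\<^sup>2 \<le> (2 * \<rho>)\<^sup>2" by (intro power_mono) auto
            then have "K * (norm (q' + h - q))\<^sup>2 \<le> K * (2 * \<rho>)\<^sup>2" using K0 by (intro mult_left_mono)
            then show ?thesis using quad[OF q m] by (simp add: B_def power_mult_distrib)
          qed
          ultimately show ?thesis unfolding eq
            using norm_triangle_ineq4[of "B - A" E] norm_triangle_ineq4[of B A] by linarith
        qed
        have "norm (\<Phi> q' - \<Phi> q) \<le> 6 * K * \<rho>"
        proof (rule norm_blinfun_bound)
          show "0 \<le> 6 * K * \<rho>" using K0 \<rho> by simp
          fix h
          show "norm ((\<Phi> q' - \<Phi> q) h) \<le> 6 * K * \<rho> * norm h"
          proof (cases "h = 0")
            case False
            then have "norm ((\<Phi> q' - \<Phi> q) ((\<rho> / norm h) *\<^sub>R h)) \<le> 6 * K * \<rho>\<^sup>2" using \<rho> by (intro step) auto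
            then have "(\<rho> / norm h) * norm ((\<Phi> q' - \<Phi> q) h) \<le> 6 * K * \<rho>\<^sup>2"
              using \<rho> by (simp add: blinfun.scaleR_right)
            then show ?thesis using \<rho> False by (simp add: field_simps power2_eq_square)
          qed simp
        qed
        also have "\<dots> \<le> 6 * K * (e / (12 * K + 1))" using \<rho> K0 by (intro mult_left_mono) (auto simp: d_def)
        also have "\<dots> < e"
        proof -
          have "6 * K * e \<le> 12 * K * e" using K0 e by (intro mult_right_mono) auto
          then have "6 * K * e < e * (12 * K + 1)" using e unfolding distrib_left by (simp add: mult_ac)
          then show ?thesis using K0 by (simp add: pos_divide_less_eq)
        qed
        finally show ?thesis by (simp add: dist_norm)
      qed
    qed
  qed
  show ?thesis
  proof (rule that[of r C X \<Phi>])
    show "0 < r" "0 \<le> C" using r C by auto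
    show "\<And>q. q \<in> ball (x 0) r \<Longrightarrow> X q 0 = q \<and> ode_sol F (X q)" using X XF by blast
    show "\<And>t. t \<in> {0..1} \<Longrightarrow> X (x 0) t = x t" by (rule Xx)
    show "\<And>q q' t. q \<in> ball (x 0) r \<Longrightarrow> q' \<in> ball (x 0) r \<Longrightarrow> t \<in> {0..1} \<Longrightarrow> norm (X q t - X q' t) \<le> C * norm (q - q')"
      using close[OF X(2) X(2)] X(1) by metis
    show "((\<lambda>q. X q 1) has_derivative blinfun_apply (\<Phi> q)) (at q)" if q: "q \<in> ball (x 0) r" for q
    proof -
      obtain \<delta> where \<delta>: "\<delta> > 0" "ball q \<delta> \<subseteq> ball (x 0) r" using q open_ball by (meson openE)
      show ?thesis
        by (rule has_derivative_quadratic[OF _ \<delta>(1)]) (use \<delta> quad[OF q] in \<open>auto simp: blinfun.bounded_linear_right dist_commute subset_iff\<close>)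
    qed
    show "continuous_on (ball (x 0) r) \<Phi>" by (rule cont)
    show "\<Phi> q (u 0) = u 1" if "q \<in> ball (x 0) r" "var_sol D (X q) u" for q u
      using uniq[OF that(1) U(2)[OF that(1), of "u 0"] that(2)] U(1)[OF that(1)] \<Phi>[OF that(1)] by simp
    show "\<And>q h. q \<in> ball (x 0) r \<Longrightarrow> \<exists>u. u 0 = h \<and> var_sol D (X q) u" by (rule ex)
  qed
qed


section \<open>Closed orbits in the plane\<close>

type_synonym plane = "real \<times> real"

definition rot :: "plane \<Rightarrow> plane" where "rot p = (- snd p, fst p)"
definition det2 :: "plane \<Rightarrow> plane \<Rightarrow> real" where "det2 u w = fst u * snd w - snd u * fst w"
text \<open>Applied to the derivative of a field, this is its divergence.\<close>

definition tr2 :: "(plane \<Rightarrow>\<^sub>L plane) \<Rightarrow> real" where "tr2 A = fst (A (1, 0)) + snd (A (0, 1))"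

lemma det2_inner: "det2 u w = rot u \<bullet> w"
  by (cases u; cases w) (simp add: det2_def rot_def)

lemma norm_rot [simp]: "norm (rot u) = norm u"
  by (cases u) (simp add: rot_def norm_Pair)

lemma bounded_linear_rot: "bounded_linear rot"
proof (rule bounded_linear_intro[where K=1])
  show "norm (rot x) \<le> norm x * 1" for x by simp
qed (auto simp: rot_def)

lemma det2_bound: "\<bar>det2 u w\<bar> \<le> norm u * norm w"
  unfolding det2_inner using Cauchy_Schwarz_ineq2[of "rot u" w] by simp

lemma det2_rot: "det2 u (rot u) = (norm u)\<^sup>2"
  by (cases u) (simp add: det2_def rot_def norm_Pair power2_eq_square)

lemma det2_simps:
  "det2 (u + u') w = det2 u w + det2 u' w" "det2 u (w + w') = det2 u w + det2 u w'"
  "det2 (u - u') w = det2 u w - det2 u' w" "det2 u (w - w') = det2 u w - det2 u w'"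
  "det2 (a *\<^sub>R u) w = a * det2 u w" "det2 u (a *\<^sub>R w) = a * det2 u w"
  "det2 u u = 0" "det2 0 w = 0" "det2 u 0 = 0"
  by (auto simp: det2_def algebra_simps)

text \<open>The frame v, \<open>rot v\<close> is orthogonal, both vectors having length
  \<open>norm v\<close>. When v is the velocity on an orbit, the first part is, to first order, a
  shift in time and the second the displacement off the orbit.\<close>

lemma plane_decomp:
  assumes "v \<noteq> 0"
  shows "z = ((z \<bullet> v) / (norm v)\<^sup>2) *\<^sub>R v + (det2 v z / (norm v)\<^sup>2) *\<^sub>R rot v"
proof -
  obtain a b where v: "v = (a, b)" by (cases v)
  obtain c d where z: "z = (c, d)" by (cases z)
  define n where "n = a * a + b * b"
  have nz: "n \<noteq> 0" using assms v by (simp add: n_def sum_squares_eq_zero_iff zero_prod_def)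
  have n: "(norm v)\<^sup>2 = n" by (simp add: v norm_Pair power2_eq_square n_def)
  have "n * c = (c * a + d * b) * a - (a * d - b * c) * b" "n * d = (c * a + d * b) * b + (a * d - b * c) * a"
    by (simp_all add: algebra_simps n_def)
  then have "c = ((c * a + d * b) * a - (a * d - b * c) * b) / n" "d = ((c * a + d * b) * b + (a * d - b * c) * a) / n"
    using nz by (simp_all only: eq_divide_eq mult.commute simp_thms if_False if_True)
  then show ?thesis unfolding n by (simp add: v z det2_def rot_def flip: add_divide_distrib diff_divide_distrib)
qed

text \<open>This is the first order term in s of the identity that det2 of u + s A u and w + s A w
  is the determinant of 1 + s A times det2 of u and w; the linear coefficient of that determinant is
  the trace.\<close>

lemma det2_trace: "det2 (blinfun_apply A u) w + det2 u (blinfun_apply A w) = tr2 A * det2 u w"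
proof -
  have A: "blinfun_apply A p = fst p *\<^sub>R A (1, 0) + snd p *\<^sub>R A (0, 1)" for p
  proof -
    have "p = fst p *\<^sub>R (1, 0) + snd p *\<^sub>R (0, 1)" by (simp add: prod_eq_iff)
    then show ?thesis by (metis blinfun.add_right blinfun.scaleR_right)
  qed
  show ?thesis by (simp add: A[of u] A[of w] det2_def tr2_def algebra_simps)
qed

lemma tr2_bound: "\<bar>tr2 A\<bar> \<le> 2 * norm A"
proof -
  have "\<bar>fst (A (1, 0))\<bar> \<le> norm (A (1, 0))" "\<bar>snd (A (0, 1))\<bar> \<le> norm (A (0, 1))"
    using norm_fst_le[of "fst (A (1, 0))" "snd (A (1, 0))"] norm_snd_le[of "snd (A (0, 1))" "fst (A (0, 1))"] by auto
  moreover have "norm (A (1, 0)) \<le> norm A" "norm (A (0, 1)) \<le> norm A"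
    using norm_blinfun[of A "(1, 0)"] norm_blinfun[of A "(0, 1)"] by (auto simp: norm_Pair)
  ultimately show ?thesis unfolding tr2_def by linarith
qed

lemma tr2_cont: "continuous_on S f \<Longrightarrow> continuous_on S (\<lambda>x. tr2 (f x))"
  unfolding tr2_def by (intro continuous_intros)

lemma det2_deriv:
  assumes "(f has_vector_derivative f') (at t within S)" "(g has_vector_derivative g') (at t within S)"
  shows "((\<lambda>t. det2 (f t) (g t)) has_real_derivative det2 f' (g t) + det2 (f t) g') (at t within S)"
proof -
  have f: "((\<lambda>t. fst (f t)) has_real_derivative fst f') (at t within S)" "((\<lambda>t. snd (f t)) has_real_derivative snd f') (at t within S)"
    and g: "((\<lambda>t. fst (g t)) has_real_derivative fst g') (at t within S)" "((\<lambda>t. snd (g t)) has_real_derivative snd g') (at t within S)"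
    unfolding has_real_derivative_iff_has_vector_derivative
    by (rule bounded_linear.has_vector_derivative[OF bounded_linear_fst] bounded_linear.has_vector_derivative[OF bounded_linear_snd] assms)+
  show ?thesis unfolding det2_def by (rule derivative_eq_intros f g refl)+ (simp add: algebra_simps)
qed

text \<open>Liouville's formula in the plane: along a solution \<open>x\<close> the determinant of the velocity and a
  variation \<open>z\<close> obeys a scalar linear equation driven by the divergence.\<close>

lemma det_flow:
  fixes F :: "plane \<Rightarrow> plane"
  assumes F: "C11 F D"
    and x: "\<And>t. t \<in> {0..1} \<Longrightarrow> (x has_vector_derivative \<tau> *\<^sub>R F (x t)) (at t within {0..1})"
    and z: "\<And>t. t \<in> {0..1} \<Longrightarrow> (z has_vector_derivative \<tau> *\<^sub>R D (x t) (z t) + w t) (at t within {0..1})"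
    and t: "t \<in> {0..1}"
  shows "((\<lambda>t. exp (- \<tau> * integral {0..t} (\<lambda>s. tr2 (D (x s)))) * det2 (F (x t)) (z t)) has_real_derivative
     exp (- \<tau> * integral {0..t} (\<lambda>s. tr2 (D (x s)))) * det2 (F (x t)) (w t)) (at t within {0..1})"
proof -
  have xc: "continuous_on {0..1} x"
    using x by (meson continuous_on_eq_continuous_within has_vector_derivative_continuous)
  have "continuous_on {0..1} (\<lambda>s. tr2 (D (x s)))"
    by (intro tr2_cont continuous_on_compose2[OF C11_cont_deriv[OF F, of UNIV] xc]) auto
  from integral_has_vector_derivative[OF this t]
  have i: "((\<lambda>t. integral {0..t} (\<lambda>s. tr2 (D (x s)))) has_real_derivative tr2 (D (x t))) (at t within {0..1})"
    by (simp add: has_real_derivative_iff_has_vector_derivative)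
  \<comment> \<open>The velocity along the orbit is itself a solution of the variational
    equation.\<close>
  have "((\<lambda>t. F (x t)) has_vector_derivative D (x t) (\<tau> *\<^sub>R F (x t))) (at t within {0..1})"
    using vector_derivative_diff_chain_within[OF x[OF t] has_derivative_at_withinI[OF C11_deriv[OF F]]]
    by (simp add: o_def)
  from det2_deriv[OF this z[OF t]]
  have d: "((\<lambda>t. det2 (F (x t)) (z t)) has_real_derivative \<tau> * tr2 (D (x t)) * det2 (F (x t)) (z t) + det2 (F (x t)) (w t)) (at t within {0..1})"
    using arg_cong[OF det2_trace[of "D (x t)" "F (x t)" "z t"], of "(*) \<tau>"]
    by (simp add: blinfun.scaleR_right det2_simps distrib_left mult.assoc add.assoc[symmetric])
  show ?thesis
    by (rule derivative_eq_intros i d refl)+ (simp add: algebra_simps)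
qed

section \<open>Uniqueness, solutions on the whole line, periodicity\<close>

lemma ode_unique:
  fixes F :: "'a::euclidean_space \<Rightarrow> 'a"
  assumes F: "smooth F" and x: "ode_sol F x" and y: "ode_sol F y" and "x 0 = y 0" and t: "t \<in> {0..1}"
  shows "x t = y t"
proof -
  obtain D where D: "C11 F D" using F by (auto simp: smooth_def)
  have "bounded (x ` {0..1} \<union> y ` {0..1})"
    using ode_sol_cont[OF x] ode_sol_cont[OF y] by (intro compact_imp_bounded compact_Un compact_continuous_image) auto
  then obtain R where R: "\<And>t. t \<in> {0..1} \<Longrightarrow> norm (x t) \<le> R" "\<And>t. t \<in> {0..1} \<Longrightarrow> norm (y t) \<le> R"
    unfolding bounded_iff by (metis UnI1 UnI2 imageI)
  obtain M where M: "M > 0" "\<And>x y. norm x \<le> R \<Longrightarrow> norm y \<le> R \<Longrightarrow> norm (F y - F x) \<le> M * norm (y - x)"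
    using C11_bound[OF D] by metis
  have "norm (x t - y t) \<le> (norm (x 0 - y 0) + 0) * exp (M + 1)"
  proof (rule gronwall[OF _ _ _ _ t])
    fix t :: real assume t: "t \<in> {0..1}"
    show "((\<lambda>t. x t - y t) has_vector_derivative F (x t) - F (y t)) (at t within {0..1})"
      using x y t unfolding ode_sol_def by (intro has_vector_derivative_diff) auto
    show "norm (F (x t) - F (y t)) \<le> M * norm (x t - y t) + 0" using M(2) R t by simp
  qed (use M in auto)
  then show ?thesis using assms(4) by simp
qed

text \<open>Unlike \<open>ode_sol\<close> this concerns all times, and the factor \<tau> may have
  either sign, so that orbits can be run backwards.\<close>

definition gsol :: "real \<Rightarrow> ('a::real_normed_vector \<Rightarrow> 'a) \<Rightarrow> (real \<Rightarrow> 'a) \<Rightarrow> bool" where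
  "gsol \<tau> F \<gamma> \<longleftrightarrow> (\<forall>t. (\<gamma> has_vector_derivative \<tau> *\<^sub>R F (\<gamma> t)) (at t))"

lemma gsol_affine:
  assumes "gsol \<tau> F \<gamma>" shows "gsol (c * \<tau>) F (\<lambda>t. \<gamma> (a + c * t))"
  unfolding gsol_def
proof
  fix t
  have "((\<lambda>t. a + c * t) has_vector_derivative c) (at t)"
    by (auto intro!: derivative_eq_intros simp flip: has_real_derivative_iff_has_vector_derivative)
  moreover have "(\<gamma> has_vector_derivative \<tau> *\<^sub>R F (\<gamma> (a + c * t))) (at (a + c * t))"
    using assms by (simp add: gsol_def)
  ultimately show "((\<lambda>t. \<gamma> (a + c * t)) has_vector_derivative (c * \<tau>) *\<^sub>R F (\<gamma> (a + c * t))) (at t)"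
    using vector_diff_chain_at[of "\<lambda>t. a + c * t" c t \<gamma> "\<tau> *\<^sub>R F (\<gamma> (a + c * t))"] by (simp add: o_def)
qed

lemma gsol_ode: "gsol \<tau> F \<gamma> \<Longrightarrow> ode_sol (\<lambda>x. \<tau> *\<^sub>R F x) \<gamma>"
  unfolding gsol_def ode_sol_def by (auto intro: has_vector_derivative_at_within)

lemma gsol_cont: "gsol \<tau> F \<gamma> \<Longrightarrow> continuous_on S \<gamma>"
  unfolding gsol_def by (meson continuous_at_imp_continuous_on has_vector_derivative_continuous)

lemma smooth_scale: "smooth F \<Longrightarrow> smooth (\<lambda>x. c *\<^sub>R F x)"
  by (rule smooth_compose[OF _ smooth_linear[OF bounded_linear_scaleR_right]])

text \<open>Rescaling time by \<open>t\<close> turns the step from \<open>a\<close> to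
  \<open>a + t\<close> into the unit interval, so \<open>ode_unique\<close> applies for either sign
  of \<open>t\<close>.\<close>

lemma gsol_unique:
  fixes F :: "'a::euclidean_space \<Rightarrow> 'a"
  assumes F: "smooth F" and "gsol \<tau> F \<gamma>" "gsol \<tau> F \<eta>" "\<gamma> a = \<eta> b"
  shows "\<gamma> (a + t) = \<eta> (b + t)"
  using ode_unique[OF smooth_scale[OF F] gsol_ode[OF gsol_affine[OF assms(2)]] gsol_ode[OF gsol_affine[OF assms(3)]], of a t b 1]
    assms(4) by simp

lemma gsol_nonzero:
  fixes F :: "'a::euclidean_space \<Rightarrow> 'a"
  assumes F: "smooth F" and g: "gsol \<tau> F \<gamma>" and "F (\<gamma> a) \<noteq> 0"
  shows "F (\<gamma> b) \<noteq> 0"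
proof
  assume 0: "F (\<gamma> b) = 0"
  then have "gsol \<tau> F (\<lambda>_. \<gamma> b)" by (simp add: gsol_def)
  from gsol_unique[OF F g this refl, of "a - b"] show False using 0 assms(3) by simp
qed

lemma periodic_int:
  fixes \<gamma> :: "real \<Rightarrow> 'a"
  assumes "\<And>t. \<gamma> (t + T) = \<gamma> t" shows "\<gamma> (t + of_int k * T) = \<gamma> t"
proof (induction k rule: int_induct[where k=0])
  case (step1 i) then show ?case using assms[of "t + of_int i * T"] by (simp add: algebra_simps)
next
  case (step2 i) then show ?case using assms[of "t + of_int (i - 1) * T"] by (simp add: algebra_simps)
qed simp

lemma periodic_rep:
  fixes \<gamma> :: "real \<Rightarrow> 'a"
  assumes "\<And>t. \<gamma> (t + T) = \<gamma> t" "T > 0"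
  obtains s where "s \<in> {0..<T}" "\<gamma> t = \<gamma> s"
proof
  let ?k = "\<lfloor>t / T\<rfloor>"
  show "t + of_int (- ?k) * T \<in> {0..<T}"
    using floor_divide_lower[OF assms(2), of t] floor_divide_upper[OF assms(2), of t] by (simp add: algebra_simps)
  show "\<gamma> t = \<gamma> (t + of_int (- ?k) * T)" using periodic_int[of \<gamma>, OF assms(1)] by metis
qed

lemma periodic_range:
  fixes \<gamma> :: "real \<Rightarrow> 'a"
  assumes "\<And>t. \<gamma> (t + T) = \<gamma> t" "T > 0"
  shows "range \<gamma> = \<gamma> ` {0..T}"
proof -
  have "\<gamma> t \<in> \<gamma> ` {0..T}" for t using periodic_rep[of \<gamma> T t, OF assms] by fastforce
  then show ?thesis by auto
qed

text \<open>Makes the divergence integral independent of the point where the turn begins. Only the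
  fractional part b of the shift matters, and the interval from b to b + 1 is cut at 1.\<close>

lemma periodic_integral:
  fixes f :: "real \<Rightarrow> real"
  assumes c: "continuous_on UNIV f" and p: "\<And>t. f (t + 1) = f t"
  shows "integral {0..1} (\<lambda>s. f (a + s)) = integral {0..1} f"
proof -
  have i: "f integrable_on {u..v}" for u v by (rule integrable_continuous_real) (rule continuous_on_subset[OF c], simp)
  have sh: "integral {u..v} (\<lambda>s. f (b + s)) = integral {b + u..b + v} f" for u v b
    using integral_shift[OF continuous_on_subset[OF c subset_UNIV], where a=u and c=b and b=v] by (simp add: o_def add.commute)
  define k where "k = \<lfloor>a\<rfloor>"
  define b where "b = a - of_int k"
  have b: "0 \<le> b" "b \<le> 1" unfolding b_def k_def by linarith+
  have "f (a + s) = f (b + s)" for s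
    using periodic_int[of f 1 "b + s" k, OF p] by (simp add: b_def algebra_simps)
  then have "integral {0..1} (\<lambda>s. f (a + s)) = integral {0..1} (\<lambda>s. f (b + s))" by simp
  also have "\<dots> = integral {b..b + 1} f" using sh[of 0 1 b] by simp
  also have "\<dots> = integral {b..1} f + integral {1..b + 1} f"
    using Henstock_Kurzweil_Integration.integral_combine[where a=b and c=1 and b="b + 1" and f=f] b i by simp
  also have "integral {1..b + 1} f = integral {0..b} f"
    using sh[of 0 b 1] p by (simp add: add.commute)
  also have "integral {b..1} f + integral {0..b} f = integral {0..1} f"
    using Henstock_Kurzweil_Integration.integral_combine[where a=0 and c=b and b=1 and f=f] b i by simp
  finally show ?thesis .
qed

section \<open>Closed orbits with normalised time, and hyperbolicity\<close>

definition closed_sol :: "(plane \<Rightarrow> plane) \<Rightarrow> real \<Rightarrow> (real \<Rightarrow> plane) \<Rightarrow> bool" where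
  "closed_sol F \<tau> x \<longleftrightarrow> \<tau> > 0 \<and> ode_sol (\<lambda>p. \<tau> *\<^sub>R F p) x \<and> x 0 = x 1 \<and> F (x 0) \<noteq> 0"

text \<open>The exponential of \<tau> times this integral is the multiplier of the section map along
  the given closed solution, so the condition says that the multiplier differs from 1. The period
  appears only as the factor \<tau> and need not be the least one.\<close>

definition hyp_orbit :: "(plane \<Rightarrow> plane) \<Rightarrow> plane set \<Rightarrow> bool" where
  "hyp_orbit F \<Gamma> \<longleftrightarrow> (\<exists>D \<tau> x. C11 F D \<and> closed_sol F \<tau> x \<and> \<Gamma> = x ` {0..1} \<and> integral {0..1} (\<lambda>t. tr2 (D (x t))) \<noteq> 0)"

text \<open>Away from the integers this is a translate of the given function. At an integer the left
  and the right derivative have to be glued, and they agree because \<open>x'\<close> takes the same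
  value at both ends.\<close>

lemma frac_deriv:
  fixes x x' :: "real \<Rightarrow> 'a::real_normed_vector"
  assumes x: "\<And>t. t \<in> {0..1} \<Longrightarrow> (x has_vector_derivative x' t) (at t within {0..1})"
    and per: "x 0 = x 1" "x' 0 = x' 1"
  shows "((\<lambda>t. x (frac t)) has_vector_derivative x' (frac t)) (at t)"
proof -
  have sh: "((\<lambda>t. x (t - a)) has_vector_derivative x' (s - a)) (at s within {a..a + 1})" if "s \<in> {a..a + 1}" for s a
  proof -
    have "((\<lambda>t. t - a) has_vector_derivative 1) (at s within {a..a + 1})"
      by (auto intro!: derivative_eq_intros simp flip: has_real_derivative_iff_has_vector_derivative)
    moreover have "(\<lambda>t. t - a) ` {a..a + 1} = {0..1}"
      by (auto simp: image_iff)
    then have "(x has_vector_derivative x' (s - a)) (at (s - a) within (\<lambda>t. t - a) ` {a..a + 1})"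
      using x[of "s - a"] that by auto
    ultimately show ?thesis
      using vector_diff_chain_within[of "\<lambda>t. t - a" 1 s "{a..a + 1}" x "x' (s - a)"] by (simp add: o_def)
  qed
  define k :: real where "k = of_int \<lfloor>t\<rfloor>"
  have fr: "frac t = t - k" by (simp add: frac_def k_def)
  have on: "x (frac s) = x (s - k)" if "s \<in> {k..k + 1}" for s
  proof (cases "s = k + 1")
    case True then show ?thesis using per by (simp add: k_def frac_def)
  next
    case False then have "\<lfloor>s\<rfloor> = \<lfloor>t\<rfloor>" using that by (auto simp: k_def floor_eq_iff)
    then show ?thesis by (simp add: frac_def k_def)
  qed
  have on': "x (frac s) = x (s - (k - 1))" if "s \<in> {k - 1..k}" for s
  proof (cases "s = k")
    case True then show ?thesis using per by (simp add: k_def frac_def)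
  next
    case False then have "\<lfloor>s\<rfloor> = \<lfloor>t\<rfloor> - 1" using that by (auto simp: k_def floor_eq_iff)
    then show ?thesis by (simp add: frac_def k_def)
  qed
  have tk: "t \<in> {k..k + 1}" "t \<noteq> k + 1" unfolding k_def by (simp, linarith+)
  have R: "((\<lambda>t. x (frac t)) has_vector_derivative x' (frac t)) (at t within {k..k + 1})"
    by (rule has_vector_derivative_transform[OF tk(1) _ sh[OF tk(1), folded fr]]) (rule on)
  show ?thesis
  proof (cases "t = k")
    case False
    then have "t \<in> interior {k..k + 1}" using tk by auto
    then show ?thesis using R by (metis at_within_interior)
  next
    case True
    have tk': "t \<in> {k - 1..k - 1 + 1}" using True by simp
    have "((\<lambda>t. x (frac t)) has_vector_derivative x' (t - (k - 1))) (at t within {k - 1..k - 1 + 1})"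
      by (rule has_vector_derivative_transform[OF tk' _ sh[OF tk']]) (use on' in auto)
    moreover have "x' (t - (k - 1)) = x' (frac t)"
    proof -
      have "t - (k - 1) = 1" "frac t = 0" using True fr by auto
      then show ?thesis using per(2) by metis
    qed
    ultimately have L: "((\<lambda>t. x (frac t)) has_vector_derivative x' (frac t)) (at t within {k - 1..k - 1 + 1})"
      by metis
    have "((\<lambda>t. x (frac t)) has_vector_derivative x' (frac t)) (at t within ({k - 1..k - 1 + 1} \<union> {k..k + 1}))"
      using L R unfolding has_vector_derivative_def has_derivative_within Lim_within_Un by blast
    moreover have "{k - 1..k - 1 + 1} \<union> {k..k + 1} = {k - 1..k + 1}" by auto
    moreover have "t \<in> interior {k - 1..k + 1}" using True by auto
    ultimately show ?thesis by (metis at_within_interior)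
  qed
qed


text \<open>The least period is chosen because, in \<open>rotated_family\<close>, telling nearby
  orbits apart requires an orbit that passes its base point only once per turn.\<close>

lemma periodic_orbit_closed_sol:
  assumes F: "smooth F" and "periodic_orbit F \<Gamma>"
  obtains \<tau> x where "closed_sol F \<tau> x" "\<Gamma> = x ` {0..1}" "\<And>t. 0 < t \<Longrightarrow> t < 1 \<Longrightarrow> x t \<noteq> x 0"
proof -
  obtain \<gamma> T where T: "T > 0" and g: "\<And>t. (\<gamma> has_vector_derivative F (\<gamma> t)) (at t)"
    and p: "\<And>t. \<gamma> (t + T) = \<gamma> t" and nc: "\<exists>t. \<gamma> t \<noteq> \<gamma> 0" and \<Gamma>: "\<Gamma> = range \<gamma>"
    using assms(2) unfolding periodic_orbit_def by blast
  have gs: "gsol 1 F \<gamma>" using g by (simp add: gsol_def)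
  have nz: "F (\<gamma> 0) \<noteq> 0"
  proof
    assume 0: "F (\<gamma> 0) = 0"
    then have c: "gsol 1 F (\<lambda>_. \<gamma> 0)" by (simp add: gsol_def)
    have "\<gamma> t = \<gamma> 0" for t using gsol_unique[OF F gs c, of 0 t] by simp
    then show False using nc by blast
  qed
  define v where "v = F (\<gamma> 0)"
  have vp: "v \<bullet> v > 0" using nz by (simp add: v_def)
  text \<open>The return times form a closed set that misses a neighbourhood of 0, so there is a least one.\<close>
  have "((\<lambda>t. \<gamma> t \<bullet> v) has_real_derivative v \<bullet> v) (at 0)"
    using g[of 0] unfolding has_vector_derivative_def has_field_derivative_def v_def[symmetric]
    by (auto intro!: derivative_eq_intros simp: fun_eq_iff)
  then obtain d where d: "d > 0" "\<And>h. h > 0 \<Longrightarrow> h < d \<Longrightarrow> \<gamma> h \<bullet> v > \<gamma> 0 \<bullet> v"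
    using DERIV_pos_inc_right[of "\<lambda>t. \<gamma> t \<bullet> v" "v \<bullet> v" 0] vp by auto
  define S where "S = {t \<in> {min d T..T}. \<gamma> t = \<gamma> 0}"
  have "closed S"
  proof -
    have "S = {min d T..T} \<inter> \<gamma> -` {\<gamma> 0}" by (auto simp: S_def)
    then show ?thesis using continuous_closed_preimage[OF gsol_cont[OF gs], of "{min d T..T}" "{\<gamma> 0}"] by simp
  qed
  then have "compact S" unfolding compact_eq_bounded_closed
    by (auto simp: S_def intro: bounded_subset[OF bounded_closed_interval[of "min d T" T]])
  moreover have "S \<noteq> {}" using p[of 0] T by (auto simp: S_def)
  ultimately obtain \<tau> where \<tau>: "\<tau> \<in> S" "\<And>t. t \<in> S \<Longrightarrow> \<tau> \<le> t" using compact_attains_inf by metis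
  have \<tau>0: "\<tau> > 0" "\<gamma> \<tau> = \<gamma> 0" "\<tau> \<le> T" using \<tau>(1) d T by (auto simp: S_def min_def split: if_splits)
  have per: "\<gamma> (t + \<tau>) = \<gamma> t" for t
    using gsol_unique[OF F gs gs \<tau>0(2), of t] by (simp add: add.commute)
  define x where "x = (\<lambda>t. \<gamma> (0 + \<tau> * t))"
  have gx: "gsol (\<tau> * 1) F x" unfolding x_def by (rule gsol_affine[OF gs])
  show thesis
  proof (rule that)
    show "closed_sol F \<tau> x" unfolding closed_sol_def using gsol_ode[OF gx] nz \<tau>0 by (simp add: x_def)
    have "x ` {0..1} = \<gamma> ` {0..\<tau>}"
    proof -
      have "(*) \<tau> ` {0..1} = {0..\<tau>}" using \<tau>0 by (simp add: image_mult_atLeastAtMost)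
      then show ?thesis unfolding x_def by (metis (no_types, lifting) add_0 image_cong image_image)
    qed
    then show "\<Gamma> = x ` {0..1}" using periodic_range[of \<gamma>, OF per \<tau>0(1)] \<Gamma> by simp
    fix t :: real assume t: "0 < t" "t < 1"
    have s: "0 < \<tau> * t" "\<tau> * t < \<tau>" using t \<tau>0 by auto
    show "x t \<noteq> x 0"
    proof
      assume "x t = x 0"
      then have e: "\<gamma> (\<tau> * t) = \<gamma> 0" by (simp add: x_def)
      show False
      proof (cases "\<tau> * t < d")
        case True then show False using d(2)[OF s(1)] e by simp
      next
        case False
        moreover have "\<tau> * t \<le> T" using s(2) \<tau>0(3) by linarith
        ultimately have "\<tau> * t \<in> S" using e by (auto simp: S_def)
        then show False using \<tau>(2)[of "\<tau> * t"] s(2) by linarith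
      qed
    qed
  qed
qed

lemma closed_sol_extend:
  assumes "closed_sol F \<tau> x"
  obtains \<gamma> where "gsol \<tau> F \<gamma>" "\<And>t. \<gamma> (t + 1) = \<gamma> t" "\<And>t. t \<in> {0..1} \<Longrightarrow> \<gamma> t = x t" "range \<gamma> = x ` {0..1}"
proof
  let ?\<gamma> = "\<lambda>t. x (frac t)"
  note c = assms[unfolded closed_sol_def ode_sol_def]
  show "gsol \<tau> F ?\<gamma>" unfolding gsol_def
    using frac_deriv[of x "\<lambda>t. \<tau> *\<^sub>R F (x t)"] c by simp
  show p: "?\<gamma> (t + 1) = ?\<gamma> t" for t by (simp add: frac_1_eq)
  show e: "?\<gamma> t = x t" if "t \<in> {0..1}" for t
    using that c by (cases "t = 1") (auto simp: frac_eq)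
  show "range ?\<gamma> = x ` {0..1}" using periodic_range[of ?\<gamma> 1, OF p] e by simp
qed

lemma closed_sol_periodic_orbit:
  assumes F: "smooth F" and x: "closed_sol F \<tau> x"
  shows "periodic_orbit F (x ` {0..1})"
proof -
  obtain \<gamma> where g: "gsol \<tau> F \<gamma>" "\<And>t. \<gamma> (t + 1) = \<gamma> t" "\<And>t. t \<in> {0..1} \<Longrightarrow> \<gamma> t = x t" "range \<gamma> = x ` {0..1}"
    using closed_sol_extend[OF x] by metis
  have \<tau>: "\<tau> > 0" "F (x 0) \<noteq> 0" using x by (auto simp: closed_sol_def)
  define \<eta> where "\<eta> = (\<lambda>t. \<gamma> (0 + (1 / \<tau>) * t))"
  have \<eta>: "gsol ((1 / \<tau>) * \<tau>) F \<eta>" unfolding \<eta>_def by (rule gsol_affine[OF g(1)])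
  then have \<eta>: "(\<eta> has_vector_derivative F (\<eta> t)) (at t)" for t using \<tau> by (simp add: gsol_def)
  have r: "range \<eta> = range \<gamma>"
  proof -
    have "\<gamma> t = \<eta> (\<tau> * t)" for t using \<tau> by (simp add: \<eta>_def)
    then have "range \<gamma> \<subseteq> range \<eta>" by (metis image_subsetI rangeI)
    moreover have "range \<eta> \<subseteq> range \<gamma>" by (auto simp: \<eta>_def)
    ultimately show ?thesis by simp
  qed
  have "\<exists>t. \<eta> t \<noteq> \<eta> 0"
  proof (rule ccontr)
    assume "\<nexists>t. \<eta> t \<noteq> \<eta> 0"
    then have "\<eta> = (\<lambda>_. \<eta> 0)" by auto
    then have "(\<eta> has_vector_derivative 0) (at 0)" by (metis has_vector_derivative_const)
    then have "F (\<eta> 0) = 0" using \<eta>[of 0] vector_derivative_unique_at by blast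
    then show False using \<tau> g(3)[of 0] by (simp add: \<eta>_def)
  qed
  moreover have "\<eta> (t + \<tau>) = \<eta> t" for t using g(2)[of "t / \<tau>"] \<tau> by (simp add: \<eta>_def add_divide_distrib)
  ultimately show ?thesis unfolding periodic_orbit_def using \<eta> \<tau> r g(4) by metis
qed

text \<open>Any solution that stays near a closed orbit with contracting section map contracts towards it under
  the time-one map; comparing with the point of the other orbit that is farthest away forces that distance
  to vanish. Expansion is covered by letting \<open>\<tau>\<close> be negative.\<close>

lemma iso_core:
  fixes F :: "plane \<Rightarrow> plane"
  assumes F: "C11 F D" and \<tau>: "\<tau> \<noteq> 0" and g: "gsol \<tau> F \<gamma>" and per: "\<And>t. \<gamma> (t + 1) = \<gamma> t"
    and nz: "F (\<gamma> 0) \<noteq> 0" and I: "\<tau> * integral {0..1} (\<lambda>t. tr2 (D (\<gamma> t))) < 0"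
  obtains \<rho> where "\<rho> > 0"
    "\<And>\<eta> T. gsol \<tau> F \<eta> \<Longrightarrow> T > 0 \<Longrightarrow> (\<And>t. \<eta> (t + T) = \<eta> t) \<Longrightarrow> (\<And>t. infdist (\<eta> t) (range \<gamma>) < \<rho>) \<Longrightarrow> range \<eta> \<subseteq> range \<gamma>"
proof -
  let ?\<Gamma> = "range \<gamma>"
  have sF: "smooth F" using F by (auto simp: smooth_def)
  have gc: "continuous_on S \<gamma>" for S using gsol_cont[OF g] .
  have \<Gamma>: "?\<Gamma> = \<gamma> ` {0..1}" using periodic_range[of \<gamma> 1] per by simp
  have cG: "compact ?\<Gamma>" unfolding \<Gamma> by (intro compact_continuous_image gc) auto
  then have "bounded ?\<Gamma>" by (rule compact_imp_bounded)
  then obtain R0 where R0: "\<And>t. norm (\<gamma> t) \<le> R0" unfolding bounded_iff by (metis rangeI)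
  define R where "R = R0 + 1"
  obtain M where M: "M > 0"
    "\<And>x y. norm x \<le> R \<Longrightarrow> norm y \<le> R \<Longrightarrow> norm (F y - F x - D x (y - x)) \<le> M * (norm (y - x))\<^sup>2"
    "\<And>x. norm x \<le> R \<Longrightarrow> norm (D x) \<le> M"
    "\<And>x y. norm x \<le> R \<Longrightarrow> norm y \<le> R \<Longrightarrow> norm (F y - F x) \<le> M * norm (y - x)"
    "\<And>x. norm x \<le> R \<Longrightarrow> norm (F x) \<le> M"
    using C11_bound[OF F, of R] by metis
  have gR: "norm (\<gamma> t) \<le> R" for t using R0[of t] by (simp add: R_def)
  have Fg: "F (\<gamma> t) \<noteq> 0" for t using gsol_nonzero[OF sF g nz] .
  have "\<exists>x\<in>?\<Gamma>. \<forall>y\<in>?\<Gamma>. norm (F x) \<le> norm (F y)"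
    using continuous_attains_inf[OF cG, of "\<lambda>x. norm (F x)"] C11_cont[OF F] by (auto intro: continuous_on_norm)
  then obtain v0 where v0: "v0 > 0" "\<And>t. v0 \<le> norm (F (\<gamma> t))" using Fg by (metis rangeE rangeI zero_less_norm_iff)
  define I where "I = integral {0..1} (\<lambda>t. tr2 (D (\<gamma> t)))"
  \<comment> \<open>C bounds the growth of a difference of solutions over unit time, N1 the
    quadratic change of the weighted determinant, K the Taylor error of \<gamma>. N collects them,
    so that one unit of time takes a distance h to at most \<kappa> h + N h^2.\<close>
  define C where "C = exp (\<bar>\<tau>\<bar> * M + 1)"
  define N1 where "N1 = exp (\<bar>\<tau>\<bar> * (2 * M)) * (M * (\<bar>\<tau>\<bar> * (M * C\<^sup>2)))"
  define K where "K = \<bar>\<tau>\<bar> * (M * (\<bar>\<tau>\<bar> * M))"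
  define N where "N = exp (\<tau> * I) * N1 / v0 + K * (C / (v0 * \<bar>\<tau>\<bar>))\<^sup>2"
  define \<kappa> where "\<kappa> = exp (\<tau> * I)"
  have \<kappa>: "\<kappa> < 1" "\<kappa> > 0" using I by (auto simp: \<kappa>_def I_def)
  have pos: "C > 0" "N1 \<ge> 0" "K \<ge> 0" "N \<ge> 0" using M(1) v0 by (auto simp: C_def N1_def K_def N_def)
  \<comment> \<open>The bound 1 keeps the other orbit in the ball of radius \<open>R\<close>; the
    second bound keeps the factor \<kappa> + N \<rho> below 1.\<close>
  define \<rho> where "\<rho> = min 1 ((1 - \<kappa>) / (2 * (N + 1)))"
  have \<rho>: "\<rho> > 0" "\<rho> \<le> 1" using \<kappa> pos by (auto simp: \<rho>_def)
  have \<kappa>\<rho>: "\<kappa> + N * \<rho> < 1"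
  proof -
    have "N * \<rho> \<le> N * ((1 - \<kappa>) / (2 * (N + 1)))" using pos by (intro mult_left_mono) (auto simp: \<rho>_def)
    also have "\<dots> \<le> (N + 1) * ((1 - \<kappa>) / (2 * (N + 1)))" using pos \<kappa> by (intro mult_right_mono) auto
    also have "\<dots> = (1 - \<kappa>) / 2"
    proof -
      have "k * (c / (2 * k)) = c / 2" if "k > 0" for k c :: real using that by simp
      then show ?thesis using pos(4) by (metis add_nonneg_pos zero_less_one)
    qed
    also have "\<dots> < 1 - \<kappa>" using \<kappa> by simp
    finally show ?thesis by simp
  qed
  have lin: "norm (\<gamma> (t + a) - \<gamma> t - a *\<^sub>R (\<tau> *\<^sub>R F (\<gamma> t))) \<le> K * a\<^sup>2" for t a
  proof -
    let ?S = "closed_segment t (t + a)"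
    have sp: "\<bar>s - t\<bar> \<le> \<bar>a\<bar>" if "s \<in> ?S" for s
      using that by (auto simp: closed_segment_eq_real_ivl split: if_splits)
    have gl: "norm (\<gamma> s - \<gamma> t) \<le> (\<bar>\<tau>\<bar> * M) * \<bar>s - t\<bar>" for s
    proof -
      have "norm (\<gamma> s - \<gamma> t) \<le> (\<bar>\<tau>\<bar> * M) * norm (s - t)"
      proof (rule differentiable_bound[of UNIV])
        show "(\<gamma> has_derivative (\<lambda>h. h *\<^sub>R (\<tau> *\<^sub>R F (\<gamma> x)))) (at x within UNIV)" for x
          using g by (simp add: gsol_def has_vector_derivative_def)
        show "onorm (\<lambda>h. h *\<^sub>R (\<tau> *\<^sub>R F (\<gamma> x))) \<le> \<bar>\<tau>\<bar> * M" for x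
        proof (rule onorm_le)
          fix h :: real
          have "(\<bar>h\<bar> * \<bar>\<tau>\<bar>) * norm (F (\<gamma> x)) \<le> (\<bar>h\<bar> * \<bar>\<tau>\<bar>) * M" by (intro mult_left_mono M(5) gR) auto
          then show "norm (h *\<^sub>R \<tau> *\<^sub>R F (\<gamma> x)) \<le> \<bar>\<tau>\<bar> * M * norm h" by (simp add: abs_mult mult_ac)
        qed
      qed auto
      then show ?thesis by simp
    qed
    have "norm (\<gamma> (t + a) - \<gamma> t - (t + a - t) *\<^sub>R (\<tau> *\<^sub>R F (\<gamma> t))) \<le> norm (t + a - t) * (\<bar>\<tau>\<bar> * (M * (\<bar>\<tau>\<bar> * M * \<bar>a\<bar>)))"
    proof (rule vector_differentiable_bound_linearization[where S="?S"])
      show "(\<gamma> has_vector_derivative \<tau> *\<^sub>R F (\<gamma> s)) (at s within ?S)" for s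
        using g by (auto simp: gsol_def intro: has_vector_derivative_at_within)
      fix s assume s: "s \<in> ?S"
      have "norm (\<tau> *\<^sub>R F (\<gamma> s) - \<tau> *\<^sub>R F (\<gamma> t)) = \<bar>\<tau>\<bar> * norm (F (\<gamma> s) - F (\<gamma> t))"
        by (simp flip: scaleR_diff_right)
      also have "\<dots> \<le> \<bar>\<tau>\<bar> * (M * norm (\<gamma> s - \<gamma> t))" using M(4)[OF gR gR] by (intro mult_left_mono) auto
      also have "\<dots> \<le> \<bar>\<tau>\<bar> * (M * (\<bar>\<tau>\<bar> * M * \<bar>a\<bar>))"
        using gl[of s] sp[OF s] M(1) by (intro mult_left_mono order_trans[OF gl] ) auto
      finally show "norm (\<tau> *\<^sub>R F (\<gamma> s) - \<tau> *\<^sub>R F (\<gamma> t)) \<le> \<bar>\<tau>\<bar> * (M * (\<bar>\<tau>\<bar> * M * \<bar>a\<bar>))" .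
    qed auto
    then show ?thesis by (simp add: K_def power2_eq_square mult_ac)
  qed
  have main: "infdist (\<eta> (s + 1)) ?\<Gamma> \<le> (\<kappa> + N * \<rho>) * infdist (\<eta> s) ?\<Gamma>"
    if eta: "gsol \<tau> F \<eta>" and near: "\<And>t. infdist (\<eta> t) ?\<Gamma> < \<rho>" for \<eta> s
  proof -
    have eR: "norm (\<eta> t) \<le> R" for t
    proof -
      obtain x where x: "x \<in> ?\<Gamma>" "infdist (\<eta> t) ?\<Gamma> = dist (\<eta> t) x"
        using infdist_attains_inf[OF compact_imp_closed[OF cG], of "\<eta> t"] by auto
      then have "norm (\<eta> t - x) \<le> 1" using near[of t] \<rho> by (simp add: dist_norm)
      moreover have "norm x \<le> R0" using x(1) R0 by blast
      ultimately show ?thesis using norm_triangle_ineq2[of "\<eta> t" x] unfolding R_def by linarith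
    qed
    obtain x0 where "x0 \<in> ?\<Gamma>" "infdist (\<eta> s) ?\<Gamma> = dist (\<eta> s) x0"
      using infdist_attains_inf[OF compact_imp_closed[OF cG], of "\<eta> s"] by auto
    then obtain t0 where t0: "infdist (\<eta> s) ?\<Gamma> = dist (\<eta> s) (\<gamma> t0)" by (metis rangeE)
    define h where "h = \<eta> s - \<gamma> t0"
    define v where "v = F (\<gamma> t0)"
    have h: "norm h = infdist (\<eta> s) ?\<Gamma>" by (simp add: t0 h_def dist_norm)
    have h\<rho>: "norm h \<le> \<rho>" using near[of s] h by simp
    have vnz: "v \<noteq> 0" "v0 \<le> norm v" using Fg v0 by (auto simp: v_def)
    have orth: "h \<bullet> v = 0"
    proof -
      have "((\<lambda>t. (\<eta> s - \<gamma> t) \<bullet> (\<eta> s - \<gamma> t)) has_real_derivative - 2 * (h \<bullet> (\<tau> *\<^sub>R v))) (at t0)"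
        using g[unfolded gsol_def, rule_format, of t0] unfolding has_vector_derivative_def has_field_derivative_def h_def v_def
        by (auto intro!: derivative_eq_intros simp: fun_eq_iff inner_commute algebra_simps)
      moreover have "(\<eta> s - \<gamma> t0) \<bullet> (\<eta> s - \<gamma> t0) \<le> (\<eta> s - \<gamma> t) \<bullet> (\<eta> s - \<gamma> t)" for t
      proof -
        have "dist (\<eta> s) (\<gamma> t0) \<le> dist (\<eta> s) (\<gamma> t)" unfolding t0[symmetric] by (rule infdist_le) simp
        then show ?thesis by (simp add: dist_norm norm_le)
      qed
      ultimately have "- 2 * (h \<bullet> (\<tau> *\<^sub>R v)) = 0" by (intro DERIV_local_min[OF _ zero_less_one]) auto
      then show ?thesis using \<tau> by simp
    qed
    define c where "c = (\<lambda>t. \<gamma> (t0 + 1 * t))"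
    define y where "y = (\<lambda>t. \<eta> (s + 1 * t))"
    define z where "z = (\<lambda>t. y t - c t)"
    have gc': "gsol (1 * \<tau>) F c" "gsol (1 * \<tau>) F y" unfolding c_def y_def using g eta by (intro gsol_affine; simp)+
    have dc: "(c has_vector_derivative \<tau> *\<^sub>R F (c t)) (at t within {0..1})" 
      and dy: "(y has_vector_derivative \<tau> *\<^sub>R F (y t)) (at t within {0..1})" for t
      using gc' unfolding gsol_def by (auto intro: has_vector_derivative_at_within)
    have cR: "norm (c t) \<le> R" and yR: "norm (y t) \<le> R" for t using gR eR by (auto simp: c_def y_def)
    have dz: "(z has_vector_derivative \<tau> *\<^sub>R F (y t) - \<tau> *\<^sub>R F (c t)) (at t within {0..1})" for t
      unfolding z_def by (intro has_vector_derivative_diff dc dy)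
    have z0: "z 0 = h" by (simp add: z_def y_def c_def h_def)
    have zb: "norm (z t) \<le> C * norm h" if "t \<in> {0..1}" for t
    proof -
      have "norm (z t) \<le> (norm (z 0) + 0) * exp (\<bar>\<tau>\<bar> * M + 1)"
      proof (rule gronwall[OF dz _ _ _ that])
        fix t
        have "norm (\<tau> *\<^sub>R F (y t) - \<tau> *\<^sub>R F (c t)) = \<bar>\<tau>\<bar> * norm (F (y t) - F (c t))" by (simp flip: scaleR_diff_right)
        also have "\<dots> \<le> \<bar>\<tau>\<bar> * (M * norm (z t))" unfolding z_def by (intro mult_left_mono M(4) cR yR) auto
        finally show "norm (\<tau> *\<^sub>R F (y t) - \<tau> *\<^sub>R F (c t)) \<le> \<bar>\<tau>\<bar> * M * norm (z t) + 0" by simp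
      qed (use M in auto)
      then show ?thesis by (simp add: z0 C_def mult.commute)
    qed
    \<comment> \<open>The difference of the two solutions obeys the variational equation along
      \<gamma> with a forcing that is quadratic in h, so \<open>det_flow\<close> controls its
      transversal part.\<close>
    define w where "w = (\<lambda>t. \<tau> *\<^sub>R (F (y t) - F (c t) - D (c t) (z t)))"
    have wb: "norm (w t) \<le> \<bar>\<tau>\<bar> * (M * C\<^sup>2) * (norm h)\<^sup>2" if "t \<in> {0..1}" for t
    proof -
      have "norm (w t) \<le> \<bar>\<tau>\<bar> * (M * (norm (z t))\<^sup>2)" unfolding w_def z_def norm_scaleR
        by (intro mult_left_mono M(2) cR yR) auto
      also have "\<dots> \<le> \<bar>\<tau>\<bar> * (M * (C * norm h)\<^sup>2)" using zb[OF that] M(1) by (intro mult_left_mono power_mono) auto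
      finally show ?thesis by (simp add: power_mult_distrib mult_ac)
    qed
    have dz': "(z has_vector_derivative \<tau> *\<^sub>R D (c t) (z t) + w t) (at t within {0..1})" for t
    proof -
      have "\<tau> *\<^sub>R F (y t) - \<tau> *\<^sub>R F (c t) = \<tau> *\<^sub>R D (c t) (z t) + w t" by (simp add: w_def algebra_simps)
      then show ?thesis using dz[of t] by simp
    qed
    define J where "J = (\<lambda>t. integral {0..t} (\<lambda>s. tr2 (D (c s))))"
    define \<mu> where "\<mu> = (\<lambda>t. exp (- \<tau> * J t) * det2 (F (c t)) (z t))"
    have tc: "continuous_on S (\<lambda>s. tr2 (D (\<gamma> s)))" for S
      by (intro tr2_cont continuous_on_compose2[OF C11_cont_deriv[OF F, of UNIV] gc]) auto
    have ccc: "continuous_on S c" for S using gsol_cont[OF gc'(1)] .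
    have tc': "continuous_on S (\<lambda>s. tr2 (D (c s)))" for S
      by (intro tr2_cont continuous_on_compose2[OF C11_cont_deriv[OF F, of UNIV] ccc]) auto
    have J1: "J 1 = I" unfolding J_def I_def c_def using periodic_integral[OF tc, of t0] per by simp
    have J0: "J 0 = 0" by (simp add: J_def)
    have Jb: "\<bar>J t\<bar> \<le> 2 * M" if "t \<in> {0..1}" for t
    proof -
      have "norm (J t) \<le> 2 * M * (t - 0)" unfolding J_def
      proof (rule integral_bound)
        show "norm (tr2 (D (c u))) \<le> 2 * M" for u using tr2_bound[of "D (c u)"] M(3)[OF cR, of u] by simp
      qed (use that tc' in auto)
      also have "\<dots> \<le> 2 * M * 1" using that M(1) by (intro mult_left_mono) auto
      finally show ?thesis by simp
    qed
    have d\<mu>: "(\<mu> has_real_derivative exp (- \<tau> * J t) * det2 (F (c t)) (w t)) (at t within {0..1})" if "t \<in> {0..1}" for t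
      unfolding \<mu>_def J_def by (rule det_flow[OF F dc dz' that])
    have \<mu>b: "\<bar>\<mu> 1 - \<mu> 0\<bar> \<le> N1 * (norm h)\<^sup>2"
    proof -
      have "norm (\<mu> 1 - \<mu> 0) \<le> N1 * (norm h)\<^sup>2 * norm (1 - 0 :: real)"
      proof (rule field_differentiable_bound[of "{0..1}" \<mu>])
        fix t :: real assume t: "t \<in> {0..1}"
        show "(\<mu> has_real_derivative exp (- \<tau> * J t) * det2 (F (c t)) (w t)) (at t within {0..1})" by (rule d\<mu>[OF t])
        have e: "exp (- \<tau> * J t) \<le> exp (\<bar>\<tau>\<bar> * (2 * M))"
        proof -
          have "- \<tau> * J t \<le> \<bar>\<tau>\<bar> * \<bar>J t\<bar>" by (metis abs_ge_self abs_minus_cancel abs_mult)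
          also have "\<dots> \<le> \<bar>\<tau>\<bar> * (2 * M)" using Jb[OF t] by (intro mult_left_mono) auto
          finally show ?thesis by simp
        qed
        have "norm (exp (- \<tau> * J t) * det2 (F (c t)) (w t)) = exp (- \<tau> * J t) * \<bar>det2 (F (c t)) (w t)\<bar>" by (simp add: abs_mult)
        also have "\<dots> \<le> exp (\<bar>\<tau>\<bar> * (2 * M)) * (norm (F (c t)) * norm (w t))"
          by (intro mult_mono e det2_bound) auto
        also have "\<dots> \<le> exp (\<bar>\<tau>\<bar> * (2 * M)) * (M * (\<bar>\<tau>\<bar> * (M * C\<^sup>2) * (norm h)\<^sup>2))"
          using M(1) by (intro mult_left_mono mult_mono M(5) cR wb t) auto
        also have "\<dots> = N1 * (norm h)\<^sup>2" by (simp add: N1_def mult_ac)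
        finally show "norm (exp (- \<tau> * J t) * det2 (F (c t)) (w t)) \<le> N1 * (norm h)\<^sup>2" .
      qed auto
      then show ?thesis by simp
    qed
    have c01: "c 0 = \<gamma> t0" "c 1 = \<gamma> t0" using per[of t0] by (auto simp: c_def)
    have "\<mu> 0 = det2 v h" "\<mu> 1 = exp (- (\<tau> * I)) * det2 v (z 1)" by (auto simp: \<mu>_def J0 J1 c01 v_def z0)
    then have "\<bar>exp (- (\<tau> * I)) * det2 v (z 1)\<bar> \<le> norm v * norm h + N1 * (norm h)\<^sup>2"
      using \<mu>b det2_bound[of v h] by linarith
    then have "\<kappa> * (exp (- (\<tau> * I)) * \<bar>det2 v (z 1)\<bar>) \<le> \<kappa> * (norm v * norm h + N1 * (norm h)\<^sup>2)"
      using \<kappa> by (intro mult_left_mono) (auto simp: abs_mult)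
    moreover have "\<kappa> * (exp (- (\<tau> * I)) * \<bar>det2 v (z 1)\<bar>) = \<bar>det2 v (z 1)\<bar>" by (simp add: \<kappa>_def exp_minus)
    ultimately have dz1: "\<bar>det2 v (z 1)\<bar> \<le> \<kappa> * (norm v * norm h + N1 * (norm h)\<^sup>2)" by simp
    \<comment> \<open>The part of \<open>z 1\<close> along the velocity is the first order
      displacement of \<gamma> during time a. Comparing with the shifted point
      \<open>\<gamma> (t0 + a)\<close> removes it up to an error K a^2, and what remains is the
      transversal part, which has shrunk by \<kappa> up to a quadratic error.\<close>
    define a where "a = (z 1 \<bullet> v) / (norm v)\<^sup>2 / \<tau>"
    have nv: "norm v > 0" using vnz by simp
    have ab: "\<bar>a\<bar> \<le> C / (v0 * \<bar>\<tau>\<bar>) * norm h"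
    proof -
      have "\<bar>z 1 \<bullet> v\<bar> \<le> (C * norm h) * norm v" using Cauchy_Schwarz_ineq2[of "z 1" v] zb[of 1]
        by (meson atLeastAtMost_iff mult_right_mono norm_ge_zero order_refl order_trans zero_le_one)
      then have "\<bar>z 1 \<bullet> v\<bar> / (norm v)\<^sup>2 \<le> C * norm h / norm v" using nv by (simp add: power2_eq_square divide_simps)
      also have "\<dots> \<le> C * norm h / v0" using vnz v0 pos by (intro divide_left_mono) auto
      finally have "\<bar>z 1 \<bullet> v\<bar> / (norm v)\<^sup>2 / \<bar>\<tau>\<bar> \<le> C * norm h / v0 / \<bar>\<tau>\<bar>" by (rule divide_right_mono) simp
      then show ?thesis by (simp add: a_def abs_mult)
    qed
    have z1: "z 1 = a *\<^sub>R (\<tau> *\<^sub>R v) + (det2 v (z 1) / (norm v)\<^sup>2) *\<^sub>R rot v"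
      using plane_decomp[OF vnz(1), of "z 1"] \<tau> by (simp add: a_def)
    have "infdist (\<eta> (s + 1)) ?\<Gamma> \<le> dist (\<eta> (s + 1)) (\<gamma> (t0 + a))" by (rule infdist_le) simp
    also have "\<dots> = norm ((det2 v (z 1) / (norm v)\<^sup>2) *\<^sub>R rot v - (\<gamma> (t0 + a) - \<gamma> t0 - a *\<^sub>R (\<tau> *\<^sub>R F (\<gamma> t0))))"
    proof -
      have "\<eta> (s + 1) = \<gamma> t0 + z 1" using c01 by (simp add: z_def y_def)
      then have "\<eta> (s + 1) - \<gamma> (t0 + a) = (det2 v (z 1) / (norm v)\<^sup>2) *\<^sub>R rot v - (\<gamma> (t0 + a) - \<gamma> t0 - a *\<^sub>R (\<tau> *\<^sub>R F (\<gamma> t0)))"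
        using z1 by (simp add: v_def algebra_simps)
      then show ?thesis by (simp only: dist_norm)
    qed
    also have "\<dots> \<le> \<bar>det2 v (z 1)\<bar> / norm v + K * a\<^sup>2"
    proof (rule order_trans[OF norm_triangle_ineq4 add_mono[OF _ lin]])
      show "norm ((det2 v (z 1) / (norm v)\<^sup>2) *\<^sub>R rot v) \<le> \<bar>det2 v (z 1)\<bar> / norm v"
        using nv by (simp add: power2_eq_square)
    qed
    also have "\<dots> \<le> (\<kappa> * norm h + \<kappa> * N1 / v0 * (norm h)\<^sup>2) + K * (C / (v0 * \<bar>\<tau>\<bar>))\<^sup>2 * (norm h)\<^sup>2"
    proof (rule add_mono)
      have "\<bar>det2 v (z 1)\<bar> / norm v \<le> \<kappa> * (norm v * norm h + N1 * (norm h)\<^sup>2) / norm v"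
        using dz1 by (rule divide_right_mono) simp
      also have "\<dots> = \<kappa> * norm h + (\<kappa> * N1 * (norm h)\<^sup>2) / norm v"
        using nv by (simp add: add_divide_distrib distrib_left)
      also have "\<dots> \<le> \<kappa> * norm h + (\<kappa> * N1 * (norm h)\<^sup>2) / v0"
        using vnz v0 nv pos \<kappa> by (intro add_left_mono divide_left_mono) auto
      finally show "\<bar>det2 v (z 1)\<bar> / norm v \<le> \<kappa> * norm h + \<kappa> * N1 / v0 * (norm h)\<^sup>2" by simp
      have "a\<^sup>2 \<le> (C / (v0 * \<bar>\<tau>\<bar>) * norm h)\<^sup>2" using ab by (metis abs_ge_zero power2_abs power_mono)
      then have "K * a\<^sup>2 \<le> K * (C / (v0 * \<bar>\<tau>\<bar>) * norm h)\<^sup>2" using pos by (intro mult_left_mono)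
      then show "K * a\<^sup>2 \<le> K * (C / (v0 * \<bar>\<tau>\<bar>))\<^sup>2 * (norm h)\<^sup>2" by (simp only: power_mult_distrib mult.assoc)
    qed
    also have "\<dots> = \<kappa> * norm h + N * (norm h)\<^sup>2" by (simp add: N_def \<kappa>_def distrib_right)
    also have "\<dots> \<le> \<kappa> * norm h + N * (\<rho> * norm h)"
      using h\<rho> pos by (intro add_left_mono mult_left_mono) (auto simp: power2_eq_square mult_right_mono)
    also have "\<dots> = (\<kappa> + N * \<rho>) * norm h" by (simp add: algebra_simps)
    finally show ?thesis unfolding h .
  qed
  show ?thesis
  proof (rule that[OF \<rho>(1)])
    fix \<eta> T assume eta: "gsol \<tau> F \<eta>" and T: "T > 0" and p: "\<And>t. \<eta> (t + T) = \<eta> t"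
      and near: "\<And>t. infdist (\<eta> t) ?\<Gamma> < \<rho>"
    have "continuous_on {0..T} (\<lambda>t. infdist (\<eta> t) ?\<Gamma>)"
      by (intro continuous_on_infdist gsol_cont[OF eta])
    then obtain s where s: "\<And>t. t \<in> {0..T} \<Longrightarrow> infdist (\<eta> t) ?\<Gamma> \<le> infdist (\<eta> s) ?\<Gamma>"
      using continuous_attains_sup[of "{0..T}" "\<lambda>t. infdist (\<eta> t) ?\<Gamma>"] T by force
    have s: "infdist (\<eta> t) ?\<Gamma> \<le> infdist (\<eta> s) ?\<Gamma>" for t
    proof -
      obtain u where "u \<in> {0..<T}" "\<eta> t = \<eta> u" using periodic_rep[of \<eta> T t] p T by metis
      then show ?thesis using s[of u] by simp
    qed
    define m where "m = infdist (\<eta> s) ?\<Gamma>"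
    have m0: "m \<ge> 0" by (simp add: m_def infdist_nonneg)
    have "m \<le> (\<kappa> + N * \<rho>) * infdist (\<eta> (s - 1)) ?\<Gamma>" using main[OF eta near, of "s - 1"] by (simp add: m_def)
    also have "\<dots> \<le> (\<kappa> + N * \<rho>) * m" unfolding m_def using s \<kappa> pos \<rho> by (intro mult_left_mono) auto
    finally have le: "m \<le> (\<kappa> + N * \<rho>) * m" .
    have "m = 0"
    proof (rule ccontr)
      assume "m \<noteq> 0"
      then have "(\<kappa> + N * \<rho>) * m < 1 * m" using m0 \<kappa>\<rho> by (intro mult_strict_right_mono) auto
      then show False using le by simp
    qed
    then have "infdist (\<eta> t) ?\<Gamma> = 0" for t using s[of t] infdist_nonneg[of "\<eta> t" ?\<Gamma>] by (simp add: m_def)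
    then have "\<eta> t \<in> ?\<Gamma>" for t using in_closed_iff_infdist_zero[OF compact_imp_closed[OF cG], of "\<eta> t"] by simp
    then show "range \<eta> \<subseteq> ?\<Gamma>" by (rule image_subsetI)
  qed
qed

text \<open>With a positive divergence integral the orbit is run backwards, which keeps the integral
  and changes the sign of the time factor, so \<open>iso_core\<close> applies in both cases. The
  inclusion of orbits that it yields becomes an equality because two solutions that meet agree up to
  a shift of time.\<close>

lemma hyp_orbit_limit_cycle:
  assumes "hyp_orbit F \<Gamma>" shows "limit_cycle F \<Gamma>"
proof -
  obtain D \<tau> x where D: "C11 F D" and x: "closed_sol F \<tau> x" and \<Gamma>: "\<Gamma> = x ` {0..1}"
    and I: "integral {0..1} (\<lambda>t. tr2 (D (x t))) \<noteq> 0"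
    using assms unfolding hyp_orbit_def by blast
  have sF: "smooth F" using D by (auto simp: smooth_def)
  obtain \<gamma> where g: "gsol \<tau> F \<gamma>" "\<And>t. \<gamma> (t + 1) = \<gamma> t" "\<And>t. t \<in> {0..1} \<Longrightarrow> \<gamma> t = x t" "range \<gamma> = x ` {0..1}"
    using closed_sol_extend[OF x] by metis
  have \<tau>: "\<tau> > 0" "F (\<gamma> 0) \<noteq> 0" using x g(3)[of 0] by (auto simp: closed_sol_def)
  have tc: "continuous_on S (\<lambda>s. tr2 (D (\<gamma> s)))" for S
    by (intro tr2_cont continuous_on_compose2[OF C11_cont_deriv[OF D, of UNIV] gsol_cont[OF g(1)]]) auto
  define I where "I = integral {0..1} (\<lambda>t. tr2 (D (\<gamma> t)))"
  have I0: "I \<noteq> 0" using I g(3) unfolding I_def by (metis (mono_tags, lifting) integral_cong)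
  define \<sigma> :: real where "\<sigma> = (if I < 0 then 1 else -1)"
  have \<sigma>: "\<sigma> = 1 \<or> \<sigma> = -1" "\<sigma> * I < 0" "\<sigma> * \<sigma> = 1" using I0 by (auto simp: \<sigma>_def)
  define \<gamma>' where "\<gamma>' = (\<lambda>t. \<gamma> (0 + \<sigma> * t))"
  have g': "gsol (\<sigma> * \<tau>) F \<gamma>'" unfolding \<gamma>'_def by (rule gsol_affine[OF g(1)])
  have per: "\<gamma>' (t + 1) = \<gamma>' t" for t
    using \<sigma>(1) g(2)[of t] g(2)[of "- 1 - t"] by (auto simp: \<gamma>'_def add.commute)
  have r': "range \<gamma>' = \<Gamma>"
  proof -
    have "\<gamma> t = \<gamma>' (\<sigma> * t)" for t using \<sigma>(3) by (simp add: \<gamma>'_def flip: mult.assoc)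
    then have "range \<gamma> \<subseteq> range \<gamma>'" by (metis image_subsetI rangeI)
    moreover have "range \<gamma>' \<subseteq> range \<gamma>" by (auto simp: \<gamma>'_def)
    ultimately show ?thesis using g(4) \<Gamma> by simp
  qed
  have "integral {0..1} (\<lambda>t. tr2 (D (\<gamma>' t))) = I"
  proof (cases "\<sigma> = 1")
    case True then show ?thesis by (simp add: I_def \<gamma>'_def)
  next
    case False
    then have "\<sigma> = -1" using \<sigma>(1) by simp
    then have "integral {0..1} (\<lambda>t. tr2 (D (\<gamma>' t))) = integral {0..1} (\<lambda>t. tr2 (D (\<gamma> (- t))))" by (simp add: \<gamma>'_def)
    also have "\<dots> = integral {-1..-0} (\<lambda>t. tr2 (D (\<gamma> t)))"
      using Henstock_Kurzweil_Integration.integral_reflect_real[where a="-1" and b=0 and f="\<lambda>t. tr2 (D (\<gamma> t))"] by simp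
    also have "\<dots> = integral {0..1} (\<lambda>t. tr2 (D (\<gamma> (- 1 + t))))"
      using integral_shift[where a=0 and b=1 and c="-1" and f="\<lambda>t. tr2 (D (\<gamma> t))"] tc by (simp add: o_def)
    also have "\<dots> = I" unfolding I_def using g(2) by (intro periodic_integral tc) simp
    finally show ?thesis .
  qed
  then have "\<sigma> * \<tau> * integral {0..1} (\<lambda>t. tr2 (D (\<gamma>' t))) < 0"
    using \<sigma>(2) \<tau>(1) by (metis mult.assoc mult.commute mult_pos_neg)
  moreover have "\<sigma> * \<tau> \<noteq> 0" "F (\<gamma>' 0) \<noteq> 0" using \<sigma> \<tau> by (auto simp: \<gamma>'_def)
  ultimately obtain \<rho> where \<rho>: "\<rho> > 0"
    "\<And>\<eta> T. gsol (\<sigma> * \<tau>) F \<eta> \<Longrightarrow> T > 0 \<Longrightarrow> (\<And>t. \<eta> (t + T) = \<eta> t) \<Longrightarrow> (\<And>t. infdist (\<eta> t) (range \<gamma>') < \<rho>) \<Longrightarrow> range \<eta> \<subseteq> range \<gamma>'"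
    using iso_core[OF D _ g' per] by metis
  define U where "U = {q. infdist q \<Gamma> < \<rho>}"
  have "open U" unfolding U_def by (intro open_Collect_less continuous_intros)
  moreover have "\<Gamma> \<subseteq> U" using \<rho>(1) by (auto simp: U_def)
  moreover have "\<Gamma>' = \<Gamma>" if po: "periodic_orbit F \<Gamma>'" and sub: "\<Gamma>' \<subseteq> U" for \<Gamma>'
  proof -
    obtain \<eta> T where T: "T > 0" "\<And>t. (\<eta> has_vector_derivative F (\<eta> t)) (at t)" "\<And>t. \<eta> (t + T) = \<eta> t" "\<Gamma>' = range \<eta>"
      using po unfolding periodic_orbit_def by blast
    \<comment> \<open>The competing periodic orbit gets the same, possibly negative, time factor
      before the comparison.\<close>
    define c where "c = \<sigma> * \<tau>"
    have c: "c \<noteq> 0" using \<sigma> \<tau> by (auto simp: c_def)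
    define \<eta>' where "\<eta>' = (\<lambda>t. \<eta> (0 + c * t))"
    have "gsol 1 F \<eta>" using T by (simp add: gsol_def)
    from gsol_affine[OF this, of c 0] have e': "gsol (\<sigma> * \<tau>) F \<eta>'" by (simp add: \<eta>'_def c_def)
    have r'': "range \<eta>' = \<Gamma>'"
    proof -
      have "\<eta> t = \<eta>' (t / c)" for t using c by (simp add: \<eta>'_def)
      then have "range \<eta> \<subseteq> range \<eta>'" by (metis image_subsetI rangeI)
      moreover have "range \<eta>' \<subseteq> range \<eta>" by (auto simp: \<eta>'_def)
      ultimately show ?thesis using T(4) by simp
    qed
    have "range \<eta>' \<subseteq> range \<gamma>'"
    proof (rule \<rho>(2)[OF e'])
      show "T / \<bar>c\<bar> > 0" using T c by simp
      show "\<eta>' (t + T / \<bar>c\<bar>) = \<eta>' t" for t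
      proof (cases "c > 0")
        case True then show ?thesis using T(3)[of "c * t"] by (simp add: \<eta>'_def distrib_left)
      next
        case False then show ?thesis using T(3)[of "c * t - T"] c by (simp add: \<eta>'_def right_diff_distrib)
      qed
      show "infdist (\<eta>' t) (range \<gamma>') < \<rho>" for t using sub r'' unfolding r' U_def by blast
    qed
    then obtain b where "\<eta>' 0 = \<gamma>' b" by blast
    note u = gsol_unique[OF sF e' g' this]
    have e: "\<eta>' t = \<gamma>' (b + t)" "\<gamma>' t = \<eta>' (t - b)" for t
      using u[of t] u[of "t - b"] by simp_all
    have "range \<eta>' \<subseteq> range \<gamma>'" by (rule image_subsetI) (subst e(1), rule rangeI)
    moreover have "range \<gamma>' \<subseteq> range \<eta>'" by (rule image_subsetI) (subst e(2), rule rangeI)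
    ultimately have "range \<eta>' = range \<gamma>'" by (rule equalityI)
    then show ?thesis using r' r'' by simp
  qed
  moreover have "periodic_orbit F \<Gamma>" unfolding \<Gamma> by (rule closed_sol_periodic_orbit[OF sF x])
  ultimately show ?thesis unfolding limit_cycle_def by blast
qed


section \<open>Continuation of closed orbits\<close>

text \<open>Period and parameters are carried along as constant state variables, so that the time-one map depends on them.\<close>

definition ext_field :: "(plane \<times> real \<times> real \<Rightarrow> plane) \<Rightarrow> plane \<times> (real \<times> real) \<times> real \<Rightarrow> plane \<times> (real \<times> real) \<times> real" where
  "ext_field f = (\<lambda>z. (fst (fst (snd z)) *\<^sub>R f (fst z, snd (fst (snd z)), snd (snd z)), 0))"

lemma smooth_ext_field: assumes "smooth f" shows "smooth (ext_field f)"
  unfolding ext_field_def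
  by (intro smooth_Pair smooth_scaleR smooth_compose[OF _ assms] smooth_intros)

lemma ext_field_deriv:
  assumes f: "C11 f D" and F: "C11 (ext_field f) De"
  shows "De (x, ((\<tau>, a), b)) (u, ((\<tau>', a'), b')) = (\<tau>' *\<^sub>R f (x, a, b) + \<tau> *\<^sub>R D (x, a, b) (u, a', b'), 0)"
proof -
  let ?z = "(x, ((\<tau>, a), b))"
  let ?\<pi> = "\<lambda>z::plane \<times> (real \<times> real) \<times> real. (fst z, snd (fst (snd z)), snd (snd z))"
  have "(?\<pi> has_derivative ?\<pi>) (at ?z)" by (auto intro!: derivative_eq_intros)
  moreover have "(f has_derivative blinfun_apply (D (x, a, b))) (at (?\<pi> ?z))" using C11_deriv[OF f] by simp
  ultimately have "((\<lambda>z. f (?\<pi> z)) has_derivative (\<lambda>h. D (x, a, b) (?\<pi> h))) (at ?z)"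
    by (rule has_derivative_compose)
  then have "(ext_field f has_derivative (\<lambda>h. (fst (fst (snd ?z)) *\<^sub>R D (x, a, b) (fst h, snd (fst (snd h)), snd (snd h)) + fst (fst (snd h)) *\<^sub>R f (x, a, b), 0))) (at ?z)"
    unfolding ext_field_def by (auto intro!: derivative_eq_intros)
  from has_derivative_unique[OF C11_deriv[OF F] this] show ?thesis by simp
qed

lemma vderiv_fst: "(g has_vector_derivative g') F \<Longrightarrow> ((\<lambda>t. fst (g t)) has_vector_derivative fst g') F"
  by (rule bounded_linear.has_vector_derivative[OF bounded_linear_fst])
lemma vderiv_snd: "(g has_vector_derivative g') F \<Longrightarrow> ((\<lambda>t. snd (g t)) has_vector_derivative snd g') F"
  by (rule bounded_linear.has_vector_derivative[OF bounded_linear_snd])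

lemma const01:
  fixes c :: "real \<Rightarrow> 'a::real_normed_vector"
  assumes "\<And>t. t \<in> {0..1} \<Longrightarrow> (c has_vector_derivative 0) (at t within {0..1})" "t \<in> {0..1}"
  shows "c t = c 0"
  using has_vector_derivative_zero_constant[of "{0..1}" c] assms by (metis atLeastAtMost_iff convex_real_interval(5) order_refl zero_le_one)

lemma ext_ode:
  assumes "ode_sol (ext_field f) X" "X 0 = (p, z)" "t \<in> {0..1}"
  shows "snd (X t) = z" "((\<lambda>t. fst (X t)) has_vector_derivative fst (fst z) *\<^sub>R f (fst (X t), snd (fst z), snd z)) (at t within {0..1})"
proof -
  have d: "(X has_vector_derivative ext_field f (X t)) (at t within {0..1})" if "t \<in> {0..1}" for t
    using assms that by (simp add: ode_sol_def)
  have "((\<lambda>t. snd (X t)) has_vector_derivative 0) (at t within {0..1})" if "t \<in> {0..1}" for t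
    using vderiv_snd[OF d[OF that]] by (simp add: ext_field_def)
  from const01[OF this] have s: "snd (X t) = z" if "t \<in> {0..1}" for t using that assms(2) by simp
  show "snd (X t) = z" using s assms(3) .
  show "((\<lambda>t. fst (X t)) has_vector_derivative fst (fst z) *\<^sub>R f (fst (X t), snd (fst z), snd z)) (at t within {0..1})"
    using vderiv_fst[OF d[OF assms(3)]] s[OF assms(3)] by (simp add: ext_field_def)
qed

text \<open>The inverse function theorem is applied to \<open>((\<tau>, a), b) \<mapsto> (end point - p, b)\<close>.\<close>

lemma continue_closed_orbit:
  fixes f :: "plane \<times> real \<times> real \<Rightarrow> plane"
  assumes f: "C11 f D" and x0: "ode_sol (\<lambda>x. T *\<^sub>R f (x, 0, 0)) x0" "x0 0 = p" "x0 1 = p"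
    and nd: "\<And>u. u 0 = 0 \<Longrightarrow> (\<And>t. t \<in> {0..1} \<Longrightarrow> (u has_vector_derivative T *\<^sub>R D (x0 t, 0, 0) (u t, 1, 0)) (at t within {0..1}))
       \<Longrightarrow> det2 (f (p, 0, 0)) (u 1) \<noteq> 0"
  obtains \<delta> \<tau> a a' C X where "\<delta> > 0" "\<tau> 0 = T" "a 0 = 0" "C \<ge> 0"
    "\<And>b. \<bar>b\<bar> < \<delta> \<Longrightarrow> (a has_real_derivative a' b) (at b)"
    "\<And>b. \<bar>b\<bar> < \<delta> \<Longrightarrow> isCont \<tau> b"
    "\<And>b. \<bar>b\<bar> < \<delta> \<Longrightarrow> ode_sol (\<lambda>x. \<tau> b *\<^sub>R f (x, a b, b)) (X b) \<and> X b 0 = p \<and> X b 1 = p"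
    "\<And>b t. \<bar>b\<bar> < \<delta> \<Longrightarrow> t \<in> {0..1} \<Longrightarrow> norm (X b t - x0 t) \<le> C * (\<bar>\<tau> b - T\<bar> + \<bar>a b\<bar> + \<bar>b\<bar>)"
    "\<And>b. \<bar>b\<bar> < \<delta> \<Longrightarrow> \<exists>ua ub. ua 0 = 0 \<and> ub 0 = 0 \<and>
      (\<forall>t\<in>{0..1}. (ua has_vector_derivative \<tau> b *\<^sub>R D (X b t, a b, b) (ua t, 1, 0)) (at t within {0..1})) \<and>
      (\<forall>t\<in>{0..1}. (ub has_vector_derivative \<tau> b *\<^sub>R D (X b t, a b, b) (ub t, 0, 1)) (at t within {0..1})) \<and>
      a' b * det2 (f (p, a b, b)) (ua 1) + det2 (f (p, a b, b)) (ub 1) = 0"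
proof -
  have "smooth f" using f by (auto simp: smooth_def)
  then obtain De where De: "C11 (ext_field f) De" using smooth_ext_field unfolding smooth_def by blast
  note Def = ext_field_deriv[OF f De]
  define z0 :: "(real \<times> real) \<times> real" where "z0 = ((T, 0), 0)"
  define xe where "xe = (\<lambda>t. (x0 t, z0))"
  have xe: "ode_sol (ext_field f) xe" unfolding ode_sol_def xe_def ext_field_def z0_def
    using x0(1) by (auto simp: ode_sol_def intro!: has_vector_derivative_Pair derivative_eq_intros)
  have xe0: "xe 0 = (p, z0)" by (simp add: xe_def x0)
  obtain r C X \<Phi> where r: "r > 0" and C: "C \<ge> 0"
    and X: "\<And>q. q \<in> ball (p, z0) r \<Longrightarrow> X q 0 = q \<and> ode_sol (ext_field f) (X q)"
    and Xx: "\<And>t. t \<in> {0..1} \<Longrightarrow> X (p, z0) t = xe t"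
    and Xl: "\<And>q q' t. q \<in> ball (p, z0) r \<Longrightarrow> q' \<in> ball (p, z0) r \<Longrightarrow> t \<in> {0..1} \<Longrightarrow> norm (X q t - X q' t) \<le> C * norm (q - q')"
    and Xd: "\<And>q. q \<in> ball (p, z0) r \<Longrightarrow> ((\<lambda>q. X q 1) has_derivative blinfun_apply (\<Phi> q)) (at q)"
    and \<Phi>c: "continuous_on (ball (p, z0) r) \<Phi>"
    and \<Phi>: "\<And>q u. q \<in> ball (p, z0) r \<Longrightarrow> var_sol De (X q) u \<Longrightarrow> \<Phi> q (u 0) = u 1"
    and ex: "\<And>q h. q \<in> ball (p, z0) r \<Longrightarrow> \<exists>u. u 0 = h \<and> var_sol De (X q) u"
    by (rule flow_C1[OF De xe, unfolded xe0]) (rule that; assumption)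
  have inb: "z \<in> ball z0 r \<longleftrightarrow> (p, z) \<in> ball (p, z0) r" for z by (simp add: dist_Pair_Pair)
  define H where "H = (\<lambda>z. (fst (X (p, z) 1) - p, snd z))"
  \<comment> \<open>Writing \<open>H'\<close> through constant linear maps and \<Phi> reduces its
    continuity to that of \<Phi>.\<close>
  define L1 where "L1 = Blinfun (\<lambda>w::plane \<times> (real \<times> real) \<times> real. (fst w, 0::real))"
  define L2 where "L2 = Blinfun (\<lambda>h::(real \<times> real) \<times> real. (0::plane, h))"
  define L3 where "L3 = Blinfun (\<lambda>h::(real \<times> real) \<times> real. (0::plane, snd h))"
  have L: "blinfun_apply L1 = (\<lambda>w. (fst w, 0))" "blinfun_apply L2 = (\<lambda>h. (0, h))" "blinfun_apply L3 = (\<lambda>h. (0, snd h))"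
    unfolding L1_def L2_def L3_def
    by (intro bounded_linear_Blinfun_apply bounded_linear_Pair bounded_linear_fst bounded_linear_snd bounded_linear_zero bounded_linear_ident)+
  define H' where "H' = (\<lambda>z. (L1 o\<^sub>L \<Phi> (p, z) o\<^sub>L L2) + L3)"
  have H'a: "H' z h = (fst (\<Phi> (p, z) (0, h)), snd h)" for z h
    by (simp add: H'_def blinfun.add_left L)
  have dH: "(H has_derivative blinfun_apply (H' z)) (at z)" if "z \<in> ball z0 r" for z
  proof -
    have "((\<lambda>z. (p, z)) has_derivative (\<lambda>h. (0, h))) (at z)" by (auto intro!: derivative_eq_intros)
    from has_derivative_compose[OF this Xd[OF that[unfolded inb]]]
    have "((\<lambda>z. X (p, z) 1) has_derivative (\<lambda>h. \<Phi> (p, z) (0, h))) (at z)" .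
    then show ?thesis unfolding H_def H'a by (auto intro!: derivative_eq_intros)
  qed
  have cH: "continuous_on (ball z0 r) H'"
    unfolding H'_def
    by (intro continuous_intros bounded_bilinear.continuous_on[OF bounded_bilinear_blinfun_compose] continuous_on_compose2[OF \<Phi>c])
      (auto simp: dist_Pair_Pair)
  \<comment> \<open>The derivative of the end point with respect to the period is the velocity
    there; those with respect to the two parameters are end values of variational equations with a
    forcing.\<close>
  have par: "\<exists>ua ub. ua 0 = 0 \<and> ub 0 = 0 \<and>
      (\<forall>t\<in>{0..1}. (ua has_vector_derivative fst (fst z) *\<^sub>R D (fst (X (p, z) t), snd (fst z), snd z) (ua t, 1, 0)) (at t within {0..1})) \<and>
      (\<forall>t\<in>{0..1}. (ub has_vector_derivative fst (fst z) *\<^sub>R D (fst (X (p, z) t), snd (fst z), snd z) (ub t, 0, 1)) (at t within {0..1})) \<and>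
      (\<forall>k. fst (\<Phi> (p, z) (0, k)) = fst (fst k) *\<^sub>R f (fst (X (p, z) 1), snd (fst z), snd z) + snd (fst k) *\<^sub>R ua 1 + snd k *\<^sub>R ub 1)"
    if z: "z \<in> ball z0 r" for z
  proof -
    obtain \<tau> a b where zz: "z = ((\<tau>, a), b)" by (metis surj_pair)
    have q: "(p, z) \<in> ball (p, z0) r" using z inb by simp
    have Xz: "X (p, z) 0 = (p, z)" "ode_sol (ext_field f) (X (p, z))" using X[OF q] by auto
    define x where "x = (\<lambda>t. fst (X (p, z) t))"
    have Xt: "X (p, z) t = (x t, ((\<tau>, a), b))" if "t \<in> {0..1}" for t
      using ext_ode(1)[OF Xz(2,1) that] by (simp add: x_def zz prod_eq_iff)
    have dx: "(x has_vector_derivative \<tau> *\<^sub>R f (x t, a, b)) (at t within {0..1})" if "t \<in> {0..1}" for t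
      using ext_ode(2)[OF Xz(2,1) that] by (simp add: x_def[abs_def] zz)
    have v: "\<exists>u1. u1 0 = 0 \<and> (\<forall>t\<in>{0..1}. (u1 has_vector_derivative \<tau>' *\<^sub>R f (x t, a, b) + \<tau> *\<^sub>R D (x t, a, b) (u1 t, a', b')) (at t within {0..1}))
        \<and> fst (\<Phi> (p, z) (0, ((\<tau>', a'), b'))) = u1 1" for \<tau>' a' b'
    proof -
      obtain u where u: "u 0 = (0, ((\<tau>', a'), b'))" "var_sol De (X (p, z)) u" using ex[OF q] by metis
      have du: "(u has_vector_derivative (fst (fst (snd (u t))) *\<^sub>R f (x t, a, b) + \<tau> *\<^sub>R D (x t, a, b) (fst (u t), snd (fst (snd (u t))), snd (snd (u t))), 0)) (at t within {0..1})" if "t \<in> {0..1}" for t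
        using u(2)[unfolded var_sol_def, rule_format, OF that] Xt[OF that] Def[of "x t" \<tau> a b "fst (u t)" "fst (fst (snd (u t)))" "snd (fst (snd (u t)))" "snd (snd (u t))"]
        by simp
      have "((\<lambda>t. snd (u t)) has_vector_derivative 0) (at t within {0..1})" if "t \<in> {0..1}" for t
        using vderiv_snd[OF du[OF that]] by simp
      from const01[OF this] have s: "snd (u t) = ((\<tau>', a'), b')" if "t \<in> {0..1}" for t using that u(1) by simp
      show ?thesis
      proof (intro exI[of _ "\<lambda>t. fst (u t)"] conjI ballI)
        show "fst (u 0) = 0" using u(1) by simp
        show "((\<lambda>t. fst (u t)) has_vector_derivative \<tau>' *\<^sub>R f (x t, a, b) + \<tau> *\<^sub>R D (x t, a, b) (fst (u t), a', b')) (at t within {0..1})" if "t \<in> {0..1}" for t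
          using vderiv_fst[OF du[OF that]] s[OF that] by simp
        show "fst (\<Phi> (p, z) (0, ((\<tau>', a'), b'))) = fst (u 1)" using \<Phi>[OF q u(2)] u(1) by simp
      qed
    qed
    obtain ua where ua: "ua 0 = 0" "\<forall>t\<in>{0..1}. (ua has_vector_derivative \<tau> *\<^sub>R D (x t, a, b) (ua t, 1, 0)) (at t within {0..1})"
      "fst (\<Phi> (p, z) (0, ((0, 1), 0))) = ua 1" using v[of 0 1 0] by auto
    obtain ub where ub: "ub 0 = 0" "\<forall>t\<in>{0..1}. (ub has_vector_derivative \<tau> *\<^sub>R D (x t, a, b) (ub t, 0, 1)) (at t within {0..1})"
      "fst (\<Phi> (p, z) (0, ((0, 0), 1))) = ub 1" using v[of 0 0 1] by auto
    have ut: "fst (\<Phi> (p, z) (0, ((1, 0), 0))) = f (x 1, a, b)"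
    proof -
      \<comment> \<open>A change of \<tau> only rescales time, so its variation is explicit: t times
        the velocity.\<close>
      define u where "u = (\<lambda>t. (t *\<^sub>R f (x t, a, b), ((1::real, 0::real), 0::real)))"
      have "var_sol De (X (p, z)) u" unfolding var_sol_def
      proof
        fix t :: real assume t: "t \<in> {0..1}"
        have "((\<lambda>t. (x t, a, b)) has_vector_derivative (\<tau> *\<^sub>R f (x t, a, b), 0, 0)) (at t within {0..1})"
          by (intro has_vector_derivative_Pair dx[OF t] has_vector_derivative_const)
        from vector_derivative_diff_chain_within[OF this has_derivative_at_withinI[OF C11_deriv[OF f]]]
        have df: "((\<lambda>t. f (x t, a, b)) has_vector_derivative D (x t, a, b) (\<tau> *\<^sub>R f (x t, a, b), 0, 0)) (at t within {0..1})"
          by (simp add: o_def)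
        have "((\<lambda>t. t *\<^sub>R f (x t, a, b)) has_vector_derivative t *\<^sub>R D (x t, a, b) (\<tau> *\<^sub>R f (x t, a, b), 0, 0) + 1 *\<^sub>R f (x t, a, b)) (at t within {0..1})"
          by (intro has_vector_derivative_scaleR df) (auto intro!: derivative_eq_intros)
        moreover have "t *\<^sub>R D (x t, a, b) (\<tau> *\<^sub>R f (x t, a, b), 0, 0) = \<tau> *\<^sub>R D (x t, a, b) (t *\<^sub>R f (x t, a, b), 0, 0)"
        proof -
          have "D (x t, a, b) (c *\<^sub>R w, 0, 0) = c *\<^sub>R D (x t, a, b) (w, 0, 0)" for c w
            using blinfun.scaleR_right[of "D (x t, a, b)" c "(w, 0, 0)"] by simp
          then show ?thesis by simp
        qed
        ultimately have "((\<lambda>t. t *\<^sub>R f (x t, a, b)) has_vector_derivative 1 *\<^sub>R f (x t, a, b) + \<tau> *\<^sub>R D (x t, a, b) (t *\<^sub>R f (x t, a, b), 0, 0)) (at t within {0..1})"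
          by (simp add: add.commute)
        then show "(u has_vector_derivative De (X (p, z) t) (u t)) (at t within {0..1})"
          unfolding u_def Xt[OF t] Def by (intro has_vector_derivative_Pair has_vector_derivative_const)
      qed
      from \<Phi>[OF q this] show ?thesis by (simp add: u_def zero_prod_def)
    qed
    have "fst (\<Phi> (p, z) (0, k)) = fst (fst k) *\<^sub>R f (x 1, a, b) + snd (fst k) *\<^sub>R ua 1 + snd k *\<^sub>R ub 1" for k
    proof -
      have "(0::plane, k) = fst (fst k) *\<^sub>R (0, ((1, 0), 0)) + snd (fst k) *\<^sub>R (0, ((0, 1), 0)) + snd k *\<^sub>R (0, ((0, 0), 1))"
        by (simp add: prod_eq_iff)
      then show ?thesis by (simp only: blinfun.add_right blinfun.scaleR_right fst_add fst_scaleR ut ua(3) ub(3))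
    qed
    then show ?thesis using ua ub by (intro exI[of _ ua] exI[of _ ub]) (auto simp: zz x_def)
  qed
  have z0: "z0 \<in> ball z0 r" using r by simp
  have X0: "fst (X (p, z0) t) = x0 t" if "t \<in> {0..1}" for t using Xx[OF that] by (simp add: xe_def)
  \<comment> \<open>For k in the kernel the component along b vanishes at once; taking det2 with the
    velocity removes the component along the period, and the transversality assumption then kills
    the component along a.\<close>
  have inj: "inj (blinfun_apply (H' z0))"
  proof (rule linear_injective_0[THEN iffD2])
    show "linear (blinfun_apply (H' z0))" by (simp add: blinfun.bounded_linear_right bounded_linear.linear)
    show "\<forall>k. H' z0 k = 0 \<longrightarrow> k = 0"
    proof (intro allI impI)
      fix k assume k: "H' z0 k = 0"
      obtain ua ub where ua: "ua 0 = 0" "\<forall>t\<in>{0..1}. (ua has_vector_derivative fst (fst z0) *\<^sub>R D (fst (X (p, z0) t), snd (fst z0), snd z0) (ua t, 1, 0)) (at t within {0..1})"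
        and eq: "\<And>k. fst (\<Phi> (p, z0) (0, k)) = fst (fst k) *\<^sub>R f (fst (X (p, z0) 1), snd (fst z0), snd z0) + snd (fst k) *\<^sub>R ua 1 + snd k *\<^sub>R ub 1"
        using par[OF z0] by (elim exE conjE) (rule that; (assumption | erule spec))
      have n: "det2 (f (p, 0, 0)) (ua 1) \<noteq> 0"
        by (rule nd[of ua]) (use ua X0 in \<open>auto simp: z0_def\<close>)
      have k2: "snd k = 0" and k1: "fst (fst k) *\<^sub>R f (p, 0, 0) + snd (fst k) *\<^sub>R ua 1 = 0"
        using k eq[of k] X0[of 1] x0 by (auto simp: H'a z0_def zero_prod_def)
      have "snd (fst k) * det2 (f (p, 0, 0)) (ua 1) = det2 (f (p, 0, 0)) (fst (fst k) *\<^sub>R f (p, 0, 0) + snd (fst k) *\<^sub>R ua 1)"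
        by (simp add: det2_simps)
      then have k3: "snd (fst k) = 0" using k1 n by (simp add: det2_simps)
      moreover have "f (p, 0, 0) \<noteq> 0" using n by (auto simp: det2_simps)
      ultimately have "fst (fst k) = 0" using k1 by simp
      then show "k = 0" using k2 k3 by (simp add: prod_eq_iff)
    qed
  qed
  obtain ig where ig: "linear ig" "ig \<circ> blinfun_apply (H' z0) = id"
    using linear_injective_left_inverse[OF _ inj] by (metis blinfun.bounded_linear_right bounded_linear.linear)
  define invf where "invf = Blinfun ig"
  have "blinfun_apply invf = ig" unfolding invf_def using ig(1) by (simp add: bounded_linear_Blinfun_apply linear_conv_bounded_linear)
  then have invf: "invf o\<^sub>L H' z0 = id_blinfun" using ig(2) by (intro blinfun_eqI) (simp add: pointfree_idE)
  obtain U' V g g' where U': "open U'" "U' \<subseteq> ball z0 r" "z0 \<in> U'" and V: "open V" "H z0 \<in> V"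
    and hom: "homeomorphism U' V H g"
    and dg: "\<And>y. y \<in> V \<Longrightarrow> (g has_derivative (g' y)) (at y)"
    and g': "\<And>y. y \<in> V \<Longrightarrow> g' y = inv (blinfun_apply (H' (g y)))"
    and bij: "\<And>y. y \<in> V \<Longrightarrow> bij (blinfun_apply (H' (g y)))"
    by (rule inverse_function_theorem[OF open_ball dH cH z0 invf], assumption) (rule that; assumption)
  have H0: "H z0 = 0" using X0[of 1] x0 by (simp add: H_def z0_def zero_prod_def)
  obtain \<delta> where \<delta>: "\<delta> > 0" "ball 0 \<delta> \<subseteq> V" using V H0 by (metis openE)
  have inV: "(0, b) \<in> V" if "\<bar>b\<bar> < \<delta>" for b
  proof -
    have "((0::plane), b) \<in> ball 0 \<delta>" using that by (simp add: norm_Pair)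
    then show ?thesis using \<delta>(2) by blast
  qed
  \<comment> \<open>A preimage of (0, b) describes a closed orbit through p for the parameter b, so
    the local inverse supplies the period and a as functions of b.\<close>
  define zb where "zb = (\<lambda>b. g (0, b))"
  have zU: "zb b \<in> ball z0 r" and Hz: "H (zb b) = (0, b)" if "\<bar>b\<bar> < \<delta>" for b
    using hom inV[OF that] U'(2) unfolding homeomorphism_def zb_def by blast+
  have zb0: "zb 0 = z0" using hom U'(3) H0 unfolding homeomorphism_def zb_def by (metis zero_prod_def)
  define \<tau> where "\<tau> = (\<lambda>b. fst (fst (zb b)))"
  define a where "a = (\<lambda>b. snd (fst (zb b)))"
  have zbe: "zb b = ((\<tau> b, a b), b)" if "\<bar>b\<bar> < \<delta>" for b
    using Hz[OF that] by (simp add: \<tau>_def a_def H_def prod_eq_iff)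
  define k where "k = (\<lambda>b. g' (0, b) (0, 1))"
  have dzb: "(zb has_derivative (\<lambda>h. g' (0, b) (0, h))) (at b)" if "\<bar>b\<bar> < \<delta>" for b
  proof -
    have "((\<lambda>b. (0::plane, b)) has_derivative (\<lambda>h. (0, h))) (at b)" by (auto intro!: derivative_eq_intros)
    from has_derivative_compose[OF this dg[OF inV[OF that]]] show ?thesis unfolding zb_def .
  qed
  have lin: "g' (0, b) (0, h) = h *\<^sub>R k b" if "\<bar>b\<bar> < \<delta>" for b h
    using linear_scale[OF has_derivative_linear[OF dzb[OF that]], of h 1] by (simp add: k_def)
  have dzb': "(zb has_vector_derivative k b) (at b)" if "\<bar>b\<bar> < \<delta>" for b
    unfolding has_vector_derivative_def using dzb[OF that] lin[OF that] by (simp add: fun_eq_iff)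
  show thesis
  proof (rule that[of \<delta> \<tau> a C "\<lambda>b. snd (fst (k b))" "\<lambda>b t. fst (X (p, zb b) t)"])
    show "\<delta> > 0" "\<tau> 0 = T" "a 0 = 0" "C \<ge> 0" using \<delta> zb0 C by (auto simp: \<tau>_def a_def z0_def)
    fix b assume b: "\<bar>b\<bar> < \<delta>"
    show "(a has_real_derivative snd (fst (k b))) (at b)"
      unfolding has_real_derivative_iff_has_vector_derivative a_def by (rule vderiv_snd[OF vderiv_fst[OF dzb'[OF b]]])
    show "isCont \<tau> b" unfolding \<tau>_def
      by (rule has_vector_derivative_continuous[OF vderiv_fst[OF vderiv_fst[OF dzb'[OF b]]]])
    have q: "(p, zb b) \<in> ball (p, z0) r" using zU[OF b] inb by simp
    have Xz: "X (p, zb b) 0 = (p, zb b)" "ode_sol (ext_field f) (X (p, zb b))" using X[OF q] by auto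
    have X1: "fst (X (p, zb b) 1) = p" using Hz[OF b] by (simp add: H_def)
    show "ode_sol (\<lambda>x. \<tau> b *\<^sub>R f (x, a b, b)) (\<lambda>t. fst (X (p, zb b) t)) \<and> fst (X (p, zb b) 0) = p \<and> fst (X (p, zb b) 1) = p"
      using ext_ode(2)[OF Xz(2,1)] Xz(1) X1 zbe[OF b] by (simp add: ode_sol_def)
    show "norm (fst (X (p, zb b) t) - x0 t) \<le> C * (\<bar>\<tau> b - T\<bar> + \<bar>a b\<bar> + \<bar>b\<bar>)" if t: "t \<in> {0..1}" for t
    proof -
      have "norm (fst (X (p, zb b) t) - x0 t) \<le> norm (X (p, zb b) t - X (p, z0) t)"
        using norm_fst_le[of "fst (X (p, zb b) t - X (p, z0) t)" "snd (X (p, zb b) t - X (p, z0) t)"] X0[OF t]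
        unfolding prod.collapse by simp
      also have "\<dots> \<le> C * norm ((p, zb b) - (p, z0))" using Xl[OF q _ t, of "(p, z0)"] r by simp
      also have "norm ((p, zb b) - (p, z0)) = norm ((\<tau> b - T, a b), b)" using zbe[OF b] by (simp add: z0_def norm_Pair)
      also have "\<dots> \<le> (\<bar>\<tau> b - T\<bar> + \<bar>a b\<bar>) + \<bar>b\<bar>"
        using norm_Pair_le[of "(\<tau> b - T, a b)" b] norm_Pair_le[of "\<tau> b - T" "a b"] by simp
      finally show ?thesis using C by (simp add: mult_left_mono)
    qed
    \<comment> \<open>This is the derivative of the identity H (zb b) = (0, b). Taking det2 with the
      velocity below eliminates the derivative of the period and leaves a relation between
      \<open>a'\<close> and the variation in b.\<close>
    have Hk: "H' (zb b) (k b) = (0, 1)"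
      using g'[OF inV[OF b]] bij[OF inV[OF b]] unfolding k_def zb_def by (simp add: bij_is_surj surj_f_inv_f)
    obtain ua ub where u: "ua 0 = 0" "ub 0 = 0"
      "\<forall>t\<in>{0..1}. (ua has_vector_derivative fst (fst (zb b)) *\<^sub>R D (fst (X (p, zb b) t), snd (fst (zb b)), snd (zb b)) (ua t, 1, 0)) (at t within {0..1})"
      "\<forall>t\<in>{0..1}. (ub has_vector_derivative fst (fst (zb b)) *\<^sub>R D (fst (X (p, zb b) t), snd (fst (zb b)), snd (zb b)) (ub t, 0, 1)) (at t within {0..1})"
      and eq: "\<And>k. fst (\<Phi> (p, zb b) (0, k)) = fst (fst k) *\<^sub>R f (fst (X (p, zb b) 1), snd (fst (zb b)), snd (zb b)) + snd (fst k) *\<^sub>R ua 1 + snd k *\<^sub>R ub 1"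
      using par[OF zU[OF b]] by (elim exE conjE) (rule that; (assumption | erule spec))
    have "fst (fst (k b)) *\<^sub>R f (p, a b, b) + snd (fst (k b)) *\<^sub>R ua 1 + ub 1 = 0"
      using Hk eq[of "k b"] X1 zbe[OF b] by (simp add: H'a)
    then have "det2 (f (p, a b, b)) (fst (fst (k b)) *\<^sub>R f (p, a b, b) + snd (fst (k b)) *\<^sub>R ua 1 + ub 1) = 0"
      by (simp add: det2_simps)
    then have "snd (fst (k b)) * det2 (f (p, a b, b)) (ua 1) + det2 (f (p, a b, b)) (ub 1) = 0" by (simp add: det2_simps)
    then show "\<exists>ua ub. ua 0 = 0 \<and> ub 0 = 0 \<and>
      (\<forall>t\<in>{0..1}. (ua has_vector_derivative \<tau> b *\<^sub>R D (fst (X (p, zb b) t), a b, b) (ua t, 1, 0)) (at t within {0..1})) \<and>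
      (\<forall>t\<in>{0..1}. (ub has_vector_derivative \<tau> b *\<^sub>R D (fst (X (p, zb b) t), a b, b) (ub t, 0, 1)) (at t within {0..1})) \<and>
      snd (fst (k b)) * det2 (f (p, a b, b)) (ua 1) + det2 (f (p, a b, b)) (ub 1) = 0"
      using u zbe[OF b] by (intro exI[of _ ua] exI[of _ ub]) auto
  qed
qed


section \<open>Derivatives along lines, slices and transversality\<close>

lemma C11_dir:
  assumes "C11 f D" shows "((\<lambda>s. f (z + s *\<^sub>R h)) has_vector_derivative D z h) (at 0)"
proof -
  have "((\<lambda>s. z + s *\<^sub>R h) has_vector_derivative h) (at 0)"
    by (auto intro!: derivative_eq_intros simp: has_vector_derivative_def)
  from vector_derivative_diff_chain_within[OF this, of f "D z"] show ?thesis
    using has_derivative_at_withinI[OF C11_deriv[OF assms]] by (simp add: o_def)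
qed

text \<open>Smoothness supplies a derivative only as some \<open>D\<close>, whose values are
  therefore read off along lines. In particular a translation parameter is recognised as acting like
  a shift of the plane variable.\<close>

lemma C11_dir_eq:
  assumes "C11 f D" "C11 g D'" "\<And>s. f (z + s *\<^sub>R h) = g (z' + s *\<^sub>R h')"
  shows "D z h = D' z' h'"
  using C11_dir[OF assms(1), of z h] C11_dir[OF assms(2), of z' h'] assms(3) vector_derivative_unique_at by force

text \<open>Composition with it restricts a derivative in all variables to the plane variables,
  where its trace is the divergence for fixed parameters.\<close>

definition emb :: "plane \<Rightarrow>\<^sub>L (plane \<times> real \<times> real)" where "emb = Blinfun (\<lambda>u. (u, 0, 0))"

lemma emb_apply [simp]: "emb u = (u, 0, 0)"
  unfolding emb_def by (subst bounded_linear_Blinfun_apply) (auto intro!: bounded_linear_Pair bounded_linear_zero bounded_linear_ident simp: zero_prod_def)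

lemma norm_emb: "norm emb \<le> 1"
  by (rule norm_blinfun_bound) (auto simp: norm_Pair)

lemma C11_slice:
  assumes "C11 f D" shows "C11 (\<lambda>x::plane. f (x, a::real, b::real)) (\<lambda>x. D (x, a, b) o\<^sub>L emb)"
proof -
  have "C11 (\<lambda>x::plane. emb x + (0, a, b)) (\<lambda>_. Blinfun emb + 0)"
    by (intro C11_add C11_const C11_linear blinfun.bounded_linear_right)
  then have "C11 (\<lambda>x::plane. (x, a, b)) (\<lambda>_. emb)" by (simp add: blinfun_apply_inverse)
  from C11_compose[OF this assms] show ?thesis by simp
qed

lemma C11_shift:
  assumes "C11 (\<lambda>x. G (x + c)) D" shows "C11 G (\<lambda>x. D (x - c))"
proof -
  have "C11 (\<lambda>x. x + - c) (\<lambda>_. Blinfun (\<lambda>x. x) + 0)" by (intro C11_add C11_const C11_linear bounded_linear_ident)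
  from C11_compose[OF this assms] have "C11 G (\<lambda>x. D (x - c) o\<^sub>L Blinfun (\<lambda>x. x))" by simp
  moreover have "D (x - c) o\<^sub>L Blinfun (\<lambda>x. x) = D (x - c)" for x
    by (rule blinfun_eqI) (simp add: bounded_linear_Blinfun_apply bounded_linear_ident)
  ultimately show ?thesis by simp
qed

lemma closed_sol_shift:
  assumes "closed_sol (\<lambda>x. G (x + c)) \<tau> x" shows "closed_sol G \<tau> (\<lambda>t. x t + c)"
  using assms unfolding closed_sol_def ode_sol_def by (auto simp: has_vector_derivative_add_const)

text \<open>Continued orbits keep their base point fixed, the translation being put into the field;
  this moves them back to the field in question.\<close>

lemma hyp_orbit_shift:
  assumes "C11 (\<lambda>x. G (x + c)) D" "closed_sol (\<lambda>x. G (x + c)) \<tau> x" "integral {0..1} (\<lambda>t. tr2 (D (x t))) \<noteq> 0"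
  shows "hyp_orbit G ((\<lambda>t. x t + c) ` {0..1})"
  unfolding hyp_orbit_def
  using C11_shift[OF assms(1)] closed_sol_shift[OF assms(2)] assms(3) by (intro exI[of _ "\<lambda>x. D (x - c)"] exI) auto

text \<open>No continuity of the derivative is assumed: one interior point with positive derivative
  gives a strict increase just to its right, and monotonicity does the rest.\<close>

lemma deriv_gap:
  fixes m :: "real \<Rightarrow> real"
  assumes m: "\<And>t. t \<in> {0..1} \<Longrightarrow> (m has_real_derivative m' t) (at t within {0..1})"
    and nn: "\<And>t. t \<in> {0..1} \<Longrightarrow> m' t \<ge> 0" and s: "0 < s" "s < 1" "m' s > 0"
  shows "m 0 < m 1"
proof -
  have mc: "continuous_on {0..1} m" using m by (meson DERIV_continuous_on)
  have mi: "(m has_real_derivative m' t) (at t)" if "0 < t" "t < 1" for t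
    using m[of t] that by (simp add: at_within_Icc_at)
  have mono: "m a \<le> m b" if "0 \<le> a" "a \<le> b" "b \<le> 1" for a b
  proof (rule DERIV_nonneg_imp_increasing_open[OF that(2)])
    show "\<exists>y. (m has_real_derivative y) (at x) \<and> 0 \<le> y" if "a < x" "x < b" for x
      using mi[of x] nn[of x] that \<open>0 \<le> a\<close> \<open>b \<le> 1\<close> by (intro exI[of _ "m' x"]) auto
    show "continuous_on {a..b} m" using that by (intro continuous_on_subset[OF mc]) auto
  qed
  obtain d where d: "d > 0" "\<And>h. h > 0 \<Longrightarrow> h < d \<Longrightarrow> m s < m (s + h)"
    using DERIV_pos_inc_right[OF mi[OF s(1,2)] s(3)] by blast
  define h where "h = min (d / 2) (1 - s)"
  have h: "0 < h" "h < d" "s + h \<le> 1" using d s by (auto simp: h_def min_def)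
  have "m 0 \<le> m s" using mono[of 0 s] s by simp
  also have "\<dots> < m (s + h)" using d(2) h by simp
  also have "\<dots> \<le> m 1" using mono[of "s + h" 1] h s by simp
  finally show ?thesis .
qed

text \<open>Two ways of checking that a parameter derivative of the flow is transversal to the orbit.\<close>

lemma var_sign:
  fixes f :: "plane \<times> real \<times> real \<Rightarrow> plane"
  assumes f: "C11 f D" and x: "ode_sol (\<lambda>x. \<tau> *\<^sub>R f (x, a, b)) x" and \<tau>: "\<tau> > 0"
    and u: "u 0 = 0" "\<And>t. t \<in> {0..1} \<Longrightarrow> (u has_vector_derivative \<tau> *\<^sub>R D (x t, a, b) (u t, a', b')) (at t within {0..1})"
    and nn: "\<And>t. t \<in> {0..1} \<Longrightarrow> det2 (f (x t, a, b)) (D (x t, a, b) (0, a', b')) \<ge> 0"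
    and s: "0 < s" "s < 1" "det2 (f (x s, a, b)) (D (x s, a, b) (0, a', b')) > 0"
  shows "det2 (f (x 1, a, b)) (u 1) > 0"
proof -
  let ?J = "\<lambda>t. exp (- \<tau> * integral {0..t} (\<lambda>s. tr2 (D (x s, a, b) o\<^sub>L emb)))"
  \<comment> \<open>The forcing never turns to the negative side of the velocity, so this weighted
    determinant starts at 0, does not decrease, and grows strictly at time s.\<close>
  define \<mu> where "\<mu> = (\<lambda>t. ?J t * det2 (f (x t, a, b)) (u t))"
  have du: "(u has_vector_derivative \<tau> *\<^sub>R (D (x t, a, b) o\<^sub>L emb) (u t) + \<tau> *\<^sub>R D (x t, a, b) (0, a', b')) (at t within {0..1})" if "t \<in> {0..1}" for t
  proof -
    have "(u t, a', b') = (u t, 0, 0) + (0, a', b')" by simp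
    then have "D (x t, a, b) (u t, a', b') = D (x t, a, b) (u t, 0, 0) + D (x t, a, b) (0, a', b')" by (metis blinfun.add_right)
    then show ?thesis using u(2)[OF that] by (simp add: scaleR_add_right)
  qed
  have d: "(\<mu> has_real_derivative ?J t * det2 (f (x t, a, b)) (\<tau> *\<^sub>R D (x t, a, b) (0, a', b'))) (at t within {0..1})" if "t \<in> {0..1}" for t
    unfolding \<mu>_def
    by (rule det_flow[OF C11_slice[OF f] _ du that]) (use x in \<open>auto simp: ode_sol_def\<close>)
  have "\<mu> 0 < \<mu> 1"
    by (rule deriv_gap[OF d _ s(1,2)]) (use nn s \<tau> in \<open>auto simp: det2_simps\<close>)
  then show ?thesis using u(1) by (simp add: \<mu>_def det2_simps zero_less_mult_iff)
qed

lemma var_translation: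
  fixes f :: "plane \<times> real \<times> real \<Rightarrow> plane"
  assumes f: "C11 f D" and x: "ode_sol (\<lambda>x. \<tau> *\<^sub>R f (x, a, b)) x" "x 0 = p" "x 1 = p"
    and u: "u 0 = 0" "\<And>t. t \<in> {0..1} \<Longrightarrow> (u has_vector_derivative \<tau> *\<^sub>R D (x t, a, b) (u t, a', b')) (at t within {0..1})"
    and n: "\<And>z. D (z, a, b) (0, a', b') = D (z, a, b) (n, 0, 0)"
  shows "det2 (f (p, a, b)) (u 1) = (exp (\<tau> * integral {0..1} (\<lambda>t. tr2 (D (x t, a, b) o\<^sub>L emb))) - 1) * det2 (f (p, a, b)) n"
proof -
  let ?J = "\<lambda>t. exp (- \<tau> * integral {0..t} (\<lambda>s. tr2 (D (x s, a, b) o\<^sub>L emb)))"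
  \<comment> \<open>The parameter acts like a translation along n, so u + n solves the variational
    equation without forcing. Its weighted determinant is constant, and the determinant itself
    changes only by Liouville's factor.\<close>
  define U where "U = (\<lambda>t. u t + n)"
  define \<mu> where "\<mu> = (\<lambda>t. ?J t * det2 (f (x t, a, b)) (U t))"
  have du: "(U has_vector_derivative \<tau> *\<^sub>R (D (x t, a, b) o\<^sub>L emb) (U t) + 0) (at t within {0..1})" if "t \<in> {0..1}" for t
  proof -
    have "D (x t, a, b) (u t, a', b') = D (x t, a, b) (U t, 0, 0)"
      using blinfun.add_right[of "D (x t, a, b)" "(u t, 0, 0)" "(0, a', b')"] blinfun.add_right[of "D (x t, a, b)" "(u t, 0, 0)" "(n, 0, 0)"] n
      by (simp add: U_def)
    then show ?thesis using u(2)[OF that] by (simp add: U_def[abs_def] has_vector_derivative_add_const)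
  qed
  have d: "(\<mu> has_real_derivative ?J t * det2 (f (x t, a, b)) 0) (at t within {0..1})" if "t \<in> {0..1}" for t
    unfolding \<mu>_def
    by (rule det_flow[OF C11_slice[OF f] _ du that]) (use x in \<open>auto simp: ode_sol_def\<close>)
  have "\<mu> 1 = \<mu> 0"
    by (rule const01) (use d in \<open>auto simp: det2_simps has_real_derivative_iff_has_vector_derivative\<close>)
  then have "?J 1 * det2 (f (p, a, b)) (u 1 + n) = det2 (f (p, a, b)) n" using u(1) x by (simp add: \<mu>_def U_def)
  then have "exp (\<tau> * integral {0..1} (\<lambda>t. tr2 (D (x t, a, b) o\<^sub>L emb))) * (?J 1 * det2 (f (p, a, b)) (u 1 + n))
     = exp (\<tau> * integral {0..1} (\<lambda>t. tr2 (D (x t, a, b) o\<^sub>L emb))) * det2 (f (p, a, b)) n" by simp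
  then have "det2 (f (p, a, b)) (u 1 + n) = exp (\<tau> * integral {0..1} (\<lambda>t. tr2 (D (x t, a, b) o\<^sub>L emb))) * det2 (f (p, a, b)) n"
    by (simp add: exp_minus flip: mult.assoc)
  then show ?thesis by (simp add: det2_simps algebra_simps)
qed

text \<open>The base point p is kept, and the position p + a n on the normal section enters the
  field as a translation parameter; closing the orbit is then solved for the period and a as
  functions of b. By \<open>var_translation\<close> the nondegeneracy needed is that exp (T I)
  differs from 1, where I is the divergence integral, and this is hyperbolicity.\<close>

lemma hyp_persist:
  fixes F :: "plane \<times> real \<Rightarrow> plane"
  assumes F: "smooth F" and hyp: "hyp_orbit (\<lambda>x. F (x, 0)) \<Gamma>" and \<epsilon>: "\<epsilon> > 0"
  shows "\<exists>\<delta>>0. \<forall>b. \<bar>b\<bar> < \<delta> \<longrightarrow> (\<exists>\<Gamma>'. hyp_orbit (\<lambda>x. F (x, b)) \<Gamma>' \<and> (\<forall>q\<in>\<Gamma>'. infdist q \<Gamma> < \<epsilon>))"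
proof -
  obtain D0 T x0 where D0: "C11 (\<lambda>x. F (x, 0)) D0" and x0: "closed_sol (\<lambda>x. F (x, 0)) T x0" "\<Gamma> = x0 ` {0..1}"
    and I: "integral {0..1} (\<lambda>t. tr2 (D0 (x0 t))) \<noteq> 0"
    using hyp unfolding hyp_orbit_def by blast
  define p where "p = x0 0"
  define v where "v = F (p, 0)"
  define n where "n = rot v"
  have T: "T > 0" and o0: "ode_sol (\<lambda>x. T *\<^sub>R F (x, 0)) x0" and x01: "x0 0 = p" "x0 1 = p" and v: "v \<noteq> 0"
    using x0(1) by (auto simp: closed_sol_def p_def v_def)
  define f where "f = (\<lambda>z::plane \<times> real \<times> real. F (fst z + fst (snd z) *\<^sub>R n, snd (snd z)))"
  have "smooth f" unfolding f_def by (intro smooth_compose[OF _ F] smooth_intros smooth_scaleR)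
  then obtain D where D: "C11 f D" by (auto simp: smooth_def)
  have tr: "D (z, a, b) (0, 1, 0) = D (z, a, b) (n, 0, 0)" for z a b
    by (rule C11_dir_eq[OF D D]) (simp add: f_def algebra_simps)
  have D0e: "D (z, 0, 0) o\<^sub>L emb = D0 z" for z
    by (intro blinfun_eqI C11_dir_eq[OF C11_slice[OF D, of 0 0] D0]) (simp add: f_def)
  have o0': "ode_sol (\<lambda>x. T *\<^sub>R f (x, 0, 0)) x0" using o0 by (simp add: f_def)
  have fp: "f (p, 0, 0) = v" by (simp add: f_def v_def)
  define I where "I = integral {0..1} (\<lambda>t. tr2 (D (x0 t, 0, 0) o\<^sub>L emb))"
  have I0: "I \<noteq> 0" using I by (simp add: I_def D0e)
  have nd: "det2 (f (p, 0, 0)) (u 1) \<noteq> 0" if "u 0 = 0"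
    "\<And>t. t \<in> {0..1} \<Longrightarrow> (u has_vector_derivative T *\<^sub>R D (x0 t, 0, 0) (u t, 1, 0)) (at t within {0..1})" for u
    using var_translation[OF D o0' x01 that tr] v T I0 unfolding fp n_def I_def by (simp add: det2_rot)
  obtain \<delta> \<tau> a a' C X where \<delta>: "\<delta> > 0" and \<tau>0: "\<tau> 0 = T" and a0: "a 0 = 0" and C: "C \<ge> 0"
    and da: "\<And>b. \<bar>b\<bar> < \<delta> \<Longrightarrow> (a has_real_derivative a' b) (at b)"
    and c\<tau>: "\<And>b. \<bar>b\<bar> < \<delta> \<Longrightarrow> isCont \<tau> b"
    and X: "\<And>b. \<bar>b\<bar> < \<delta> \<Longrightarrow> ode_sol (\<lambda>x. \<tau> b *\<^sub>R f (x, a b, b)) (X b) \<and> X b 0 = p \<and> X b 1 = p"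
    and Xc: "\<And>b t. \<bar>b\<bar> < \<delta> \<Longrightarrow> t \<in> {0..1} \<Longrightarrow> norm (X b t - x0 t) \<le> C * (\<bar>\<tau> b - T\<bar> + \<bar>a b\<bar> + \<bar>b\<bar>)"
  proof (rule continue_closed_orbit[where f=f and D=D and T=T and ?x0.0=x0 and p=p])
    show "det2 (f (p, 0, 0)) (u 1) \<noteq> 0" if "u 0 = 0"
      "\<And>t. t \<in> {0..1} \<Longrightarrow> (u has_vector_derivative T *\<^sub>R D (x0 t, 0, 0) (u t, 1, 0)) (at t within {0..1})" for u
      by (rule nd[of u]) (rule that; assumption)+
  qed (rule D o0' x01 | rule that; assumption)+
  define m where "m = (\<lambda>b. \<bar>\<tau> b - T\<bar> + \<bar>a b\<bar> + \<bar>b\<bar>)"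
  have "isCont a 0" using da[of 0] \<delta> DERIV_isCont by auto
  then have mc: "isCont m 0" unfolding m_def using c\<tau>[of 0] \<delta> by (intro continuous_intros) auto
  have m0: "m 0 = 0" by (simp add: m_def \<tau>0 a0)
  have msmall: "\<exists>d>0. \<forall>b. \<bar>b\<bar> < d \<longrightarrow> m b < \<eta>" if "\<eta> > 0" for \<eta>
  proof -
    obtain d where "d > 0" "\<And>b. dist b 0 < d \<Longrightarrow> dist (m b) (m 0) < \<eta>"
      using mc \<open>\<eta> > 0\<close> unfolding continuous_at_eps_delta by blast
    then show ?thesis using m0 by (intro exI[of _ d]) (auto simp: dist_real_def abs_less_iff)
  qed
  have "bounded (x0 ` {0..1})" using ode_sol_cont[OF o0] by (intro compact_imp_bounded compact_continuous_image) auto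
  then obtain R0 where R0: "\<And>t. t \<in> {0..1} \<Longrightarrow> norm (x0 t) \<le> R0" unfolding bounded_iff by blast
  define K where "K = C + norm n + 1"
  have K: "K \<ge> 1" using C by (simp add: K_def)
  define R where "R = R0 + K"
  obtain M where M: "M > 0" "\<And>x y. norm x \<le> R \<Longrightarrow> norm y \<le> R \<Longrightarrow> norm (D y - D x) \<le> M * norm (y - x)"
     "\<And>x y. norm x \<le> R \<Longrightarrow> norm y \<le> R \<Longrightarrow> norm (f y - f x) \<le> M * norm (y - x)"
    using C11_bound[OF D, of R] by metis
  \<comment> \<open>In this order the bounds keep the orbit in the ball of radius \<open>R\<close>,
    place it within \<epsilon> of \<Gamma>, keep the period positive, the velocity at the base point
    nonzero, and the divergence integral nonzero.\<close>
  define \<eta> where "\<eta> = Min {1, \<epsilon> / K, T, norm v / (M * K), \<bar>I\<bar> / (2 * M * K)}"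
  have \<eta>: "\<eta> > 0" using T v M(1) K \<epsilon> I0 by (simp add: \<eta>_def)
  have \<eta>le: "\<eta> \<le> 1" "\<eta> \<le> \<epsilon> / K" "\<eta> \<le> T" "\<eta> \<le> norm v / (M * K)" "\<eta> \<le> \<bar>I\<bar> / (2 * M * K)"
    unfolding \<eta>_def by (rule Min_le; simp)+
  obtain d where d: "d > 0" "\<And>b. \<bar>b\<bar> < d \<Longrightarrow> m b < \<eta>" using msmall[OF \<eta>] by blast
  show ?thesis
  proof (intro exI[of _ "min d \<delta>"] conjI allI impI)
    show "min d \<delta> > 0" using d \<delta> by simp
    fix b assume "\<bar>b\<bar> < min d \<delta>"
    then have b: "\<bar>b\<bar> < \<delta>" and mb: "m b < \<eta>" using d by auto
    have mnn: "m b \<ge> 0" by (simp add: m_def)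
    have mparts: "\<bar>\<tau> b - T\<bar> \<le> m b" "\<bar>a b\<bar> + \<bar>b\<bar> \<le> m b" "\<bar>a b\<bar> \<le> m b" by (auto simp: m_def)
    have \<tau>b: "\<tau> b > 0" using mparts(1) mb \<eta>le(3) by linarith
    have near: "norm ((X b t, a b, b) - (x0 t, 0, 0)) \<le> K * m b" if "t \<in> {0..1}" for t
    proof -
      have "norm ((X b t, a b, b) - (x0 t, 0, 0)) \<le> norm (X b t - x0 t) + (\<bar>a b\<bar> + \<bar>b\<bar>)"
        using norm_Pair_le[of "X b t - x0 t" "(a b, b)"] norm_Pair_le[of "a b" b] by simp
      also have "\<dots> \<le> C * m b + m b" using Xc[OF b that] mparts by (simp add: m_def)
      also have "\<dots> = (C + 1) * m b" by (simp add: distrib_right)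
      also have "\<dots> \<le> K * m b" using mnn by (intro mult_right_mono) (simp_all add: K_def)
      finally show ?thesis .
    qed
    have Kmb: "K * m b \<le> K" "K * m b < \<epsilon>" "M * (K * m b) < norm v" "2 * (M * (K * m b)) < \<bar>I\<bar>"
    proof -
      show "K * m b \<le> K" using mb \<eta>le(1) K by (simp add: mult_left_le)
      have "m b < \<epsilon> / K" "m b < norm v / (M * K)" "m b < \<bar>I\<bar> / (2 * M * K)" using mb \<eta>le by linarith+
      then show "K * m b < \<epsilon>" "M * (K * m b) < norm v" "2 * (M * (K * m b)) < \<bar>I\<bar>"
        using K M(1) by (auto simp: pos_less_divide_eq mult_ac)
    qed
    have n0: "norm (x0 t, 0::real, 0::real) \<le> R" if "t \<in> {0..1}" for t
      using R0[OF that] K by (simp add: R_def norm_Pair)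
    have nX: "norm (X b t, a b, b) \<le> R" if "t \<in> {0..1}" for t
      using near[OF that] norm_triangle_ineq2[of "(X b t, a b, b)" "(x0 t, 0, 0)"] R0[OF that] Kmb(1)
      by (simp add: R_def norm_Pair)
    have fnz: "f (X b 0, a b, b) \<noteq> 0"
    proof
      assume 0: "f (X b 0, a b, b) = 0"
      have "norm (f (X b 0, a b, b) - f (x0 0, 0, 0)) \<le> M * norm ((X b 0, a b, b) - (x0 0, 0, 0))"
        by (intro M(3) n0 nX) auto
      also have "\<dots> \<le> M * (K * m b)" using near[of 0] M(1) by (intro mult_left_mono) auto
      finally show False using 0 fp x01 Kmb(3) by simp
    qed
    have cs: "closed_sol (\<lambda>x. f (x, a b, b)) (\<tau> b) (X b)"
      using X[OF b] \<tau>b fnz by (simp add: closed_sol_def)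
    have xc: "continuous_on {0..1} (X b)" using X[OF b] ode_sol_cont by blast
    have ct: "continuous_on {0..1} (\<lambda>t. tr2 (D (X b t, a b, b) o\<^sub>L emb))"
      by (intro tr2_cont continuous_on_compose2[OF C11_cont_deriv[OF C11_slice[OF D], of UNIV] xc]) auto
    have ct0: "continuous_on {0..1} (\<lambda>t. tr2 (D (x0 t, 0, 0) o\<^sub>L emb))"
      by (intro tr2_cont continuous_on_compose2[OF C11_cont_deriv[OF C11_slice[OF D], of UNIV] ode_sol_cont[OF o0]]) auto
    have Ib: "integral {0..1} (\<lambda>t. tr2 (D (X b t, a b, b) o\<^sub>L emb)) \<noteq> 0"
    proof
      assume 0: "integral {0..1} (\<lambda>t. tr2 (D (X b t, a b, b) o\<^sub>L emb)) = 0"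
      have "norm (integral {0..1} (\<lambda>t. tr2 (D (X b t, a b, b) o\<^sub>L emb) - tr2 (D (x0 t, 0, 0) o\<^sub>L emb))) \<le> 2 * (M * (K * m b)) * (1 - 0)"
      proof (rule integral_bound)
        fix t :: real assume t: "t \<in> {0..1}"
        have "tr2 (D (X b t, a b, b) o\<^sub>L emb) - tr2 (D (x0 t, 0, 0) o\<^sub>L emb) = tr2 ((D (X b t, a b, b) - D (x0 t, 0, 0)) o\<^sub>L emb)"
          by (simp add: tr2_def blinfun.diff_left)
        also have "norm \<dots> \<le> 2 * norm ((D (X b t, a b, b) - D (x0 t, 0, 0)) o\<^sub>L emb)" using tr2_bound by simp
        also have "\<dots> \<le> 2 * (norm (D (X b t, a b, b) - D (x0 t, 0, 0)) * norm emb)"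
          by (intro mult_left_mono norm_blinfun_compose) auto
        also have "\<dots> \<le> 2 * (norm (D (X b t, a b, b) - D (x0 t, 0, 0)) * 1)"
          by (intro mult_left_mono norm_emb) auto
        also have "\<dots> \<le> 2 * (M * norm ((X b t, a b, b) - (x0 t, 0, 0)))"
          using M(2)[OF n0[OF t] nX[OF t]] by simp
        also have "\<dots> \<le> 2 * (M * (K * m b))" using near[OF t] M(1) by (intro mult_left_mono) auto
        finally show "norm (tr2 (D (X b t, a b, b) o\<^sub>L emb) - tr2 (D (x0 t, 0, 0) o\<^sub>L emb)) \<le> 2 * (M * (K * m b))" .
      qed (use ct ct0 in \<open>auto intro!: continuous_intros\<close>)
      also have "integral {0..1} (\<lambda>t. tr2 (D (X b t, a b, b) o\<^sub>L emb) - tr2 (D (x0 t, 0, 0) o\<^sub>L emb)) = - I"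
        using 0 ct ct0 by (subst integral_diff) (auto intro: integrable_continuous_real simp: I_def)
      finally show False using Kmb(4) by simp
    qed
    have "C11 (\<lambda>x. (\<lambda>x. F (x, b)) (x + a b *\<^sub>R n)) (\<lambda>x. D (x, a b, b) o\<^sub>L emb)" using C11_slice[OF D, of "a b" b] by (simp add: f_def)
    moreover have "closed_sol (\<lambda>x. (\<lambda>x. F (x, b)) (x + a b *\<^sub>R n)) (\<tau> b) (X b)" using cs by (simp add: f_def)
    ultimately have "hyp_orbit (\<lambda>x. F (x, b)) ((\<lambda>t. X b t + a b *\<^sub>R n) ` {0..1})" using Ib by (rule hyp_orbit_shift)
    moreover have "infdist (X b t + a b *\<^sub>R n) \<Gamma> < \<epsilon>" if t: "t \<in> {0..1}" for t
    proof -
      have "infdist (X b t + a b *\<^sub>R n) \<Gamma> \<le> dist (X b t + a b *\<^sub>R n) (x0 t)" using t by (intro infdist_le) (auto simp: x0(2))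
      also have "\<dots> = norm ((X b t - x0 t) + a b *\<^sub>R n)" by (simp add: dist_norm algebra_simps)
      also have "\<dots> \<le> norm (X b t - x0 t) + \<bar>a b\<bar> * norm n" using norm_triangle_ineq[of "X b t - x0 t" "a b *\<^sub>R n"] by simp
      also have "\<dots> \<le> C * m b + m b * norm n"
        using Xc[OF b t] mparts(3) by (intro add_mono mult_right_mono) (auto simp: m_def)
      also have "\<dots> \<le> K * m b" using mnn by (simp add: K_def algebra_simps)
      finally show ?thesis using Kmb(2) by linarith
    qed
    ultimately show "\<exists>\<Gamma>'. hyp_orbit (\<lambda>x. F (x, b)) \<Gamma>' \<and> (\<forall>q\<in>\<Gamma>'. infdist q \<Gamma> < \<epsilon>)" by blast
  qed
qed


section \<open>A hyperbolic cycle of a van der Pol field\<close>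

lemma C11_dir_deriv:
  assumes "C11 f D" "((\<lambda>s. f (z + s *\<^sub>R h)) has_vector_derivative w) (at 0)"
  shows "D z h = w"
  by (rule vector_derivative_unique_at[OF C11_dir[OF assms(1)] assms(2)])

lemma C11_dir_affine:
  assumes "C11 f D" "\<And>s. f (z + s *\<^sub>R h) = f z + s *\<^sub>R w"
  shows "D z h = w"
  by (rule C11_dir_deriv[OF assms(1)])
    (unfold assms(2), auto intro!: derivative_eq_intros simp: has_vector_derivative_def)

text \<open>Rayleigh's form of the van der Pol equation, where the friction depends on the velocity
  y. The only nonlinear term is then y^3, which multiplied by x^(n-2) has degree n + 1.\<close>

definition vdp :: "real \<Rightarrow> real \<Rightarrow> plane \<Rightarrow> plane" where
  "vdp l c = (\<lambda>(x, y). (y, - x + l * y - c * y ^ 3))"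

lemma sin_square_integral: "((\<lambda>t. (sin (2 * pi * t))\<^sup>2) has_integral 1/2) {0..1}"
proof -
  have "((\<lambda>t. (sin (2 * pi * t))\<^sup>2) has_integral (1/2 - sin (4 * pi * 1) / (8 * pi)) - (0/2 - sin (4 * pi * 0) / (8 * pi))) {0..1}"
  proof (rule fundamental_theorem_of_calculus)
    fix t :: real
    have "((\<lambda>t. t / 2 - sin (4 * pi * t) / (8 * pi)) has_real_derivative 1/2 - cos (4 * pi * t) * (4 * pi) / (8 * pi)) (at t within {0..1})"
      by (auto intro!: derivative_eq_intros)
    moreover have "1/2 - cos (4 * pi * t) * (4 * pi) / (8 * pi) = (sin (2 * pi * t))\<^sup>2"
      using cos_double_sin[of "2 * pi * t"] by (simp add: mult_ac diff_divide_distrib)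
    ultimately show "((\<lambda>t. t / 2 - sin (4 * pi * t) / (8 * pi)) has_vector_derivative (sin (2 * pi * t))\<^sup>2) (at t within {0..1})"
      by (simp add: has_real_derivative_iff_has_vector_derivative)
  qed simp
  moreover have "sin (4 * pi) = 0" using sin_npi[of 4] by (simp add: mult.commute)
  ultimately show ?thesis by simp
qed

text \<open>Continuation of the unit circle of the harmonic oscillator: the damping \<open>a b\<close> is determined by the
  energy balance \<open>a \<integral> y\<^sup>2 = b \<integral> y\<^sup>4\<close>, which also decides the sign of the integrated divergence.\<close>

lemma vdp_hyp_orbit: "\<exists>l c \<Gamma>. hyp_orbit (vdp l c) \<Gamma>"
proof -
  define f where "f = (\<lambda>z::plane \<times> real \<times> real. (snd (fst z), - fst (fst z) + fst (snd z) * snd (fst z) - snd (snd z) * snd (fst z) ^ 3))"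
  have "smooth f" unfolding f_def by (intro smooth_intros)
  then obtain D where D: "C11 f D" by (auto simp: smooth_def)
  have D1: "D (z, a, b) (0, 1, 0) = (0, snd z)" for z a b
    by (rule C11_dir_affine[OF D]) (simp add: f_def algebra_simps)
  have Dtr: "tr2 (D (z, a, b) o\<^sub>L emb) = a - 3 * b * (snd z)\<^sup>2" for z a b
  proof -
    have "D (z, a, b) ((1, 0), 0, 0) = (0, -1)"
      by (rule C11_dir_affine[OF D]) (simp add: f_def algebra_simps)
    moreover have "D (z, a, b) ((0, 1), 0, 0) = (1, a - 3 * b * (snd z)\<^sup>2)"
    proof (rule C11_dir_deriv[OF D])
      have "((\<lambda>s. snd z + s) has_vector_derivative 1) (at 0)"
        by (auto intro!: derivative_eq_intros simp flip: has_real_derivative_iff_has_vector_derivative)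
      moreover have "((\<lambda>s. - fst z + a * (snd z + s) - b * (snd z + s) ^ 3) has_vector_derivative a - 3 * b * (snd z)\<^sup>2) (at 0)"
        by (auto intro!: derivative_eq_intros simp flip: has_real_derivative_iff_has_vector_derivative)
      ultimately have "((\<lambda>s. (snd z + s, - fst z + a * (snd z + s) - b * (snd z + s) ^ 3)) has_vector_derivative (1, a - 3 * b * (snd z)\<^sup>2)) (at 0)"
        by (rule has_vector_derivative_Pair)
      then show "((\<lambda>s. f ((z, a, b) + s *\<^sub>R ((0, 1), 0, 0))) has_vector_derivative (1, a - 3 * b * (snd z)\<^sup>2)) (at 0)"
        by (simp add: f_def)
    qed
    ultimately show ?thesis by (simp add: tr2_def)
  qed
  define x0 where "x0 = (\<lambda>t. (cos (2 * pi * t), - sin (2 * pi * t)))"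
  define p :: plane where "p = (1, 0)"
  have o0: "ode_sol (\<lambda>x. (2 * pi) *\<^sub>R f (x, 0, 0)) x0" unfolding ode_sol_def
  proof
    fix t :: real
    have "((\<lambda>t. cos (2 * pi * t)) has_vector_derivative 2 * pi * - sin (2 * pi * t)) (at t within {0..1})"
      "((\<lambda>t. - sin (2 * pi * t)) has_vector_derivative 2 * pi * - cos (2 * pi * t)) (at t within {0..1})"
      unfolding has_real_derivative_iff_has_vector_derivative[symmetric] by (auto intro!: derivative_eq_intros)
    from has_vector_derivative_Pair[OF this]
    show "(x0 has_vector_derivative (2 * pi) *\<^sub>R f (x0 t, 0, 0)) (at t within {0..1})" by (simp add: x0_def f_def)
  qed
  have x01: "x0 0 = p" "x0 1 = p" by (auto simp: x0_def p_def)
  have fp: "f (p, a, b) = (0, -1)" for a b by (simp add: f_def p_def)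
  have nd: "det2 (f (p, 0, 0)) (u 1) \<noteq> 0" if "u 0 = 0"
    "\<And>t. t \<in> {0..1} \<Longrightarrow> (u has_vector_derivative (2 * pi) *\<^sub>R D (x0 t, 0, 0) (u t, 1, 0)) (at t within {0..1})" for u
  proof -
    \<comment> \<open>The damping acts on the velocity and feeds energy at the rate y^2, which is
      nonnegative and equals 1 a quarter turn after the start; so it is transversal by
      \<open>var_sign\<close>.\<close>
    have d: "det2 (f (x0 t, 0, 0)) (D (x0 t, 0, 0) (0, 1, 0)) = (sin (2 * pi * t))\<^sup>2" for t
      by (simp add: D1 det2_def f_def x0_def power2_eq_square)
    have s: "sin (2 * pi * (1/4)) = 1" by simp
    have "0 < det2 (f (x0 1, 0, 0)) (u 1)"
    proof (rule var_sign[where f=f and D=D and \<tau>="2 * pi" and a=0 and b=0 and x=x0 and u=u and a'=1 and b'=0 and s="1/4", OF D o0])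
      show "0 < det2 (f (x0 (1/4), 0, 0)) (D (x0 (1/4), 0, 0) (0, 1, 0))" unfolding d s by simp
      show "0 \<le> det2 (f (x0 t, 0, 0)) (D (x0 t, 0, 0) (0, 1, 0))" for t unfolding d by simp
    qed (rule that; assumption | simp)+
    then show ?thesis using x01 by simp
  qed
  obtain \<delta> \<tau> a a' C X where \<delta>: "\<delta> > 0" and \<tau>0: "\<tau> 0 = 2 * pi" and a0: "a 0 = 0" and C: "C \<ge> 0"
    and da: "\<And>b. \<bar>b\<bar> < \<delta> \<Longrightarrow> (a has_real_derivative a' b) (at b)"
    and c\<tau>: "\<And>b. \<bar>b\<bar> < \<delta> \<Longrightarrow> isCont \<tau> b"
    and X: "\<And>b. \<bar>b\<bar> < \<delta> \<Longrightarrow> ode_sol (\<lambda>x. \<tau> b *\<^sub>R f (x, a b, b)) (X b) \<and> X b 0 = p \<and> X b 1 = p"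
    and Xc: "\<And>b t. \<bar>b\<bar> < \<delta> \<Longrightarrow> t \<in> {0..1} \<Longrightarrow> norm (X b t - x0 t) \<le> C * (\<bar>\<tau> b - 2 * pi\<bar> + \<bar>a b\<bar> + \<bar>b\<bar>)"
  proof (rule continue_closed_orbit[where f=f and D=D and T="2 * pi" and ?x0.0=x0 and p=p])
    show "det2 (f (p, 0, 0)) (u 1) \<noteq> 0" if "u 0 = 0"
      "\<And>t. t \<in> {0..1} \<Longrightarrow> (u has_vector_derivative (2 * pi) *\<^sub>R D (x0 t, 0, 0) (u t, 1, 0)) (at t within {0..1})" for u
      by (rule nd[of u]) (rule that; assumption)+
  qed (rule D o0 x01 | rule that; assumption)+
  define m where "m = (\<lambda>b. \<bar>\<tau> b - 2 * pi\<bar> + \<bar>a b\<bar> + \<bar>b\<bar>)"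
  have "isCont a 0" using da[of 0] \<delta> DERIV_isCont by auto
  then have mc: "isCont m 0" unfolding m_def using c\<tau>[of 0] \<delta> by (intro continuous_intros) auto
  have m0: "m 0 = 0" by (simp add: m_def \<tau>0 a0)
  \<comment> \<open>The second bound keeps the ordinate y within 1/100 of that of the unit circle;
    the first keeps the period positive.\<close>
  define \<eta> where "\<eta> = min 1 (1 / (100 * (C + 1)))"
  have \<eta>: "\<eta> > 0" "\<eta> \<le> 1" "\<eta> \<le> 1 / (100 * (C + 1))" using C by (auto simp: \<eta>_def)
  obtain d where d: "d > 0" "\<And>b. dist b 0 < d \<Longrightarrow> dist (m b) (m 0) < \<eta>"
    using mc \<eta>(1) unfolding continuous_at_eps_delta by blast
  \<comment> \<open>The parameter must not be 0, where the field is the harmonic oscillator with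
    circles for orbits; the final contradiction cancels the factor b.\<close>
  define b where "b = min d \<delta> / 2"
  have b: "b > 0" "\<bar>b\<bar> < \<delta>" "b < d" using d \<delta> by (auto simp: b_def min_def)
  have mb: "m b < \<eta>" using d(2)[of b] b m0 by (simp add: dist_real_def abs_less_iff)
  have mnn: "m b \<ge> 0" by (simp add: m_def)
  have \<tau>b: "\<tau> b > 0"
  proof -
    have "\<bar>\<tau> b - 2 * pi\<bar> \<le> m b" by (simp add: m_def)
    then show ?thesis using mb \<eta>(2) pi_gt3 by linarith
  qed
  define y where "y = (\<lambda>t. snd (X b t))"
  define x where "x = (\<lambda>t. fst (X b t))"
  have ynear: "\<bar>y t + sin (2 * pi * t)\<bar> \<le> 1/100" if "t \<in> {0..1}" for t
  proof -
    have "X b t - x0 t = (x t - cos (2 * pi * t), y t + sin (2 * pi * t))" by (simp add: prod_eq_iff x_def y_def x0_def)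
    then have "\<bar>y t + sin (2 * pi * t)\<bar> \<le> norm (X b t - x0 t)"
      using norm_snd_le[of "y t + sin (2 * pi * t)" "x t - cos (2 * pi * t)"] by simp
    also have "\<dots> \<le> C * m b" using Xc[OF b(2) that] by (simp add: m_def)
    also have "\<dots> \<le> (C + 1) * (1 / (100 * (C + 1)))" using C mb \<eta>(3) mnn by (intro mult_mono) auto
    also have "\<dots> = 1/100" using C by simp
    finally show ?thesis .
  qed
  have X': "ode_sol (\<lambda>x. \<tau> b *\<^sub>R f (x, a b, b)) (X b)" "X b 0 = p" "X b 1 = p" using X[OF b(2)] by auto
  have dX: "(X b has_vector_derivative \<tau> b *\<^sub>R f (X b t, a b, b)) (at t within {0..1})" if "t \<in> {0..1}" for t
    using X'(1) that by (simp add: ode_sol_def)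
  have dx: "(x has_real_derivative \<tau> b * y t) (at t within {0..1})" if "t \<in> {0..1}" for t
  proof -
    have "(x has_vector_derivative fst (\<tau> b *\<^sub>R f (X b t, a b, b))) (at t within {0..1})"
      unfolding x_def by (rule vderiv_fst[OF dX[OF that]])
    moreover have "fst (\<tau> b *\<^sub>R f (X b t, a b, b)) = \<tau> b * y t" by (simp add: f_def x_def y_def)
    ultimately show ?thesis by (simp only: has_real_derivative_iff_has_vector_derivative)
  qed
  have dy: "(y has_real_derivative \<tau> b * (- x t + a b * y t - b * y t ^ 3)) (at t within {0..1})" if "t \<in> {0..1}" for t
  proof -
    have "(y has_vector_derivative snd (\<tau> b *\<^sub>R f (X b t, a b, b))) (at t within {0..1})"
      unfolding y_def by (rule vderiv_snd[OF dX[OF that]])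
    moreover have "snd (\<tau> b *\<^sub>R f (X b t, a b, b)) = \<tau> b * (- x t + a b * y t - b * y t ^ 3)" by (simp add: f_def x_def y_def)
    ultimately show ?thesis by (simp only: has_real_derivative_iff_has_vector_derivative)
  qed
  have yc: "continuous_on {0..1} y" by (rule DERIV_continuous_on[OF dy])
  define A where "A = integral {0..1} (\<lambda>t. (y t)\<^sup>2)"
  define B where "B = integral {0..1} (\<lambda>t. y t ^ 4)"
  have iA: "(\<lambda>t. (y t)\<^sup>2) integrable_on {0..1}" and iB: "(\<lambda>t. y t ^ 4) integrable_on {0..1}"
    by (intro integrable_continuous_real continuous_intros yc)+
  have energy: "a b * A = b * B"
  proof -
    have "((\<lambda>t. ((x t)\<^sup>2 + (y t)\<^sup>2) / 2) has_real_derivative \<tau> b * (a b * (y t)\<^sup>2 - b * y t ^ 4)) (at t within {0..1})" if "t \<in> {0..1}" for t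
    proof -
      have "((\<lambda>t. (x t * x t + y t * y t) / 2) has_real_derivative
          (\<tau> b * y t * x t + \<tau> b * y t * x t + (\<tau> b * (- x t + a b * y t - b * y t ^ 3) * y t + \<tau> b * (- x t + a b * y t - b * y t ^ 3) * y t)) / 2) (at t within {0..1})"
        by (intro DERIV_cdivide DERIV_add DERIV_mult dx dy that)
      moreover have "(\<tau> b * y t * x t + \<tau> b * y t * x t + (\<tau> b * (- x t + a b * y t - b * y t ^ 3) * y t + \<tau> b * (- x t + a b * y t - b * y t ^ 3) * y t)) / 2
          = \<tau> b * (a b * (y t)\<^sup>2 - b * y t ^ 4)"
        by (simp add: algebra_simps power2_eq_square power3_eq_cube power4_eq_xxxx diff_divide_distrib add_divide_distrib)
      ultimately show ?thesis by (simp only: power2_eq_square)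
    qed
    then have "((\<lambda>t. \<tau> b * (a b * (y t)\<^sup>2 - b * y t ^ 4)) has_integral (((x 1)\<^sup>2 + (y 1)\<^sup>2) / 2 - ((x 0)\<^sup>2 + (y 0)\<^sup>2) / 2)) {0..1}"
      by (intro fundamental_theorem_of_calculus) (auto simp: has_real_derivative_iff_has_vector_derivative)
    from integral_unique[OF this] have "integral {0..1} (\<lambda>t. \<tau> b * (a b * (y t)\<^sup>2 - b * y t ^ 4)) = ((x 1)\<^sup>2 + (y 1)\<^sup>2) / 2 - ((x 0)\<^sup>2 + (y 0)\<^sup>2) / 2" .
    also have "\<dots> = 0" using X' by (simp add: x_def y_def)
    finally have "integral {0..1} (\<lambda>t. \<tau> b * (a b * (y t)\<^sup>2 - b * y t ^ 4)) = 0" .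
    moreover have "integral {0..1} (\<lambda>t. \<tau> b * (a b * (y t)\<^sup>2 - b * y t ^ 4)) = \<tau> b * (a b * A - b * B)"
      unfolding A_def B_def using iA iB by (simp add: integral_diff integrable_on_mult_right)
    ultimately show ?thesis using \<tau>b by simp
  qed
  \<comment> \<open>From |y + s| \<le> 1/100 and |s| \<le> 1 the squares of y and s differ by at
    most 3/100. As the mean of the squared sine is 1/2, this gives A \<ge> 47/100, and it gives B
    \<le> 103/100 A.\<close>
  have y2: "(y t)\<^sup>2 \<le> 103/100" "(sin (2 * pi * t))\<^sup>2 - 3/100 \<le> (y t)\<^sup>2" if "t \<in> {0..1}" for t
  proof -
    define s where "s = sin (2 * pi * t)"
    have s1: "\<bar>s\<bar> \<le> 1" by (simp add: s_def)
    have n: "\<bar>y t + s\<bar> \<le> 1/100" using ynear[OF that] by (simp add: s_def)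
    have yb: "\<bar>y t\<bar> \<le> 101/100" using n s1 by linarith
    have "\<bar>(y t)\<^sup>2 - s\<^sup>2\<bar> = \<bar>y t + s\<bar> * \<bar>y t - s\<bar>" by (simp add: power2_eq_square algebra_simps flip: abs_mult)
    also have "\<dots> \<le> (1/100) * 3" using n yb s1 by (intro mult_mono) linarith+
    finally have e: "\<bar>(y t)\<^sup>2 - s\<^sup>2\<bar> \<le> 3/100" by simp
    have "s\<^sup>2 \<le> 1" using s1 by (simp add: abs_square_le_1)
    then show "(y t)\<^sup>2 \<le> 103/100" "(sin (2 * pi * t))\<^sup>2 - 3/100 \<le> (y t)\<^sup>2" using e unfolding s_def by linarith+
  qed
  have A: "A \<ge> 47/100"
  proof -
    have "((\<lambda>t. (sin (2 * pi * t))\<^sup>2 - 3/100) has_integral 1/2 - 3/100 * (1 - 0)) {0..1}"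
      using has_integral_diff[OF sin_square_integral has_integral_const_real[of "3/100" 0 1]] by simp
    then have "1/2 - 3/100 * (1 - 0) \<le> A" unfolding A_def
      using iA y2(2) by (intro has_integral_le[OF _ integrable_integral]) auto
    then show ?thesis by simp
  qed
  have B: "B \<le> 103/100 * A"
  proof -
    have "B \<le> integral {0..1} (\<lambda>t. 103/100 * (y t)\<^sup>2)" unfolding B_def
    proof (rule integral_le[OF iB])
      show "(\<lambda>t. 103/100 * (y t)\<^sup>2) integrable_on {0..1}" using iA by (rule integrable_on_mult_right)
      show "y t ^ 4 \<le> 103/100 * (y t)\<^sup>2" if "t \<in> {0..1}" for t
        using mult_right_mono[OF y2(1)[OF that] zero_le_power2[of "y t"]] by (simp add: power2_eq_square power4_eq_xxxx mult.assoc)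
    qed
    then show ?thesis by (simp add: A_def)
  qed
  define I where "I = integral {0..1} (\<lambda>t. tr2 (D (X b t, a b, b) o\<^sub>L emb))"
  have I: "I = a b - 3 * b * A"
  proof -
    have "((\<lambda>t::real. a b) has_integral a b) {0..1}" using has_integral_const_real[of "a b" 0 1] by simp
    moreover have "((\<lambda>t. 3 * b * (y t)\<^sup>2) has_integral 3 * b * A) {0..1}"
      unfolding A_def by (rule has_integral_mult_right[OF integrable_integral[OF iA]])
    ultimately have "((\<lambda>t. a b - 3 * b * (y t)\<^sup>2) has_integral a b - 3 * b * A) {0..1}" by (rule has_integral_diff)
    then show ?thesis unfolding I_def Dtr y_def by (rule integral_unique)
  qed
  \<comment> \<open>If the integral vanished, then a = 3 b A. The energy balance would give B = 3
    A^2 and, since B is at most 103/100 A, also 3 A \<le> 103/100, whereas A is nearly 1/2.\<close>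
  have "I \<noteq> 0"
  proof
    assume "I = 0"
    then have ab: "a b = 3 * b * A" using I by simp
    have "b * B = b * (3 * A * A)" using energy[symmetric] unfolding ab by (simp only: mult_ac)
    then have "B = 3 * A * A" using b(1) by simp
    then have "3 * A * A \<le> 103/100 * A" using B by simp
    then have "3 * A \<le> 103/100" using A by (simp add: mult_le_cancel_right)
    then show False using A by linarith
  qed
  moreover have "closed_sol (\<lambda>x. f (x, a b, b)) (\<tau> b) (X b)" using X' \<tau>b fp by (simp add: closed_sol_def zero_prod_def)
  moreover note C11_slice[OF D, of "a b" b]
  ultimately have "hyp_orbit (\<lambda>x. f (x, a b, b)) (X b ` {0..1})" unfolding hyp_orbit_def I_def by blast
  moreover have "(\<lambda>x. f (x, a b, b)) = vdp (a b) b" by (auto simp: f_def vdp_def)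
  ultimately show ?thesis by metis
qed



text \<open>Up to the factor sqrt (1 + a^2) this is rotation of the field by the angle arctan a; in
  this form it keeps polynomials polynomial and does not raise their degree.\<close>

definition rotated :: "(plane \<Rightarrow> plane) \<Rightarrow> real \<Rightarrow> plane \<Rightarrow> plane" where
  "rotated F a = (\<lambda>x. F x + a *\<^sub>R rot (F x))"

text \<open>The closed orbits of the rotated fields near a limit cycle are the level sets of a differentiable
  function \<open>e\<close> on a section, and regular points of \<open>e\<close> are hyperbolic closed orbits.\<close>

lemma rotated_family:
  assumes F: "smooth F" and lc: "limit_cycle F \<Gamma>" and N: "open N" "\<Gamma> \<subseteq> N"
  obtains \<delta> e e' S where "\<delta> > 0" "e 0 = 0"
    "\<And>b. \<bar>b\<bar> < \<delta> \<Longrightarrow> (e has_real_derivative e' b) (at b)"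
    "\<And>b. \<bar>b\<bar> < \<delta> \<Longrightarrow> S b \<subseteq> N \<and> S b \<noteq> {}"
    "\<And>b. \<bar>b\<bar> < \<delta> \<Longrightarrow> e' b \<noteq> 0 \<Longrightarrow> hyp_orbit (rotated F (e b)) (S b)"
    "\<And>b b'. \<bar>b\<bar> < \<delta> \<Longrightarrow> \<bar>b'\<bar> < \<delta> \<Longrightarrow> e b = e b' \<Longrightarrow> S b = S b' \<Longrightarrow> b = b'"
    "\<And>b. \<bar>b\<bar> < \<delta> \<Longrightarrow> b \<noteq> 0 \<Longrightarrow> e b \<noteq> 0"
proof -
  obtain U where U: "open U" "\<Gamma> \<subseteq> U" "\<And>\<Gamma>'. periodic_orbit F \<Gamma>' \<Longrightarrow> \<Gamma>' \<subseteq> U \<Longrightarrow> \<Gamma>' = \<Gamma>" and po: "periodic_orbit F \<Gamma>"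
    using lc unfolding limit_cycle_def by blast
  obtain T x0 where x0: "closed_sol F T x0" "\<Gamma> = x0 ` {0..1}" and min: "\<And>t. 0 < t \<Longrightarrow> t < 1 \<Longrightarrow> x0 t \<noteq> x0 0"
    using periodic_orbit_closed_sol[OF F po] by metis
  define p where "p = x0 0"
  define v where "v = F p"
  define n where "n = rot v"
  have T: "T > 0" and o0: "ode_sol (\<lambda>x. T *\<^sub>R F x) x0" and x01: "x0 0 = p" "x0 1 = p" and v: "v \<noteq> 0"
    using x0(1) by (auto simp: closed_sol_def p_def v_def)
  have nv: "n \<noteq> 0" "n \<bullet> v = 0" "norm n = norm v" using v det2_simps(7)[of v] norm_rot[of v]
    by (auto simp: n_def det2_inner simp del: norm_rot)
  have x0c: "continuous_on {0..1} x0" by (rule ode_sol_cont[OF o0])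
  define f where "f = (\<lambda>z::plane \<times> real \<times> real. F (fst z + snd (snd z) *\<^sub>R n) + fst (snd z) *\<^sub>R rot (F (fst z + snd (snd z) *\<^sub>R n)))"
  have "smooth f" unfolding f_def
    by (intro smooth_add smooth_scaleR smooth_compose[OF _ smooth_linear[OF bounded_linear_rot]] smooth_compose[OF _ F] smooth_intros)
  then obtain D where D: "C11 f D" by (auto simp: smooth_def)
  have Db: "D (z, a, b) (0, 0, 1) = D (z, a, b) (n, 0, 0)" for z a b
    by (rule C11_dir_eq[OF D D]) (simp add: f_def algebra_simps)
  have Da: "D (z, a, b) (0, 1, 0) = rot (F (z + b *\<^sub>R n))" for z a b
    by (rule C11_dir_affine[OF D]) (simp add: f_def algebra_simps)
  have frot: "f (x, a, b) = rotated F a (x + b *\<^sub>R n)" for x a b by (simp add: f_def rotated_def)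
  \<comment> \<open>Wherever the field does not vanish, rotating it pushes strictly to one side of
    its orbits. Hence the closing condition can be solved for the rotation a, whether or not the
    cycle is hyperbolic.\<close>
  have fD: "det2 (f (z, a, b)) (D (z, a, b) (0, 1, 0)) = (norm (F (z + b *\<^sub>R n)))\<^sup>2" for z a b
    unfolding Da f_def by (simp add: det2_simps det2_rot)
  have fz: "f (z, a, b) = 0 \<longleftrightarrow> F (z + b *\<^sub>R n) = 0" for z a b
  proof
    assume "f (z, a, b) = 0"
    then have "det2 (f (z, a, b)) (D (z, a, b) (0, 1, 0)) = 0" by (simp add: det2_simps)
    then show "F (z + b *\<^sub>R n) = 0" unfolding fD by simp
  qed (simp add: f_def rot_def zero_prod_def)
  have o0': "ode_sol (\<lambda>x. T *\<^sub>R f (x, 0, 0)) x0" using o0 by (simp add: f_def)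
  have transv: "det2 (f (p, a, b)) (u 1) > 0" if "\<tau> > 0" "ode_sol (\<lambda>x. \<tau> *\<^sub>R f (x, a, b)) x" "x 0 = p" "x 1 = p" "f (p, a, b) \<noteq> 0"
     "u 0 = 0" "\<And>t. t \<in> {0..1} \<Longrightarrow> (u has_vector_derivative \<tau> *\<^sub>R D (x t, a, b) (u t, 1, 0)) (at t within {0..1})" for \<tau> a b x u
  proof -
    have xc: "continuous_on {0..1} x" by (rule ode_sol_cont[OF that(2)])
    have "continuous_on {0..1} (\<lambda>t. norm (F (x t + b *\<^sub>R n)))"
    proof -
      obtain DF where "C11 F DF" using F by (auto simp: smooth_def)
      then show ?thesis by (intro continuous_intros continuous_on_compose2[OF C11_cont[of F DF UNIV]] xc) auto
    qed
    moreover have "norm (F (x 0 + b *\<^sub>R n)) > 0" using fz[of p a b] that by simp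
    ultimately obtain d where d0: "d > 0"
      and d1: "\<And>t. t \<in> {0..1} \<Longrightarrow> dist t 0 < d \<Longrightarrow> dist (norm (F (x t + b *\<^sub>R n))) (norm (F (x 0 + b *\<^sub>R n))) < norm (F (x 0 + b *\<^sub>R n))"
      unfolding continuous_on_iff by (metis atLeastAtMost_iff order_refl zero_le_one)
    have d: "norm (F (x t + b *\<^sub>R n)) > 0" if "t \<in> {0..1}" "dist t 0 < d" for t
      using d1[OF that] by (auto simp: dist_real_def)
    define s where "s = min d 1 / 2"
    have s: "0 < s" "s < 1" "s < d" using d0 by (auto simp: s_def min_def)
    have "det2 (f (x 1, a, b)) (u 1) > 0"
      by (rule var_sign[OF D that(2,1,6,7) _ s(1,2)]) (use d[of s] s fD in \<open>auto simp: dist_real_def\<close>)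
    then show ?thesis using that by simp
  qed
  have fp: "f (p, 0, 0) = v" by (simp add: f_def v_def)
  obtain \<delta>0 \<tau> e e' C X where \<delta>0: "\<delta>0 > 0" and \<tau>0: "\<tau> 0 = T" and e0: "e 0 = 0" and C: "C \<ge> 0"
    and de: "\<And>b. \<bar>b\<bar> < \<delta>0 \<Longrightarrow> (e has_real_derivative e' b) (at b)"
    and c\<tau>: "\<And>b. \<bar>b\<bar> < \<delta>0 \<Longrightarrow> isCont \<tau> b"
    and X: "\<And>b. \<bar>b\<bar> < \<delta>0 \<Longrightarrow> ode_sol (\<lambda>x. \<tau> b *\<^sub>R f (x, e b, b)) (X b) \<and> X b 0 = p \<and> X b 1 = p"
    and Xc: "\<And>b t. \<bar>b\<bar> < \<delta>0 \<Longrightarrow> t \<in> {0..1} \<Longrightarrow> norm (X b t - x0 t) \<le> C * (\<bar>\<tau> b - T\<bar> + \<bar>e b\<bar> + \<bar>b\<bar>)"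
    and rel: "\<And>b. \<bar>b\<bar> < \<delta>0 \<Longrightarrow> \<exists>ua ub. ua 0 = 0 \<and> ub 0 = 0 \<and>
      (\<forall>t\<in>{0..1}. (ua has_vector_derivative \<tau> b *\<^sub>R D (X b t, e b, b) (ua t, 1, 0)) (at t within {0..1})) \<and>
      (\<forall>t\<in>{0..1}. (ub has_vector_derivative \<tau> b *\<^sub>R D (X b t, e b, b) (ub t, 0, 1)) (at t within {0..1})) \<and>
      e' b * det2 (f (p, e b, b)) (ua 1) + det2 (f (p, e b, b)) (ub 1) = 0"
  proof (rule continue_closed_orbit[where f=f and D=D and T=T and ?x0.0=x0 and p=p])
    show "det2 (f (p, 0, 0)) (u 1) \<noteq> 0" if "u 0 = 0"
      "\<And>t. t \<in> {0..1} \<Longrightarrow> (u has_vector_derivative T *\<^sub>R D (x0 t, 0, 0) (u t, 1, 0)) (at t within {0..1})" for u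
      using transv[OF T o0' x01 _ that] fp v by simp
  qed (rule D o0' x01 | rule that; assumption)+
  define m where "m = (\<lambda>b. \<bar>\<tau> b - T\<bar> + \<bar>e b\<bar> + \<bar>b\<bar>)"
  have "isCont e 0" using de[of 0] \<delta>0 DERIV_isCont by auto
  then have mc: "isCont m 0" unfolding m_def using c\<tau>[of 0] \<delta>0 by (intro continuous_intros) auto
  have m0: "m 0 = 0" by (simp add: m_def \<tau>0 e0)
  define y where "y = (\<lambda>b t. X b t + b *\<^sub>R n)"
  define S where "S = (\<lambda>b. y b ` {0..1})"
  define K where "K = C + norm n"
  have K: "K > 0" using C nv(1) by (simp add: K_def add_nonneg_pos)
  have ynear: "norm (y b t - x0 t) \<le> K * m b" if "\<bar>b\<bar> < \<delta>0" "t \<in> {0..1}" for b t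
  proof -
    have "norm (y b t - x0 t) \<le> norm (X b t - x0 t) + \<bar>b\<bar> * norm n"
      using norm_triangle_ineq[of "X b t - x0 t" "b *\<^sub>R n"] by (simp add: y_def algebra_simps)
    also have "\<dots> \<le> C * m b + m b * norm n" using Xc[OF that] by (intro add_mono mult_right_mono) (auto simp: m_def)
    also have "\<dots> = K * m b" by (simp add: K_def algebra_simps)
    finally show ?thesis .
  qed
  have y0: "y b 0 = p + b *\<^sub>R n" "y b 1 = p + b *\<^sub>R n" if "\<bar>b\<bar> < \<delta>0" for b using X[OF that] by (auto simp: y_def)
  have yode: "ode_sol (\<lambda>x. \<tau> b *\<^sub>R rotated F (e b) x) (y b)" if "\<bar>b\<bar> < \<delta>0" for b
    using X[OF that] unfolding ode_sol_def y_def frot by (auto simp: has_vector_derivative_add_const)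
  \<comment> \<open>Near p, and for small rotations, the field crosses the section line through p
    along n in the direction of v.\<close>
  obtain \<rho> where \<rho>: "\<rho> > 0" "\<And>q a. norm (q - p) < \<rho> \<Longrightarrow> \<bar>a\<bar> < \<rho> \<Longrightarrow> rotated F a q \<bullet> v > 0"
  proof -
    obtain DF where DF: "C11 F DF" using F by (auto simp: smooth_def)
    have "isCont (\<lambda>z. (F (fst z) + snd z *\<^sub>R rot (F (fst z))) \<bullet> v) (p, 0::real)"
    proof -
      have "continuous_on UNIV (\<lambda>z::plane \<times> real. (F (fst z) + snd z *\<^sub>R rot (F (fst z))) \<bullet> v)"
        by (intro continuous_intros continuous_on_compose2[OF C11_cont[OF DF, of UNIV]]
            bounded_linear.continuous_on[OF bounded_linear_rot]) auto
      then show ?thesis unfolding continuous_on_eq_continuous_at[OF open_UNIV] by (rule bspec) simp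
    qed
    moreover have "(F (fst (p, 0::real)) + snd (p, 0::real) *\<^sub>R rot (F (fst (p, 0::real)))) \<bullet> v > 0" using v by (simp flip: v_def)
    ultimately obtain d where d: "d > 0" "\<And>z. dist z (p, 0) < d \<Longrightarrow> (F (fst z) + snd z *\<^sub>R rot (F (fst z))) \<bullet> v > 0"
      unfolding continuous_at_eps_delta dist_real_def by (metis (no_types, lifting) abs_diff_less_iff diff_self)
    show thesis
    proof (rule that[of "d / 2"])
      show "d / 2 > 0" using d by simp
      fix q a assume "norm (q - p) < d / 2" "\<bar>a\<bar> < d / 2"
      then have "dist (q, a) (p, 0) < d" using norm_Pair_le[of "q - p" a] by (simp add: dist_norm)
      then show "rotated F a q \<bullet> v > 0" using d(2)[of "(q, a)"] by (simp add: rotated_def)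
    qed
  qed
  obtain \<kappa> where \<kappa>: "0 < \<kappa>" "\<kappa> < 1/2" "\<And>t. t \<in> {0..1} \<Longrightarrow> t \<le> \<kappa> \<or> 1 - \<kappa> \<le> t \<Longrightarrow> norm (x0 t - p) < \<rho> / 2"
  proof -
    obtain d1 where d1: "d1 > 0" "\<And>t. t \<in> {0..1} \<Longrightarrow> dist t 0 < d1 \<Longrightarrow> dist (x0 t) (x0 0) < \<rho> / 2"
      using x0c[unfolded continuous_on_iff, rule_format, of 0 "\<rho> / 2"] \<rho>(1) by auto
    obtain d2 where d2: "d2 > 0" "\<And>t. t \<in> {0..1} \<Longrightarrow> dist t 1 < d2 \<Longrightarrow> dist (x0 t) (x0 1) < \<rho> / 2"
      using x0c[unfolded continuous_on_iff, rule_format, of 1 "\<rho> / 2"] \<rho>(1) by auto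
    define k where "k = min (min d1 d2) (1/2) / 2"
    have k: "0 < k" "k < 1/2" "k < d1" "k < d2" using d1 d2 by (auto simp: k_def min_def)
    show thesis
    proof (rule that[OF k(1,2)])
      fix t assume "t \<in> {0..1}" "t \<le> k \<or> 1 - k \<le> t"
      then show "norm (x0 t - p) < \<rho> / 2" using d1(2)[of t] d2(2)[of t] k x01 by (auto simp: dist_norm)
    qed
  qed
  \<comment> \<open>Here the least period enters: away from the two ends of the time interval the
    cycle keeps a positive distance from p.\<close>
  obtain d0 where d0: "d0 > 0" "\<And>t. t \<in> {\<kappa>..1 - \<kappa>} \<Longrightarrow> d0 \<le> norm (x0 t - p)"
  proof -
    have "continuous_on {\<kappa>..1 - \<kappa>} (\<lambda>t. norm (x0 t - p))"
      using \<kappa> by (intro continuous_intros continuous_on_subset[OF x0c]) auto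
    then obtain s where s: "s \<in> {\<kappa>..1 - \<kappa>}" "\<And>t. t \<in> {\<kappa>..1 - \<kappa>} \<Longrightarrow> norm (x0 s - p) \<le> norm (x0 t - p)"
      using continuous_attains_inf[of "{\<kappa>..1 - \<kappa>}" "\<lambda>t. norm (x0 t - p)"] \<kappa> by force
    have "x0 s \<noteq> p" using min[of s] s(1) \<kappa> x01 by auto
    then show thesis using that[of "norm (x0 s - p)"] s(2) by simp
  qed
  have "compact \<Gamma>" unfolding x0(2) using x0c by (intro compact_continuous_image) auto
  then obtain \<omega> where \<omega>: "\<omega> > 0" "(\<Union>x\<in>\<Gamma>. ball x \<omega>) \<subseteq> N \<inter> U"
    using compact_subset_open_imp_ball_epsilon_subset[of \<Gamma> "N \<inter> U"] N U by (metis Int_greatest open_Int)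
  \<comment> \<open>The bounds keep the ends of the orbit and the rotation within the range of
    \<rho>, the middle of the orbit away from p, the orbit inside both N and U, and the period
    positive.\<close>
  define \<eta> where "\<eta> = Min {\<rho> / (2 * K), \<rho>, d0 / (2 * K), \<omega> / K, T}"
  have \<eta>: "\<eta> > 0" using T K \<rho>(1) d0(1) \<omega>(1) by (simp add: \<eta>_def)
  have \<eta>le: "\<eta> \<le> \<rho> / (2 * K)" "\<eta> \<le> \<rho>" "\<eta> \<le> d0 / (2 * K)" "\<eta> \<le> \<omega> / K" "\<eta> \<le> T"
    unfolding \<eta>_def by (rule Min_le; simp)+
  obtain d where d: "d > 0" "\<And>b. dist b 0 < d \<Longrightarrow> dist (m b) (m 0) < \<eta>"
    using mc \<eta> unfolding continuous_at_eps_delta by blast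
  define \<delta> where "\<delta> = min d \<delta>0"
  have \<delta>: "\<delta> > 0" "\<And>b. \<bar>b\<bar> < \<delta> \<Longrightarrow> \<bar>b\<bar> < \<delta>0" using d \<delta>0 by (auto simp: \<delta>_def)
  have small: "K * m b < \<rho> / 2" "\<bar>e b\<bar> < \<rho>" "K * m b < d0 / 2" "K * m b < \<omega>" "\<tau> b > 0" if "\<bar>b\<bar> < \<delta>" for b
  proof -
    have mb: "m b < \<eta>" using d(2)[of b] that m0 by (simp add: \<delta>_def dist_real_def abs_less_iff)
    have "m b < \<rho> / (2 * K)" "m b < d0 / (2 * K)" "m b < \<omega> / K" using mb \<eta>le by linarith+
    then show "K * m b < \<rho> / 2" "K * m b < d0 / 2" "K * m b < \<omega>" using K by (auto simp: field_simps)
    have "\<bar>e b\<bar> \<le> m b" "\<bar>\<tau> b - T\<bar> \<le> m b" by (auto simp: m_def)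
    then show "\<bar>e b\<bar> < \<rho>" "\<tau> b > 0" using mb \<eta>le by linarith+
  qed
  have fne: "rotated F (e b) (y b 0) \<noteq> 0" if b: "\<bar>b\<bar> < \<delta>" for b
  proof -
    have "norm (y b 0 - p) < \<rho>" using ynear[OF \<delta>(2)[OF b], of 0] small(1)[OF b] x01 \<rho>(1) by simp
    from \<rho>(2)[OF this small(2)[OF b]] show ?thesis by auto
  qed
  have ycs: "closed_sol (rotated F (e b)) (\<tau> b) (y b)" if b: "\<bar>b\<bar> < \<delta>" for b
    using yode[OF \<delta>(2)[OF b]] y0[OF \<delta>(2)[OF b]] fne[OF b] small(5)[OF b] by (simp add: closed_sol_def)
  have SN: "S b \<subseteq> N \<inter> U" if b: "\<bar>b\<bar> < \<delta>" for b
  proof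
    fix q assume "q \<in> S b"
    then obtain t where t: "t \<in> {0..1}" "q = y b t" by (auto simp: S_def)
    have "q \<in> ball (x0 t) \<omega>" using ynear[OF \<delta>(2)[OF b] t(1)] small(4)[OF b] t(2) by (simp add: dist_norm norm_minus_commute)
    then show "q \<in> N \<inter> U" using \<omega>(2) t(1) x0(2) by blast
  qed
  have hyp: "hyp_orbit (rotated F (e b)) (S b)" if b: "\<bar>b\<bar> < \<delta>" and ne: "e' b \<noteq> 0" for b
  proof -
    note b0 = \<delta>(2)[OF b]
    have Xb: "ode_sol (\<lambda>x. \<tau> b *\<^sub>R f (x, e b, b)) (X b)" "X b 0 = p" "X b 1 = p" using X[OF b0] by auto
    have fpb: "f (p, e b, b) \<noteq> 0" using fne[OF b] y0[OF b0] by (simp add: frot)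
    obtain ua ub where u: "ua 0 = 0" "ub 0 = 0"
      "\<forall>t\<in>{0..1}. (ua has_vector_derivative \<tau> b *\<^sub>R D (X b t, e b, b) (ua t, 1, 0)) (at t within {0..1})"
      "\<forall>t\<in>{0..1}. (ub has_vector_derivative \<tau> b *\<^sub>R D (X b t, e b, b) (ub t, 0, 1)) (at t within {0..1})"
      "e' b * det2 (f (p, e b, b)) (ua 1) + det2 (f (p, e b, b)) (ub 1) = 0"
      using rel[OF b0] by (elim exE conjE) (rule that; assumption)
    have "det2 (f (p, e b, b)) (ua 1) > 0"
      by (rule transv[of "\<tau> b" "e b" b "X b" ua]) (rule small(5)[OF b] Xb fpb u(1) u(3)[rule_format]; assumption?)+
    \<comment> \<open>The relation between the two variations turns a nonzero derivative of e into a
      nonzero variation in b; as b acts by translation, that variation is a multiple of the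
      exponential of the scaled divergence integral minus 1.\<close>
    then have "det2 (f (p, e b, b)) (ub 1) \<noteq> 0" using u(5) ne by auto
    moreover have "det2 (f (p, e b, b)) (ub 1) = (exp (\<tau> b * integral {0..1} (\<lambda>t. tr2 (D (X b t, e b, b) o\<^sub>L emb))) - 1) * det2 (f (p, e b, b)) n"
      by (rule var_translation[where f=f and D=D and x="X b" and u=ub and a'=0 and b'=1]) (rule D Xb u(2) Db u(4)[rule_format]; assumption?)+
    ultimately have I: "integral {0..1} (\<lambda>t. tr2 (D (X b t, e b, b) o\<^sub>L emb)) \<noteq> 0" by auto
    have "C11 (\<lambda>x. rotated F (e b) (x + b *\<^sub>R n)) (\<lambda>x. D (x, e b, b) o\<^sub>L emb)"
      using C11_slice[OF D, of "e b" b] by (simp add: frot)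
    moreover have "closed_sol (\<lambda>x. rotated F (e b) (x + b *\<^sub>R n)) (\<tau> b) (X b)"
      using Xb fpb small(5)[OF b] by (simp add: closed_sol_def frot)
    ultimately have "hyp_orbit (rotated F (e b)) ((\<lambda>t. X b t + b *\<^sub>R n) ` {0..1})" using I by (rule hyp_orbit_shift)
    then show ?thesis by (simp add: S_def y_def)
  qed
  have uniq: "b = b'" if b: "\<bar>b\<bar> < \<delta>" and b': "\<bar>b'\<bar> < \<delta>" and ee: "e b = e b'" and SS: "S b = S b'" for b b'
  proof -
    note b0 = \<delta>(2)[OF b] and b0' = \<delta>(2)[OF b']
    have "y b' 0 \<in> S b" unfolding SS by (auto simp: S_def)
    then obtain t1 where t1: "t1 \<in> {0..1}" "y b t1 = p + b' *\<^sub>R n" using y0[OF b0'] by (auto simp: S_def)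
    have b'n: "norm (b' *\<^sub>R n) < d0 / 2"
      using ynear[OF b0', of 0] y0[OF b0'] x01 small(3)[OF b'] by simp
    have nmid: "t1 < \<kappa> \<or> 1 - \<kappa> < t1"
    proof (rule ccontr)
      assume "\<not> ?thesis"
      then have "d0 \<le> norm (x0 t1 - p)" using d0(2) by simp
      moreover have "norm (x0 t1 - p) \<le> norm (y b t1 - x0 t1) + norm (y b t1 - p)"
        using norm_triangle_ineq4[of "y b t1 - p" "y b t1 - x0 t1"] by simp
      moreover have "norm (y b t1 - p) < d0 / 2" using t1(2) b'n by simp
      ultimately show False using ynear[OF b0 t1(1)] small(3)[OF b] by linarith
    qed
    \<comment> \<open>If the base point for b' lies on the orbit for b at time t1, then t1 is close
      to an end of the interval. Near the ends this height over the section line is strictly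
      increasing, and it vanishes at 0, at 1 and at t1, so t1 is itself an end.\<close>
    define \<phi> where "\<phi> = (\<lambda>t. (y b t - p) \<bullet> v)"
    have d\<phi>: "(\<phi> has_real_derivative \<tau> b * (rotated F (e b) (y b t) \<bullet> v)) (at t within {0..1})" if "t \<in> {0..1}" for t
    proof -
      have "(y b has_vector_derivative \<tau> b *\<^sub>R rotated F (e b) (y b t)) (at t within {0..1})"
        using yode[OF b0] that by (simp add: ode_sol_def)
      then show ?thesis unfolding \<phi>_def has_vector_derivative_def has_field_derivative_def
        by (auto intro!: derivative_eq_intros simp: fun_eq_iff)
    qed
    have pos: "rotated F (e b) (y b t) \<bullet> v > 0" if "t \<in> {0..1}" "t \<le> \<kappa> \<or> 1 - \<kappa> \<le> t" for t
    proof (rule \<rho>(2)[OF _ small(2)[OF b]])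
      show "norm (y b t - p) < \<rho>"
        using norm_triangle_ineq[of "y b t - x0 t" "x0 t - p"] ynear[OF b0 that(1)] small(1)[OF b] \<kappa>(3)[OF that] by simp
    qed
    have \<phi>c: "continuous_on {0..1} \<phi>" by (rule DERIV_continuous_on[OF d\<phi>])
    have inc: "\<phi> s < \<phi> t" if "0 \<le> s" "s < t" "t \<le> 1" "t \<le> \<kappa> \<or> 1 - \<kappa> \<le> s" for s t
    proof (rule DERIV_pos_imp_increasing_open[OF that(2)])
      show "continuous_on {s..t} \<phi>" using that by (intro continuous_on_subset[OF \<phi>c]) auto
      fix r assume r: "s < r" "r < t"
      then have "(\<phi> has_real_derivative \<tau> b * (rotated F (e b) (y b r) \<bullet> v)) (at r)"
        using d\<phi>[of r] that by (simp add: at_within_Icc_at)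
      moreover have "\<tau> b * (rotated F (e b) (y b r) \<bullet> v) > 0" using pos[of r] r that small(5)[OF b] by auto
      ultimately show "\<exists>l. (\<phi> has_real_derivative l) (at r) \<and> 0 < l" by blast
    qed
    have \<phi>01: "\<phi> 0 = 0" "\<phi> 1 = 0" "\<phi> t1 = 0" using y0[OF b0] t1(2) nv by (auto simp: \<phi>_def)
    have "t1 = 0 \<or> t1 = 1"
    proof (rule ccontr)
      assume "\<not> ?thesis"
      then have "0 < t1" "t1 < 1" using t1(1) by auto
      then show False using nmid inc[of 0 t1] inc[of t1 1] \<phi>01 by auto
    qed
    then have "p + b *\<^sub>R n = p + b' *\<^sub>R n" using t1(2) y0[OF b0] by auto
    then show ?thesis using nv(1) by simp
  qed
  have S0: "S 0 = \<Gamma>"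
  proof -
    have "y 0 t = x0 t" if "t \<in> {0..1}" for t using ynear[of 0 t] \<delta>0 that m0 by simp
    then show ?thesis by (simp add: S_def x0(2))
  qed
  show thesis
  proof (rule that[of \<delta> e e' S])
    show "\<delta> > 0" "e 0 = 0" by fact+
    show "\<And>b. \<bar>b\<bar> < \<delta> \<Longrightarrow> (e has_real_derivative e' b) (at b)" using de \<delta>(2) by blast
    show "\<And>b. \<bar>b\<bar> < \<delta> \<Longrightarrow> S b \<subseteq> N \<and> S b \<noteq> {}" using SN by (auto simp: S_def)
    show "\<And>b. \<bar>b\<bar> < \<delta> \<Longrightarrow> e' b \<noteq> 0 \<Longrightarrow> hyp_orbit (rotated F (e b)) (S b)" by (rule hyp)
    show "\<And>b b'. \<bar>b\<bar> < \<delta> \<Longrightarrow> \<bar>b'\<bar> < \<delta> \<Longrightarrow> e b = e b' \<Longrightarrow> S b = S b' \<Longrightarrow> b = b'" by (rule uniq)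
    fix b assume b: "\<bar>b\<bar> < \<delta>" "b \<noteq> 0"
    show "e b \<noteq> 0"
    proof
      assume eb: "e b = 0"
      have "periodic_orbit F (S b)"
        using closed_sol_periodic_orbit[OF F, of "\<tau> b" "y b"] ycs[OF b(1)] by (simp add: eb rotated_def S_def)
      then have "S b = \<Gamma>" using U(3) SN[OF b(1)] by blast
      then have "b = 0" using uniq[OF b(1), of 0] \<delta>(1) S0 eb e0 by simp
      then show False using b(2) by simp
    qed
  qed
qed


section \<open>Voronoi cells of the cycles, and one rotation for all of them\<close>

definition cell :: "plane set set \<Rightarrow> plane set \<Rightarrow> plane set" where
  "cell S \<Gamma> = (\<Inter>\<Gamma>'\<in>S - {\<Gamma>}. {q. infdist q \<Gamma> < infdist q \<Gamma>'})"

lemma open_cell: "finite S \<Longrightarrow> open (cell S \<Gamma>)"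
  unfolding cell_def by (intro open_INT ballI open_Collect_less continuous_intros) auto

lemma cell_disjoint: "\<Gamma> \<in> S \<Longrightarrow> \<Gamma>' \<in> S \<Longrightarrow> q \<in> cell S \<Gamma> \<Longrightarrow> q \<in> cell S \<Gamma>' \<Longrightarrow> \<Gamma> = \<Gamma>'"
proof (rule ccontr)
  assume "\<Gamma> \<in> S" "\<Gamma>' \<in> S" "q \<in> cell S \<Gamma>" "q \<in> cell S \<Gamma>'" "\<Gamma> \<noteq> \<Gamma>'"
  then have "infdist q \<Gamma> < infdist q \<Gamma>'" "infdist q \<Gamma>' < infdist q \<Gamma>" unfolding cell_def by blast+
  then show False by simp
qed

lemma periodic_orbit_gsol:
  assumes "smooth F" "periodic_orbit F \<Gamma>" obtains \<gamma> where "gsol 1 F \<gamma>" "\<Gamma> = range \<gamma>" "compact \<Gamma>" "\<Gamma> \<noteq> {}"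
proof -
  obtain \<gamma> T where g: "T > 0" "\<And>t. (\<gamma> has_vector_derivative F (\<gamma> t)) (at t)" "\<And>t. \<gamma> (t + T) = \<gamma> t" "\<Gamma> = range \<gamma>"
    using assms(2) unfolding periodic_orbit_def by blast
  have gs: "gsol 1 F \<gamma>" using g(2) by (simp add: gsol_def)
  have "range \<gamma> = \<gamma> ` {0..T}" by (rule periodic_range[of \<gamma>, OF g(3,1)])
  then have "compact \<Gamma>" unfolding g(4) using gsol_cont[OF gs] by (metis compact_continuous_image compact_Icc)
  then show thesis using that[OF gs g(4)] g(4) by blast
qed

lemma periodic_orbit_eq:
  assumes F: "smooth F" and "periodic_orbit F \<Gamma>" "periodic_orbit F \<Gamma>'" "q \<in> \<Gamma>" "q \<in> \<Gamma>'"
  shows "\<Gamma> = \<Gamma>'"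
proof -
  have sub: "A \<subseteq> B" if AB: "periodic_orbit F A" "periodic_orbit F B" "q \<in> A" "q \<in> B" for A B
  proof -
    obtain \<gamma> where g: "gsol 1 F \<gamma>" "A = range \<gamma>" using periodic_orbit_gsol[OF F AB(1)] by metis
    obtain \<eta> where h: "gsol 1 F \<eta>" "B = range \<eta>" using periodic_orbit_gsol[OF F AB(2)] by metis
    obtain a where a: "q = \<gamma> a" using AB(3) g(2) by blast
    obtain b where b: "q = \<eta> b" using AB(4) h(2) by blast
    have e: "\<gamma> t = \<eta> (b + (t - a))" for t
      using gsol_unique[OF F g(1) h(1), of a b "t - a"] a b by simp
    show ?thesis unfolding g(2) h(2) by (rule image_subsetI) (subst e, rule rangeI)
  qed
  show ?thesis using sub assms by (metis subset_antisym)
qed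

text \<open>Distinct periodic orbits are disjoint compact sets, so a point of one has positive
  distance from the others. The cells are open and pairwise disjoint, and thereby keep perturbed
  orbits of different cycles distinct.\<close>

lemma subset_cell:
  assumes F: "smooth F" and S: "\<And>\<Gamma>. \<Gamma> \<in> S \<Longrightarrow> periodic_orbit F \<Gamma>" and \<Gamma>: "\<Gamma> \<in> S"
  shows "\<Gamma> \<subseteq> cell S \<Gamma>"
  unfolding cell_def
proof (intro subsetI INT_I CollectI)
  fix q \<Gamma>' assume q: "q \<in> \<Gamma>" and \<Gamma>': "\<Gamma>' \<in> S - {\<Gamma>}"
  obtain \<gamma>' where c: "compact \<Gamma>'" "\<Gamma>' \<noteq> {}" using periodic_orbit_gsol[OF F S] \<Gamma>' by (metis DiffD1)
  have "q \<notin> \<Gamma>'" using periodic_orbit_eq[OF F S S _ q] \<Gamma> \<Gamma>' by blast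
  then have "infdist q \<Gamma>' \<noteq> 0" using in_closed_iff_infdist_zero[OF compact_imp_closed[OF c(1)] c(2)] by blast
  then show "infdist q \<Gamma> < infdist q \<Gamma>'" using q infdist_nonneg[of q \<Gamma>'] by simp
qed

text \<open>Sard's theorem in one variable, where differentiability at the critical points is
  enough. The line is written as \<open>real^1\<close> to match the form of
  \<open>baby_Sard\<close>.\<close>

lemma critical_values_negligible:
  fixes e :: "real \<Rightarrow> real"
  assumes "\<And>b. b \<in> A \<Longrightarrow> (e has_real_derivative 0) (at b)"
  shows "negligible ((\<lambda>b. e b *\<^sub>R (1::real^1)) ` A)"
proof -
  let ?g = "\<lambda>x::real^1. e (x $ 1) *\<^sub>R (1::real^1)"
  let ?B = "{x::real^1. x $ 1 \<in> A}"
  have "negligible (?g ` ?B)"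
  proof (rule baby_Sard[where f' = "\<lambda>_ _. 0"])
    show "CARD(1) \<le> CARD(1)" by simp
    fix x :: "real^1" assume "x \<in> ?B"
    then have "(e has_derivative (*) 0) (at (x $ 1))" using assms[of "x $ 1"] unfolding has_field_derivative_def by simp
    moreover have "((\<lambda>x::real^1. x $ 1) has_derivative (\<lambda>h. h $ 1)) (at x)"
      by (rule bounded_linear_imp_has_derivative[OF bounded_linear_vec_nth])
    ultimately have "((\<lambda>x. e (x $ 1)) has_derivative (\<lambda>h. 0 * h $ 1)) (at x)" by (rule has_derivative_compose[rotated])
    from has_derivative_at_withinI[OF has_derivative_scaleR_left[OF this, of 1]]
    show "(?g has_derivative (\<lambda>_. 0)) (at x within ?B)" by simp
    have "matrix (\<lambda>_::real^1. 0::real^1) = 0" by (simp add: matrix_def vec_eq_iff)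
    then show "rank (matrix (\<lambda>_::real^1. 0::real^1)) < CARD(1)" by simp
  qed
  moreover have "?g ` ?B = (\<lambda>b. e b *\<^sub>R (1::real^1)) ` A"
  proof -
    have "?g x \<in> (\<lambda>b. e b *\<^sub>R (1::real^1)) ` A" if "x \<in> ?B" for x
      by (rule image_eqI[of _ _ "x $ 1"]) (use that in auto)
    moreover have "e b *\<^sub>R (1::real^1) \<in> ?g ` ?B" if "b \<in> A" for b
      by (rule image_eqI[of _ _ "b *\<^sub>R 1"]) (use that in auto)
    ultimately show ?thesis by (intro equalityI image_subsetI)
  qed
  ultimately show ?thesis by simp
qed

text \<open>Packs the outcome of \<open>rotated_family\<close> into one predicate, so that a single
  choice turns its witnesses into functions of the cycle.\<close>

definition rot_data :: "(plane \<Rightarrow> plane) \<Rightarrow> plane set \<Rightarrow> real \<Rightarrow> (real \<Rightarrow> real) \<Rightarrow> (real \<Rightarrow> real) \<Rightarrow> (real \<Rightarrow> plane set) \<Rightarrow> bool" where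
  "rot_data F N \<delta> e e' Sf \<longleftrightarrow> \<delta> > 0 \<and> e 0 = 0 \<and>
    (\<forall>b. \<bar>b\<bar> < \<delta> \<longrightarrow> (e has_real_derivative e' b) (at b) \<and> Sf b \<subseteq> N \<and> Sf b \<noteq> {} \<and>
       (e' b \<noteq> 0 \<longrightarrow> hyp_orbit (rotated F (e b)) (Sf b)) \<and> (b \<noteq> 0 \<longrightarrow> e b \<noteq> 0) \<and>
       (\<forall>b'. \<bar>b'\<bar> < \<delta> \<longrightarrow> e b = e b' \<longrightarrow> Sf b = Sf b' \<longrightarrow> b = b'))"

text \<open>Every limit cycle has two sides, on each of which \<open>e\<close> has a sign. One sign is shared by at least as
  many sides as there are cycles, and for a small regular value of that sign each such side carries a
  hyperbolic closed orbit.\<close>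

lemma hyperbolize:
  assumes F: "smooth F" and fin: "finite S" and S: "\<And>\<Gamma>. \<Gamma> \<in> S \<Longrightarrow> limit_cycle F \<Gamma>"
  obtains \<epsilon> S' where "finite S'" "card S' = card S" "\<And>\<Gamma>. \<Gamma> \<in> S' \<Longrightarrow> hyp_orbit (rotated F \<epsilon>) \<Gamma>"
proof (cases "S = {}")
  case True then show thesis using that[of "{}"] by simp
next
  case False
  have po: "periodic_orbit F \<Gamma>" if "\<Gamma> \<in> S" for \<Gamma> using S[OF that] by (simp add: limit_cycle_def)
  have "\<exists>\<delta> e e' Sf. rot_data F (cell S \<Gamma>) \<delta> e e' Sf" if \<Gamma>: "\<Gamma> \<in> S" for \<Gamma>
  proof -
    obtain \<delta> e e' Sf where "\<delta> > 0" "e 0 = 0"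
    "\<And>b. \<bar>b\<bar> < \<delta> \<Longrightarrow> (e has_real_derivative e' b) (at b)"
    "\<And>b. \<bar>b\<bar> < \<delta> \<Longrightarrow> Sf b \<subseteq> cell S \<Gamma> \<and> Sf b \<noteq> {}"
    "\<And>b. \<bar>b\<bar> < \<delta> \<Longrightarrow> e' b \<noteq> 0 \<Longrightarrow> hyp_orbit (rotated F (e b)) (Sf b)"
    "\<And>b b'. \<bar>b\<bar> < \<delta> \<Longrightarrow> \<bar>b'\<bar> < \<delta> \<Longrightarrow> e b = e b' \<Longrightarrow> Sf b = Sf b' \<Longrightarrow> b = b'"
    "\<And>b. \<bar>b\<bar> < \<delta> \<Longrightarrow> b \<noteq> 0 \<Longrightarrow> e b \<noteq> 0"
      by (rule rotated_family[OF F S[OF \<Gamma>] open_cell[OF fin] subset_cell[OF F po \<Gamma>]]) (assumption | rule that; assumption)+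
    then have "rot_data F (cell S \<Gamma>) \<delta> e e' Sf" unfolding rot_data_def by simp
    then show ?thesis by blast
  qed
  then obtain \<delta> e e' Sf where rd: "\<And>\<Gamma>. \<Gamma> \<in> S \<Longrightarrow> rot_data F (cell S \<Gamma>) (\<delta> \<Gamma>) (e \<Gamma>) (e' \<Gamma>) (Sf \<Gamma>)" by metis
  have dpos: "\<delta> \<Gamma> > 0" if "\<Gamma> \<in> S" for \<Gamma>
    using rd[OF that] unfolding rot_data_def by (rule conjunct1)
  have e0: "e \<Gamma> 0 = 0" if "\<Gamma> \<in> S" for \<Gamma>
    using rd[OF that] unfolding rot_data_def by (rule conjunct1[OF conjunct2])
  have rb: "(e \<Gamma> has_real_derivative e' \<Gamma> b) (at b) \<and> Sf \<Gamma> b \<subseteq> cell S \<Gamma> \<and> Sf \<Gamma> b \<noteq> {} \<and>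
       (e' \<Gamma> b \<noteq> 0 \<longrightarrow> hyp_orbit (rotated F (e \<Gamma> b)) (Sf \<Gamma> b)) \<and> (b \<noteq> 0 \<longrightarrow> e \<Gamma> b \<noteq> 0) \<and>
       (\<forall>b'. \<bar>b'\<bar> < \<delta> \<Gamma> \<longrightarrow> e \<Gamma> b = e \<Gamma> b' \<longrightarrow> Sf \<Gamma> b = Sf \<Gamma> b' \<longrightarrow> b = b')" if "\<Gamma> \<in> S" "\<bar>b\<bar> < \<delta> \<Gamma>" for \<Gamma> b
    by (rule mp[OF spec[OF conjunct2[OF conjunct2[OF rd[OF that(1), unfolded rot_data_def]]]] that(2)])
  have de: "(e \<Gamma> has_real_derivative e' \<Gamma> b) (at b)" and cellb: "Sf \<Gamma> b \<subseteq> cell S \<Gamma>" "Sf \<Gamma> b \<noteq> {}"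
    and hypb: "e' \<Gamma> b \<noteq> 0 \<Longrightarrow> hyp_orbit (rotated F (e \<Gamma> b)) (Sf \<Gamma> b)" and enz: "b \<noteq> 0 \<Longrightarrow> e \<Gamma> b \<noteq> 0"
    and unq: "\<bar>b'\<bar> < \<delta> \<Gamma> \<Longrightarrow> e \<Gamma> b = e \<Gamma> b' \<Longrightarrow> Sf \<Gamma> b = Sf \<Gamma> b' \<Longrightarrow> b = b'"
    if "\<Gamma> \<in> S" "\<bar>b\<bar> < \<delta> \<Gamma>" for \<Gamma> b b'
    using rb[OF that] by blast+
  define W where "W = S \<times> {1, -1 :: real}"
  have finW: "finite W" and cW: "card W = 2 * card S" using fin by (auto simp: W_def card_cartesian_product)
  \<comment> \<open>A side is coded as a cycle with a sign of the section parameter. This is the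
    value of e halfway along the side; as e vanishes at 0, all values in between are taken on that
    side.\<close>
  define w where "w = (\<lambda>(\<Gamma>, \<sigma>). e \<Gamma> (\<sigma> * (\<delta> \<Gamma> / 2)))"
  have w0: "w s \<noteq> 0" if sW: "s \<in> W" for s
  proof -
    obtain \<Gamma> \<sigma> where s: "s = (\<Gamma>, \<sigma>)" "\<Gamma> \<in> S" "\<sigma> = 1 \<or> \<sigma> = -1" using sW by (auto simp: W_def)
    then have "\<bar>\<sigma> * (\<delta> \<Gamma> / 2)\<bar> < \<delta> \<Gamma>" "\<sigma> * (\<delta> \<Gamma> / 2) \<noteq> 0" using dpos[OF s(2)] by auto
    from enz[OF s(2) this] show ?thesis by (simp add: w_def s(1))
  qed
  \<comment> \<open>There are twice as many sides as cycles and w vanishes on none of them, so one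
    of the two signs belongs to at least half of the sides.\<close>
  have "\<exists>\<xi>::real. (\<xi> = 1 \<or> \<xi> = -1) \<and> card S \<le> card {s \<in> W. \<xi> * w s > 0}"
  proof (rule ccontr)
    assume n: "\<not> ?thesis"
    have "\<not> card S \<le> card {s \<in> W. 1 * w s > 0}" "\<not> card S \<le> card {s \<in> W. -1 * w s > 0}" using n by blast+
    then have "card {s \<in> W. 1 * w s > 0} < card S" "card {s \<in> W. -1 * w s > 0} < card S" by simp_all
    moreover have WW: "W = {s \<in> W. 1 * w s > 0} \<union> {s \<in> W. -1 * w s > 0}" using w0 by force
    ultimately show False
      using card_Un_le[of "{s \<in> W. 1 * w s > 0}" "{s \<in> W. -1 * w s > 0}"] arg_cong[OF WW, of card] cW by linarith
  qed
  then obtain \<xi> :: real where \<xi>: "\<xi> = 1 \<or> \<xi> = -1" and cQ: "card S \<le> card {s \<in> W. \<xi> * w s > 0}" by blast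
  define Q where "Q = {s \<in> W. \<xi> * w s > 0}"
  have finQ: "finite Q" using finW by (simp add: Q_def)
  have "Q \<noteq> {}" using cQ False fin by (auto simp flip: Q_def)
  define \<epsilon>0 where "\<epsilon>0 = Min ((\<lambda>s. \<xi> * w s) ` Q)"
  have "\<epsilon>0 \<in> (\<lambda>s. \<xi> * w s) ` Q" unfolding \<epsilon>0_def using finQ \<open>Q \<noteq> {}\<close> by (intro Min_in) auto
  then have \<epsilon>0: "\<epsilon>0 > 0" "\<And>s. s \<in> Q \<Longrightarrow> \<epsilon>0 \<le> \<xi> * w s"
    by (force simp: Q_def) (unfold \<epsilon>0_def, rule Min_le, simp add: finQ, rule imageI)
  \<comment> \<open>The critical values of the finitely many functions e form a negligible set, so
    the open set of admissible values contains one that is regular for all of them.\<close>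
  define Cr where "Cr = (\<lambda>\<Gamma>. (\<lambda>b. e \<Gamma> b *\<^sub>R (1::real^1)) ` {b. \<bar>b\<bar> < \<delta> \<Gamma> \<and> e' \<Gamma> b = 0})"
  have "negligible (Cr \<Gamma>)" if "\<Gamma> \<in> S" for \<Gamma> unfolding Cr_def
  proof (rule critical_values_negligible)
    fix b assume "b \<in> {b. \<bar>b\<bar> < \<delta> \<Gamma> \<and> e' \<Gamma> b = 0}"
    then show "(e \<Gamma> has_real_derivative 0) (at b)" using de[OF that, of b] by simp
  qed
  then have neg: "negligible (\<Union>(Cr ` S))" using fin by (intro negligible_Union) auto
  define V where "V = {v::real^1. 0 < \<xi> * v $ 1 \<and> \<xi> * v $ 1 < \<epsilon>0}"
  have "open V"
  proof -
    have "V = {v. 0 < \<xi> * v $ 1} \<inter> {v. \<xi> * v $ 1 < \<epsilon>0}" by (auto simp: V_def)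
    then show ?thesis by (simp only:) (intro open_Int open_Collect_less continuous_intros)
  qed
  moreover have "(\<xi> * (\<epsilon>0 / 2)) *\<^sub>R (1::real^1) \<in> V" using \<epsilon>0(1) \<xi> by (auto simp: V_def)
  ultimately have "\<not> negligible V" using open_not_negligible by blast
  then have "\<not> V \<subseteq> \<Union>(Cr ` S)" using negligible_subset[OF neg] by blast
  then obtain v where v: "v \<in> V" "v \<notin> \<Union>(Cr ` S)" by blast
  define \<epsilon> where "\<epsilon> = v $ 1"
  have v1: "v = \<epsilon> *\<^sub>R 1" by (simp add: \<epsilon>_def vec_eq_iff forall_1)
  have \<epsilon>: "0 < \<xi> * \<epsilon>" "\<xi> * \<epsilon> < \<epsilon>0" using v(1) by (auto simp: V_def \<epsilon>_def)
  have root: "\<exists>b. \<bar>b\<bar> < \<delta> (fst s) \<and> snd s * b > 0 \<and> e (fst s) b = \<epsilon>" if s: "s \<in> Q" for s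
  proof -
    have "s \<in> W" using s by (simp add: Q_def)
    then obtain \<Gamma> \<sigma> where s': "s = (\<Gamma>, \<sigma>)" "\<Gamma> \<in> S" "\<sigma> = 1 \<or> \<sigma> = -1" by (auto simp: W_def)
    have ce: "continuous_on {- (\<delta> \<Gamma> / 2)..\<delta> \<Gamma> / 2} (e \<Gamma>)"
    proof (rule continuous_at_imp_continuous_on, rule ballI)
      fix b assume b: "b \<in> {- (\<delta> \<Gamma> / 2)..\<delta> \<Gamma> / 2}"
      have "\<bar>b\<bar> < \<delta> \<Gamma>" using b dpos[OF s'(2)] by auto
      then show "isCont (e \<Gamma>) b" by (rule DERIV_isCont[OF de[OF s'(2)]])
    qed
    have "(\<lambda>b. \<sigma> * b) ` {0..\<delta> \<Gamma> / 2} \<subseteq> {- (\<delta> \<Gamma> / 2)..\<delta> \<Gamma> / 2}" using s'(3) by auto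
    from continuous_on_compose2[OF ce _ this]
    have "continuous_on {0..\<delta> \<Gamma> / 2} (\<lambda>b. e \<Gamma> (\<sigma> * b))" by (simp add: continuous_intros)
    then have c: "continuous_on {0..\<delta> \<Gamma> / 2} (\<lambda>b. \<xi> * e \<Gamma> (\<sigma> * b))" by (rule continuous_on_mult_left)
    have "\<exists>b\<ge>0. b \<le> \<delta> \<Gamma> / 2 \<and> \<xi> * e \<Gamma> (\<sigma> * b) = \<xi> * \<epsilon>"
    proof (rule IVT'[OF _ _ _ c])
      show "\<xi> * e \<Gamma> (\<sigma> * 0) \<le> \<xi> * \<epsilon>" using e0[OF s'(2)] \<epsilon> by simp
      show "\<xi> * \<epsilon> \<le> \<xi> * e \<Gamma> (\<sigma> * (\<delta> \<Gamma> / 2))" using \<epsilon> \<epsilon>0(2)[OF s] by (simp add: s'(1) w_def)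
      show "0 \<le> \<delta> \<Gamma> / 2" using dpos[OF s'(2)] by simp
    qed
    then obtain b where b: "0 \<le> b" "b \<le> \<delta> \<Gamma> / 2" "e \<Gamma> (\<sigma> * b) = \<epsilon>" using \<xi> by auto
    have "b \<noteq> 0" using b(3) e0[OF s'(2)] \<epsilon>(1) by auto
    moreover note dpos[OF s'(2)]
    ultimately have "b > 0" "\<bar>\<sigma> * b\<bar> < \<delta> \<Gamma>" "\<sigma> * (\<sigma> * b) > 0" using b s'(3) by auto
    then show ?thesis using b(3) by (intro exI[of _ "\<sigma> * b"]) (simp add: s'(1))
  qed
  then obtain \<beta> where \<beta>: "\<And>s. s \<in> Q \<Longrightarrow> \<bar>\<beta> s\<bar> < \<delta> (fst s) \<and> snd s * \<beta> s > 0 \<and> e (fst s) (\<beta> s) = \<epsilon>" by metis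
  define \<Theta> where "\<Theta> = (\<lambda>s. Sf (fst s) (\<beta> s))"
  have QS: "fst s \<in> S" "snd s = 1 \<or> snd s = -1" if "s \<in> Q" for s
  proof -
    have "s \<in> W" using that by (simp add: Q_def)
    then show "fst s \<in> S" "snd s = 1 \<or> snd s = -1" by (auto simp: W_def)
  qed
  have hyp: "hyp_orbit (rotated F \<epsilon>) (\<Theta> s)" if s: "s \<in> Q" for s
  proof -
    have "e' (fst s) (\<beta> s) \<noteq> 0"
    proof
      assume "e' (fst s) (\<beta> s) = 0"
      then have "v \<in> Cr (fst s)" unfolding Cr_def v1 using \<beta>[OF s] by (intro image_eqI[of _ _ "\<beta> s"]) auto
      then show False using v(2) QS(1)[OF s] by blast
    qed
    then have "hyp_orbit (rotated F (e (fst s) (\<beta> s))) (Sf (fst s) (\<beta> s))" using hypb[OF QS(1)[OF s]] \<beta>[OF s] by blast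
    then show ?thesis using \<beta>[OF s] by (simp add: \<Theta>_def)
  qed
  \<comment> \<open>The cell tells the cycle, the orbit together with the common value of e tells
    the parameter, and the sign of the parameter tells the side.\<close>
  have "inj_on \<Theta> Q"
  proof (rule inj_onI)
    fix s s' assume s: "s \<in> Q" "s' \<in> Q" and eq: "\<Theta> s = \<Theta> s'"
    have "\<Theta> s \<subseteq> cell S (fst s)" "\<Theta> s \<noteq> {}" unfolding \<Theta>_def using cellb[OF QS(1)[OF s(1)]] \<beta>[OF s(1)] by blast+
    moreover have "\<Theta> s' \<subseteq> cell S (fst s')" unfolding \<Theta>_def using cellb[OF QS(1)[OF s(2)]] \<beta>[OF s(2)] by blast
    ultimately have f: "fst s = fst s'" using cell_disjoint[OF QS(1)[OF s(1)] QS(1)[OF s(2)]] eq by blast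
    have "\<beta> s = \<beta> s'"
      by (rule unq[OF QS(1)[OF s(1)]]) (use \<beta>[OF s(1)] \<beta>[OF s(2)] eq in \<open>simp_all add: \<Theta>_def f\<close>)
    then have "snd s = snd s'" using \<beta>[OF s(1)] \<beta>[OF s(2)] QS(2)[OF s(1)] QS(2)[OF s(2)] by auto
    then show "s = s'" using f by (simp add: prod_eq_iff)
  qed
  then have "card (\<Theta> ` Q) = card Q" by (rule card_image)
  then have "card S \<le> card (\<Theta> ` Q)" using cQ by (simp add: Q_def)
  then obtain S' where S': "S' \<subseteq> \<Theta> ` Q" "card S' = card S" using obtain_subset_with_card_n by metis
  show thesis
  proof (rule that[of S' \<epsilon>])
    show "finite S'" using S'(1) finQ finite_subset by blast
    show "card S' = card S" by fact
    show "\<And>\<Gamma>. \<Gamma> \<in> S' \<Longrightarrow> hyp_orbit (rotated F \<epsilon>) \<Gamma>" using S'(1) hyp by blast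
  qed
qed

lemma hyp_orbit_periodic: "hyp_orbit F \<Gamma> \<Longrightarrow> periodic_orbit F \<Gamma>"
  using hyp_orbit_limit_cycle by (auto simp: limit_cycle_def)

text \<open>Each orbit is continued inside its own cell, so the number of orbits is kept. The radius
  \<open>R\<close> does not depend on b; it separates these orbits from one created far
  away.\<close>

lemma hyp_persist_set:
  fixes F :: "plane \<times> real \<Rightarrow> plane"
  assumes F: "smooth F" and fin: "finite S" and S: "\<And>\<Gamma>. \<Gamma> \<in> S \<Longrightarrow> hyp_orbit (\<lambda>x. F (x, 0)) \<Gamma>"
  obtains \<delta> R where "\<delta> > 0" "\<And>b. \<bar>b\<bar> < \<delta> \<Longrightarrow> \<exists>S'. finite S' \<and> card S' = card S \<and>
    (\<forall>\<Gamma>\<in>S'. hyp_orbit (\<lambda>x. F (x, b)) \<Gamma> \<and> (\<forall>q\<in>\<Gamma>. norm q \<le> R))"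
proof -
  have F0: "smooth (\<lambda>x. F (x, 0))" by (rule smooth_compose[OF _ F]) (intro smooth_intros)
  have po: "periodic_orbit (\<lambda>x. F (x, 0)) \<Gamma>" if "\<Gamma> \<in> S" for \<Gamma> using hyp_orbit_periodic[OF S[OF that]] .
  have cpt: "compact \<Gamma>" "\<Gamma> \<noteq> {}" if "\<Gamma> \<in> S" for \<Gamma> using periodic_orbit_gsol[OF F0 po[OF that]] by metis+
  have "compact (\<Union>S)" using fin cpt by (intro compact_Union) auto
  then obtain R0 where R0: "\<And>q. q \<in> \<Union>S \<Longrightarrow> norm q \<le> R0" using compact_imp_bounded bounded_iff by metis
  have "\<exists>d>0. \<forall>b. \<bar>b\<bar> < d \<longrightarrow> (\<exists>\<Gamma>'. hyp_orbit (\<lambda>x. F (x, b)) \<Gamma>' \<and> \<Gamma>' \<subseteq> cell S \<Gamma> \<and> (\<forall>q\<in>\<Gamma>'. norm q \<le> R0 + 1))"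
    if \<Gamma>: "\<Gamma> \<in> S" for \<Gamma>
  proof -
    obtain \<omega> where \<omega>: "\<omega> > 0" "(\<Union>x\<in>\<Gamma>. ball x \<omega>) \<subseteq> cell S \<Gamma>"
      using compact_subset_open_imp_ball_epsilon_subset[OF cpt(1)[OF \<Gamma>] open_cell[OF fin] subset_cell[OF F0 po \<Gamma>]] by metis
    have "min \<omega> 1 > 0" using \<omega> by simp
    from hyp_persist[OF F S[OF \<Gamma>] this] obtain d where d: "d > 0"
      "\<And>b. \<bar>b\<bar> < d \<Longrightarrow> \<exists>\<Gamma>'. hyp_orbit (\<lambda>x. F (x, b)) \<Gamma>' \<and> (\<forall>q\<in>\<Gamma>'. infdist q \<Gamma> < min \<omega> 1)" by blast
    have near: "q \<in> cell S \<Gamma> \<and> norm q \<le> R0 + 1" if "infdist q \<Gamma> < min \<omega> 1" for q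
    proof -
      obtain x where x: "x \<in> \<Gamma>" "infdist q \<Gamma> = dist q x"
        using infdist_attains_inf[OF compact_imp_closed[OF cpt(1)[OF \<Gamma>]] cpt(2)[OF \<Gamma>]] by metis
      have "q \<in> ball x \<omega>" using x that by (simp add: dist_commute)
      moreover have "norm x \<le> R0" using R0 x(1) \<Gamma> by blast
      moreover have "norm (q - x) < 1" using x that by (simp add: dist_norm)
      ultimately show ?thesis using \<omega>(2) x(1) norm_triangle_ineq2[of q x] by (auto simp del: mem_ball)
    qed
    show ?thesis using d near by (metis subsetI)
  qed
  then obtain d where d: "\<And>\<Gamma>. \<Gamma> \<in> S \<Longrightarrow> d \<Gamma> > 0"
    "\<And>\<Gamma> b. \<Gamma> \<in> S \<Longrightarrow> \<bar>b\<bar> < d \<Gamma> \<Longrightarrow> \<exists>\<Gamma>'. hyp_orbit (\<lambda>x. F (x, b)) \<Gamma>' \<and> \<Gamma>' \<subseteq> cell S \<Gamma> \<and> (\<forall>q\<in>\<Gamma>'. norm q \<le> R0 + 1)"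
    by metis
  \<comment> \<open>The inserted 1 makes the minimum meaningful also for empty
    \<open>S\<close>.\<close>
  define \<delta> where "\<delta> = Min (insert 1 (d ` S))"
  have \<delta>: "\<delta> > 0" "\<And>\<Gamma>. \<Gamma> \<in> S \<Longrightarrow> \<delta> \<le> d \<Gamma>" using fin d(1) by (auto simp: \<delta>_def)
  show thesis
  proof (rule that[OF \<delta>(1), of "R0 + 1"])
    fix b assume b: "\<bar>b\<bar> < \<delta>"
    have "\<exists>\<Gamma>'. hyp_orbit (\<lambda>x. F (x, b)) \<Gamma>' \<and> \<Gamma>' \<subseteq> cell S \<Gamma> \<and> (\<forall>q\<in>\<Gamma>'. norm q \<le> R0 + 1)" if "\<Gamma> \<in> S" for \<Gamma>
      by (rule d(2)[OF that]) (use b \<delta>(2)[OF that] in linarith)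
    then obtain G where G: "\<And>\<Gamma>. \<Gamma> \<in> S \<Longrightarrow> hyp_orbit (\<lambda>x. F (x, b)) (G \<Gamma>) \<and> G \<Gamma> \<subseteq> cell S \<Gamma> \<and> (\<forall>q\<in>G \<Gamma>. norm q \<le> R0 + 1)"
      by metis
    have Fb: "smooth (\<lambda>x. F (x, b))" by (rule smooth_compose[OF _ F]) (intro smooth_intros)
    have "inj_on G S"
    proof (rule inj_onI)
      fix \<Gamma> \<Gamma>' assume g: "\<Gamma> \<in> S" "\<Gamma>' \<in> S" "G \<Gamma> = G \<Gamma>'"
      have "G \<Gamma> \<noteq> {}" using periodic_orbit_gsol[OF Fb hyp_orbit_periodic] G[OF g(1)] by metis
      then show "\<Gamma> = \<Gamma>'" using cell_disjoint[OF g(1,2)] G[OF g(1)] G[OF g(2)] g(3) by blast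
    qed
    then have "card (G ` S) = card S" by (rule card_image)
    then show "\<exists>S'. finite S' \<and> card S' = card S \<and> (\<forall>\<Gamma>\<in>S'. hyp_orbit (\<lambda>x. F (x, b)) \<Gamma> \<and> (\<forall>q\<in>\<Gamma>. norm q \<le> R0 + 1))"
      using fin G by (intro exI[of _ "G ` S"]) auto
  qed
qed

section \<open>Affine changes of coordinates with rescaled time\<close>

definition aff :: "plane \<Rightarrow> real \<Rightarrow> real \<Rightarrow> plane \<Rightarrow> plane" where
  "aff c \<alpha> \<beta> z = (fst c + \<alpha> * fst z, snd c + \<beta> * snd z)"

lemma periodic_orbit_aff:
  assumes nz: "\<alpha> \<noteq> 0" "\<beta> \<noteq> 0" "\<omega> \<noteq> 0"
    and rel: "\<And>z. F (aff c \<alpha> \<beta> z) = \<omega> *\<^sub>R (\<alpha> * fst (G z), \<beta> * snd (G z))"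
    and po: "periodic_orbit G \<Gamma>"
  shows "periodic_orbit F (aff c \<alpha> \<beta> ` \<Gamma>)"
proof -
  obtain \<gamma> T where T: "T > 0" and g: "\<And>t. (\<gamma> has_vector_derivative G (\<gamma> t)) (at t)"
    and p: "\<And>t. \<gamma> (t + T) = \<gamma> t" and nc: "\<exists>t. \<gamma> t \<noteq> \<gamma> 0" and \<Gamma>: "\<Gamma> = range \<gamma>"
    using po unfolding periodic_orbit_def by blast
  define \<eta> where "\<eta> = (\<lambda>t. \<gamma> (0 + \<omega> * t))"
  have "gsol 1 G \<gamma>" using g by (simp add: gsol_def)
  from gsol_affine[OF this, of \<omega> 0] have d: "(\<eta> has_vector_derivative \<omega> *\<^sub>R G (\<eta> t)) (at t)" for t
    by (simp add: gsol_def \<eta>_def)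
  define \<zeta> where "\<zeta> = (\<lambda>t. aff c \<alpha> \<beta> (\<eta> t))"
  have dz: "(\<zeta> has_vector_derivative F (\<zeta> t)) (at t)" for t
  proof -
    have "((\<lambda>t. fst c + \<alpha> * fst (\<eta> t)) has_vector_derivative \<alpha> * fst (\<omega> *\<^sub>R G (\<eta> t))) (at t)"
      using vderiv_fst[OF d[of t]] unfolding has_real_derivative_iff_has_vector_derivative[symmetric]
      by (auto intro!: derivative_eq_intros)
    moreover have "((\<lambda>t. snd c + \<beta> * snd (\<eta> t)) has_vector_derivative \<beta> * snd (\<omega> *\<^sub>R G (\<eta> t))) (at t)"
      using vderiv_snd[OF d[of t]] unfolding has_real_derivative_iff_has_vector_derivative[symmetric]
      by (auto intro!: derivative_eq_intros)
    ultimately have "(\<zeta> has_vector_derivative (\<alpha> * fst (\<omega> *\<^sub>R G (\<eta> t)), \<beta> * snd (\<omega> *\<^sub>R G (\<eta> t)))) (at t)"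
      unfolding \<zeta>_def aff_def by (rule has_vector_derivative_Pair)
    moreover have "F (\<zeta> t) = (\<alpha> * fst (\<omega> *\<^sub>R G (\<eta> t)), \<beta> * snd (\<omega> *\<^sub>R G (\<eta> t)))" by (simp add: \<zeta>_def rel)
    ultimately show ?thesis by simp
  qed
  have inj: "aff c \<alpha> \<beta> z = aff c \<alpha> \<beta> z' \<longleftrightarrow> z = z'" for z z' using nz by (auto simp: aff_def prod_eq_iff)
  have bk: "\<gamma> t = \<eta> (t / \<omega>)" for t using nz by (simp add: \<eta>_def)
  have "\<exists>t. \<zeta> t \<noteq> \<zeta> 0"
  proof -
    obtain t where "\<gamma> t \<noteq> \<gamma> 0" using nc by blast
    then have "\<eta> (t / \<omega>) \<noteq> \<eta> 0" using bk[of t] by (simp add: \<eta>_def)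
    then show ?thesis using inj by (auto simp: \<zeta>_def)
  qed
  moreover have "\<zeta> (t + T / \<bar>\<omega>\<bar>) = \<zeta> t" for t
  proof (cases "\<omega> > 0")
    case True then show ?thesis using p[of "\<omega> * t"] by (simp add: \<zeta>_def \<eta>_def distrib_left)
  next
    case False then show ?thesis using p[of "\<omega> * t - T"] nz by (simp add: \<zeta>_def \<eta>_def right_diff_distrib)
  qed
  moreover have "T / \<bar>\<omega>\<bar> > 0" using T nz by simp
  moreover have "aff c \<alpha> \<beta> ` \<Gamma> = range \<zeta>"
  proof
    show "aff c \<alpha> \<beta> ` \<Gamma> \<subseteq> range \<zeta>" unfolding \<Gamma> \<zeta>_def using bk by auto
    show "range \<zeta> \<subseteq> aff c \<alpha> \<beta> ` \<Gamma>" unfolding \<Gamma> \<zeta>_def \<eta>_def by auto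
  qed
  ultimately show ?thesis unfolding periodic_orbit_def using dz by metis
qed

text \<open>Isolation is transported by pulling a competing orbit back with the inverse map, which
  is again of the same form. The time factor may be negative, as happens in the blow-up when the
  leading coefficient is negative.\<close>

lemma limit_cycle_aff:
  assumes nz: "\<alpha> \<noteq> 0" "\<beta> \<noteq> 0" "\<omega> \<noteq> 0"
    and rel: "\<And>z. F (aff c \<alpha> \<beta> z) = \<omega> *\<^sub>R (\<alpha> * fst (G z), \<beta> * snd (G z))"
    and lc: "limit_cycle G \<Gamma>"
  shows "limit_cycle F (aff c \<alpha> \<beta> ` \<Gamma>)"
proof -
  obtain U where U: "open U" "\<Gamma> \<subseteq> U" "\<And>\<Gamma>'. periodic_orbit G \<Gamma>' \<Longrightarrow> \<Gamma>' \<subseteq> U \<Longrightarrow> \<Gamma>' = \<Gamma>" and po: "periodic_orbit G \<Gamma>"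
    using lc unfolding limit_cycle_def by blast
  define c' where "c' = (- fst c / \<alpha>, - snd c / \<beta>)"
  define B where "B = aff c' (1 / \<alpha>) (1 / \<beta>)"
  have AB: "aff c \<alpha> \<beta> (B z) = z" "B (aff c \<alpha> \<beta> z) = z" for z
    using nz by (auto simp: aff_def B_def c'_def prod_eq_iff divide_simps)
  have relB: "G (B z) = (1 / \<omega>) *\<^sub>R (1 / \<alpha> * fst (F z), 1 / \<beta> * snd (F z))" for z
    using rel[of "B z"] nz unfolding AB by (simp add: prod_eq_iff)
  have "open (B -` U)"
  proof (rule open_vimage[OF U(1)])
    show "continuous_on UNIV B" unfolding B_def aff_def by (intro continuous_intros)
  qed
  moreover have "aff c \<alpha> \<beta> ` \<Gamma> \<subseteq> B -` U" using U(2) AB by auto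
  moreover have "\<Gamma>' = aff c \<alpha> \<beta> ` \<Gamma>" if "periodic_orbit F \<Gamma>'" "\<Gamma>' \<subseteq> B -` U" for \<Gamma>'
  proof -
    have "periodic_orbit G (B ` \<Gamma>')" unfolding B_def
      by (rule periodic_orbit_aff[OF _ _ _ _ that(1), where \<omega>="1 / \<omega>"]) (use nz relB in \<open>auto simp: B_def\<close>)
    then have "B ` \<Gamma>' = \<Gamma>" using U(3) that(2) by blast
    then have "aff c \<alpha> \<beta> ` \<Gamma> = aff c \<alpha> \<beta> ` B ` \<Gamma>'" by simp
    also have "\<dots> = \<Gamma>'" by (simp add: image_image AB)
    finally show ?thesis by simp
  qed
  moreover have "periodic_orbit F (aff c \<alpha> \<beta> ` \<Gamma>)" by (rule periodic_orbit_aff[OF nz rel po])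
  ultimately show ?thesis unfolding limit_cycle_def by blast
qed

section \<open>Polynomial fields\<close>


lemma poly2_add: "poly2_deg_le n P \<Longrightarrow> poly2_deg_le n Q \<Longrightarrow> poly2_deg_le n (\<lambda>x y. P x y + Q x y)"
proof -
  assume "poly2_deg_le n P" "poly2_deg_le n Q"
  then obtain c d where "\<And>x y. P x y = (\<Sum>i\<le>n. \<Sum>j\<le>n - i. c i j * x ^ i * y ^ j)" "\<And>x y. Q x y = (\<Sum>i\<le>n. \<Sum>j\<le>n - i. d i j * x ^ i * y ^ j)"
    unfolding poly2_deg_le_def by blast
  then show ?thesis unfolding poly2_deg_le_def
    by (intro exI[of _ "\<lambda>i j. c i j + d i j"]) (simp add: sum.distrib distrib_right)
qed

lemma poly2_cmult: "poly2_deg_le n P \<Longrightarrow> poly2_deg_le n (\<lambda>x y. k * P x y)"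
proof -
  assume "poly2_deg_le n P"
  then obtain c where "\<And>x y. P x y = (\<Sum>i\<le>n. \<Sum>j\<le>n - i. c i j * x ^ i * y ^ j)" unfolding poly2_deg_le_def by blast
  then show ?thesis unfolding poly2_deg_le_def
    by (intro exI[of _ "\<lambda>i j. k * c i j"]) (simp add: sum_distrib_left mult.assoc)
qed

lemma poly2_sum: "finite A \<Longrightarrow> (\<And>i. i \<in> A \<Longrightarrow> poly2_deg_le n (P i)) \<Longrightarrow> poly2_deg_le n (\<lambda>x y. \<Sum>i\<in>A. P i x y)"
proof (induction A rule: finite_induct)
  case empty
  show ?case unfolding poly2_deg_le_def by (intro exI[of _ "\<lambda>_ _. 0"]) simp
next
  case (insert a A)
  then show ?case using poly2_add[of n "P a" "\<lambda>x y. \<Sum>i\<in>A. P i x y"] by simp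
qed

lemma monom_sum:
  fixes x y c :: real
  assumes "a + b \<le> n"
  shows "c * x ^ a * y ^ b = (\<Sum>i\<le>n. \<Sum>j\<le>n - i. (if i = a then if j = b then c else 0 else 0) * x ^ i * y ^ j)"
proof -
  have "(\<Sum>j\<le>n - i. (if i = a then if j = b then c else 0 else 0) * x ^ i * y ^ j) = (if i = a then c * x ^ a * y ^ b else 0)" for i
  proof (cases "i = a")
    case True
    have "(\<Sum>j\<le>n - a. (if j = b then c else 0) * x ^ a * y ^ j) = (\<Sum>j\<le>n - a. if j = b then c * x ^ a * y ^ b else 0)"
      by (rule sum.cong) auto
    also have "\<dots> = c * x ^ a * y ^ b" using assms by (subst sum.delta) auto
    finally show ?thesis using True by simp
  qed simp
  then show ?thesis using assms by (simp only: sum.delta finite_atMost atMost_iff) simp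
qed

lemma poly2_monom:
  assumes "a + b \<le> n" shows "poly2_deg_le n (\<lambda>x y. c * x ^ a * y ^ b)"
  unfolding poly2_deg_le_def
  by (intro exI[of _ "\<lambda>i j. if i = a then if j = b then c else 0 else 0"] allI monom_sum[OF assms])

lemma poly2_mono: assumes "poly2_deg_le n P" "n \<le> m" shows "poly2_deg_le m P"
proof -
  obtain c where P: "P = (\<lambda>x y. \<Sum>i\<le>n. \<Sum>j\<le>n - i. c i j * x ^ i * y ^ j)" using assms(1) unfolding poly2_deg_le_def by (metis (mono_tags) ext)
  show ?thesis unfolding P using assms(2) by (intro poly2_sum poly2_monom) auto
qed

lemma poly2_times_x: assumes "poly2_deg_le n P" shows "poly2_deg_le (Suc n) (\<lambda>x y. x * P x y)"
proof -
  obtain c where P: "P = (\<lambda>x y. \<Sum>i\<le>n. \<Sum>j\<le>n - i. c i j * x ^ i * y ^ j)" using assms(1) unfolding poly2_deg_le_def by (metis (mono_tags) ext)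
  have "(\<lambda>x y. x * P x y) = (\<lambda>x y. \<Sum>i\<le>n. \<Sum>j\<le>n - i. c i j * x ^ Suc i * y ^ j)"
    unfolding P by (simp add: sum_distrib_left mult_ac)
  then show ?thesis by (simp only:) (intro poly2_sum poly2_monom; simp)
qed

lemma poly2_smooth: assumes "poly2_deg_le n P" "smooth f" "smooth g" shows "smooth (\<lambda>z. P (f z) (g z))"
proof -
  obtain c where "\<And>x y. P x y = (\<Sum>i\<le>n. \<Sum>j\<le>n - i. c i j * x ^ i * y ^ j)" using assms(1) unfolding poly2_deg_le_def by blast
  then show ?thesis by (simp only:) (intro smooth_intros assms)
qed

lemma vfield_eq: "vfield P Q = (\<lambda>z. (P (fst z) (snd z), Q (fst z) (snd z)))"
  by (auto simp: vfield_def)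

lemma vfield_smooth:
  assumes "poly2_deg_le n P" "poly2_deg_le n Q" shows "smooth (vfield P Q)"
  unfolding vfield_eq
  by (rule smooth_Pair[OF poly2_smooth[OF assms(1)] poly2_smooth[OF assms(2)]]; intro smooth_intros)

lemma rotated_vfield: "rotated (vfield P Q) a = vfield (\<lambda>x y. P x y + - a * Q x y) (\<lambda>x y. Q x y + a * P x y)"
  by (auto simp: rotated_def rot_def vfield_eq)

text \<open>Linear fields have no limit cycles: scaling about the mean of a periodic solution gives another one.\<close>

lemma linear_no_limit_cycle:
  assumes "poly2_deg_le 1 P" "poly2_deg_le 1 Q" shows "\<not> limit_cycle (vfield P Q) \<Gamma>"
proof
  assume lc: "limit_cycle (vfield P Q) \<Gamma>"
  have lin: "\<exists>a b c. \<forall>x y. R x y = a + b * x + c * y" if R: "poly2_deg_le 1 R" for R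
  proof -
    obtain c where "\<And>x y. R x y = (\<Sum>i\<le>1. \<Sum>j\<le>1 - i. c i j * x ^ i * y ^ j)" using R unfolding poly2_deg_le_def by blast
    then have "R x y = c 0 0 + c 1 0 * x + c 0 1 * y" for x y by (simp add: atMost_Suc)
    then show ?thesis by blast
  qed
  obtain a1 b1 c1 where P: "\<And>x y. P x y = a1 + b1 * x + c1 * y" using lin[OF assms(1)] by blast
  obtain a2 b2 c2 where Q: "\<And>x y. Q x y = a2 + b2 * x + c2 * y" using lin[OF assms(2)] by blast
  let ?F = "vfield P Q"
  have F: "?F z = (a1 + b1 * fst z + c1 * snd z, a2 + b2 * fst z + c2 * snd z)" for z by (simp add: vfield_eq P Q)
  obtain U where U: "open U" "\<Gamma> \<subseteq> U" "\<And>\<Gamma>'. periodic_orbit ?F \<Gamma>' \<Longrightarrow> \<Gamma>' \<subseteq> U \<Longrightarrow> \<Gamma>' = \<Gamma>" and po: "periodic_orbit ?F \<Gamma>"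
    using lc unfolding limit_cycle_def by blast
  obtain \<gamma> T where T: "T > 0" and g: "\<And>t. (\<gamma> has_vector_derivative ?F (\<gamma> t)) (at t)"
    and p: "\<And>t. \<gamma> (t + T) = \<gamma> t" and nc: "\<exists>t. \<gamma> t \<noteq> \<gamma> 0" and \<Gamma>: "\<Gamma> = range \<gamma>"
    using po unfolding periodic_orbit_def by blast
  have gs: "gsol 1 ?F \<gamma>" using g by (simp add: gsol_def)
  have cg: "continuous_on S \<gamma>" for S by (rule gsol_cont[OF gs])
  define mx where "mx = integral {0..T} (\<lambda>t. fst (\<gamma> t)) / T"
  define my where "my = integral {0..T} (\<lambda>t. snd (\<gamma> t)) / T"
  define m where "m = (mx, my)"
  have ix: "((\<lambda>t. fst (\<gamma> t)) has_integral mx * T) {0..T}" and iy: "((\<lambda>t. snd (\<gamma> t)) has_integral my * T) {0..T}"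
    unfolding mx_def my_def using T by (simp_all add: has_integral_integral[symmetric] integrable_continuous_real continuous_intros cg)
  have ia: "((\<lambda>t::real. k) has_integral k * T) {0..T}" for k using has_integral_const_real[of k 0 T] T by (simp add: mult.commute)
  \<comment> \<open>Over a period a coordinate returns to its value, so the mean of its derivative
    is 0. The field being affine, this says that it vanishes at the mean point m, which makes
    scaling about m possible.\<close>
  have mean: "a + b * mx + c * my = 0"
    if d: "\<And>t. (h has_real_derivative (a + b * fst (\<gamma> t) + c * snd (\<gamma> t))) (at t)" and hp: "h T = h 0" for h a b c
  proof -
    have "((\<lambda>t. a + b * fst (\<gamma> t) + c * snd (\<gamma> t)) has_integral h T - h 0) {0..T}"
      using T d by (intro fundamental_theorem_of_calculus) (auto simp flip: has_real_derivative_iff_has_vector_derivative intro: has_field_derivative_at_within)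
    moreover have "((\<lambda>t. a + b * fst (\<gamma> t) + c * snd (\<gamma> t)) has_integral a * T + b * (mx * T) + c * (my * T)) {0..T}"
      by (intro has_integral_add ia has_integral_mult_right ix iy)
    ultimately have "a * T + b * (mx * T) + c * (my * T) = 0" using hp by (auto dest: has_integral_unique)
    then have "(a + b * mx + c * my) * T = 0" by (simp add: algebra_simps)
    then show ?thesis using T by simp
  qed
  have pT: "\<gamma> T = \<gamma> 0" using p[of 0] by simp
  have Fm: "a1 + b1 * mx + c1 * my = 0" "a2 + b2 * mx + c2 * my = 0"
  proof -
    show "a1 + b1 * mx + c1 * my = 0"
      by (rule mean[of "\<lambda>t. fst (\<gamma> t)"])
        (use vderiv_fst[OF g] pT in \<open>auto simp: F has_real_derivative_iff_has_vector_derivative\<close>)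
    show "a2 + b2 * mx + c2 * my = 0"
      by (rule mean[of "\<lambda>t. snd (\<gamma> t)"])
        (use vderiv_snd[OF g] pT in \<open>auto simp: F has_real_derivative_iff_has_vector_derivative\<close>)
  qed
  define \<eta> where "\<eta> = (\<lambda>s t. m + s *\<^sub>R (\<gamma> t - m))"
  have \<eta>po: "periodic_orbit ?F (range (\<eta> s))" if s: "s \<noteq> 0" for s
    unfolding periodic_orbit_def
  proof (rule exI[of _ "\<eta> s"], rule exI[of _ T], intro conjI allI)
    show "T > 0" by fact
    show "\<eta> s (t + T) = \<eta> s t" for t by (simp add: \<eta>_def p)
    obtain t where "\<gamma> t \<noteq> \<gamma> 0" using nc by blast
    then show "\<exists>t. \<eta> s t \<noteq> \<eta> s 0" using s by (intro exI[of _ t]) (simp add: \<eta>_def)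
    fix t
    have "(\<eta> s has_vector_derivative 0 + s *\<^sub>R (?F (\<gamma> t) - 0)) (at t)" unfolding \<eta>_def
      by (intro has_vector_derivative_add has_vector_derivative_const bounded_linear.has_vector_derivative[OF bounded_linear_scaleR_right] has_vector_derivative_diff g)
    moreover have "?F (\<eta> s t) = s *\<^sub>R ?F (\<gamma> t) + (1 - s) *\<^sub>R (a1 + b1 * mx + c1 * my, a2 + b2 * mx + c2 * my)"
      unfolding F \<eta>_def m_def by (simp add: algebra_simps)
    then have "?F (\<eta> s t) = s *\<^sub>R ?F (\<gamma> t)" unfolding Fm by (simp add: zero_prod_def[symmetric])
    ultimately show "(\<eta> s has_vector_derivative ?F (\<eta> s t)) (at t)" by simp
  qed simp
  have rg: "range \<gamma> = \<gamma> ` {0..T}" by (rule periodic_range[of \<gamma>, OF p T])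
  have cG: "compact \<Gamma>" unfolding \<Gamma> rg by (intro compact_continuous_image cg) auto
  obtain \<omega> where \<omega>: "\<omega> > 0" "(\<Union>x\<in>\<Gamma>. ball x \<omega>) \<subseteq> U" using compact_subset_open_imp_ball_epsilon_subset[OF cG U(1,2)] by metis
  have "continuous_on {0..T} (\<lambda>t. norm (\<gamma> t - m))" by (intro continuous_intros cg)
  then obtain t0 where t0: "t0 \<in> {0..T}" "\<And>t. t \<in> {0..T} \<Longrightarrow> norm (\<gamma> t - m) \<le> norm (\<gamma> t0 - m)"
    using continuous_attains_sup[of "{0..T}" "\<lambda>t. norm (\<gamma> t - m)"] T by force
  define R where "R = norm (\<gamma> t0 - m)"
  have R: "norm (\<gamma> t - m) \<le> R" for t
  proof -
    have "\<gamma> t \<in> \<gamma> ` {0..T}" using rg by blast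
    then show ?thesis using t0(2) by (auto simp: R_def)
  qed
  have R0: "R > 0"
  proof (rule ccontr)
    assume "\<not> R > 0"
    then have "norm (\<gamma> t - m) = 0" for t using R[of t] norm_ge_zero[of "\<gamma> t - m"] by linarith
    then show False using nc by simp
  qed
  \<comment> \<open>The scaling moves points by less than \<omega>, so the scaled orbit is still in
    U and would have to be \<Gamma>; but the farthest point from m, at distance R, has moved out to
    s R.\<close>
  define s where "s = 1 + \<omega> / (2 * R)"
  have s: "s > 1" using \<omega>(1) R0 by (simp add: s_def)
  have "range (\<eta> s) \<subseteq> U"
  proof (rule image_subsetI)
    fix t
    have "norm (\<eta> s t - \<gamma> t) = (\<omega> / (2 * R)) * norm (\<gamma> t - m)"
    proof -
      have "\<eta> s t - \<gamma> t = (\<omega> / (2 * R)) *\<^sub>R (\<gamma> t - m)" by (simp add: \<eta>_def s_def algebra_simps)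
      then show ?thesis using \<omega>(1) R0 by simp
    qed
    also have "\<dots> \<le> (\<omega> / (2 * R)) * R" using R \<omega>(1) R0 by (intro mult_left_mono) auto
    also have "\<dots> < \<omega>" using R0 \<omega>(1) by simp
    finally have "\<eta> s t \<in> ball (\<gamma> t) \<omega>" by (simp add: dist_norm norm_minus_commute)
    then show "\<eta> s t \<in> U" using \<omega>(2) \<Gamma> by blast
  qed
  then have "range (\<eta> s) = \<Gamma>" using U(3) \<eta>po[of s] s by simp
  then obtain t where "\<eta> s t0 = \<gamma> t" using \<Gamma> by (metis rangeE rangeI)
  then have "\<gamma> t - m = s *\<^sub>R (\<gamma> t0 - m)" by (simp add: \<eta>_def flip: \<open>\<eta> s t0 = \<gamma> t\<close>)
  then have "norm (\<gamma> t - m) = s * R" using s by (simp add: R_def)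
  then have "s * R \<le> R" using R[of t] by simp
  then show False using s R0 by simp
qed

text \<open>A quadratic field with the unit circle as limit cycle; the circle is traversed by
  \<open>x = (5 cos t + 4) / (5 + 4 cos t)\<close>, \<open>y = 3 sin t / (5 + 4 cos t)\<close>.\<close>

lemma quadratic_limit_cycle:
  "\<exists>P Q \<Gamma>. poly2_deg_le 2 P \<and> poly2_deg_le 2 Q \<and> limit_cycle (vfield P Q) \<Gamma>"
proof -
  \<comment> \<open>The field is (5 - 4 x) / 3 times the rotation (-y, x), plus (x^2 + y^2 - 1, 0),
    which vanishes on the circle. The linear factor is positive there and slows the motion near x =
    1, so the integral of x, which would be 0 for uniform rotation, becomes positive. As 5^2 - 4^2 =
    3^2, the period is 2 pi.\<close>
  define P where "P = (\<lambda>x y::real. - (5/3) * x ^ 0 * y ^ 1 + (4/3) * x ^ 1 * y ^ 1 + (1 * x ^ 2 * y ^ 0 + 1 * x ^ 0 * y ^ 2 + (-1) * x ^ 0 * y ^ 0))"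
  define Q where "Q = (\<lambda>x y::real. (5/3) * x ^ 1 * y ^ 0 + (- (4/3)) * x ^ 2 * y ^ 0)"
  have pd: "poly2_deg_le 2 P" "poly2_deg_le 2 Q" unfolding P_def Q_def by (intro poly2_add poly2_monom; simp)+
  let ?F = "vfield P Q"
  obtain D where D: "C11 ?F D" using vfield_smooth[OF pd] by (auto simp: smooth_def)
  have F: "?F z = (- (5/3) * snd z + 4/3 * fst z * snd z + (fst z ^ 2 + snd z ^ 2 - 1), 5/3 * fst z - 4/3 * fst z ^ 2)" for z
    by (simp add: vfield_eq P_def Q_def)
  have tr: "tr2 (D z) = 4/3 * snd z + 2 * fst z" for z
  proof -
    obtain x y where z: "z = (x, y)" by (cases z)
    have "D z (1, 0) = (4/3 * y + 2 * x, 5/3 - 4/3 * (2 * x))"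
    proof (rule C11_dir_deriv[OF D])
      have "((\<lambda>s. - (5/3) * y + 4/3 * (x + s) * y + ((x + s) ^ 2 + y ^ 2 - 1)) has_vector_derivative 4/3 * y + 2 * x) (at 0)"
        "((\<lambda>s. 5/3 * (x + s) - 4/3 * (x + s) ^ 2) has_vector_derivative 5/3 - 4/3 * (2 * x)) (at 0)"
        unfolding has_real_derivative_iff_has_vector_derivative[symmetric] by (auto intro!: derivative_eq_intros)
      from has_vector_derivative_Pair[OF this]
      show "((\<lambda>s. ?F (z + s *\<^sub>R (1, 0))) has_vector_derivative (4/3 * y + 2 * x, 5/3 - 4/3 * (2 * x))) (at 0)"
        by (simp add: F z)
    qed
    moreover have "D z (0, 1) = (- (5/3) + 4/3 * x + 2 * y, 0)"
    proof (rule C11_dir_deriv[OF D])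
      have "((\<lambda>s. - (5/3) * (y + s) + 4/3 * x * (y + s) + (x ^ 2 + (y + s) ^ 2 - 1)) has_vector_derivative - (5/3) + 4/3 * x + 2 * y) (at 0)"
        "((\<lambda>s::real. 5/3 * x - 4/3 * x ^ 2) has_vector_derivative 0) (at 0)"
        unfolding has_real_derivative_iff_has_vector_derivative[symmetric] by (auto intro!: derivative_eq_intros)
      from has_vector_derivative_Pair[OF this]
      show "((\<lambda>s. ?F (z + s *\<^sub>R (0, 1))) has_vector_derivative (- (5/3) + 4/3 * x + 2 * y, 0)) (at 0)"
        by (simp add: F z)
    qed
    ultimately show ?thesis by (simp add: tr2_def z)
  qed
  define \<theta> where "\<theta> = (\<lambda>t::real. 2 * pi * t)"
  define w where "w = (\<lambda>t. 5 + 4 * cos (\<theta> t))"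
  define x where "x = (\<lambda>t. (5 * cos (\<theta> t) + 4) / w t)"
  define y where "y = (\<lambda>t. 3 * sin (\<theta> t) / w t)"
  have w: "w t > 0" for t using cos_ge_minus_one[of "\<theta> t"] unfolding w_def by linarith
  have c01: "cos (\<theta> 0) = 1" "sin (\<theta> 0) = 0" "cos (\<theta> 1) = 1" "sin (\<theta> 1) = 0" by (auto simp: \<theta>_def)
  have dw: "(w has_real_derivative - 4 * sin (\<theta> t) * (2 * pi)) (at t within A)" for t A
    unfolding w_def \<theta>_def by (auto intro!: derivative_eq_intros)
  have sc: "(sin (\<theta> t))\<^sup>2 = 1 - (cos (\<theta> t))\<^sup>2" for t by (simp add: sin_squared_eq)
  have circ: "(x t)\<^sup>2 + (y t)\<^sup>2 = 1" for t
  proof -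
    have "(5 * cos (\<theta> t) + 4)\<^sup>2 + (3 * sin (\<theta> t))\<^sup>2 = (w t)\<^sup>2"
      unfolding power_mult_distrib sc w_def by (simp add: power2_eq_square algebra_simps)
    then have "((5 * cos (\<theta> t) + 4)\<^sup>2 + (3 * sin (\<theta> t))\<^sup>2) / (w t)\<^sup>2 = 1" using w[of t] by simp
    then show ?thesis by (simp only: x_def y_def power_divide add_divide_distrib[symmetric])
  qed
  have x54: "5/3 - 4/3 * x t = 3 / w t" for t
  proof -
    have xw: "x t * w t = 5 * cos (\<theta> t) + 4" using w[of t] by (simp add: x_def)
    have "(5/3 - 4/3 * x t) * w t = 5/3 * w t - 4/3 * (x t * w t)" by (simp add: algebra_simps)
    also have "\<dots> = 3" by (subst xw) (simp add: w_def field_simps)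
    finally show ?thesis using w[of t] by (simp add: eq_divide_eq)
  qed
  have dx: "(x has_real_derivative 2 * pi * (- y t * (3 / w t))) (at t within A)" for t A
  proof -
    have d: "((\<lambda>t. 5 * cos (\<theta> t) + 4) has_real_derivative - 5 * sin (\<theta> t) * (2 * pi)) (at t within A)"
      unfolding \<theta>_def by (auto intro!: derivative_eq_intros)
    have "(x has_real_derivative ((- 5 * sin (\<theta> t) * (2 * pi)) * w t - (5 * cos (\<theta> t) + 4) * (- 4 * sin (\<theta> t) * (2 * pi))) / (w t * w t)) (at t within A)"
      unfolding x_def by (rule DERIV_divide[OF d dw]) (use w[of t] in simp)
    moreover have "(- 5 * sin (\<theta> t) * (2 * pi)) * w t - (5 * cos (\<theta> t) + 4) * (- 4 * sin (\<theta> t) * (2 * pi)) = 2 * pi * (- (3 * sin (\<theta> t)) * 3)"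
      by (simp add: w_def algebra_simps)
    ultimately have "(x has_real_derivative 2 * pi * (- (3 * sin (\<theta> t)) * 3) / (w t * w t)) (at t within A)" by (simp only:)
    moreover have "2 * pi * (- (3 * sin (\<theta> t)) * 3) / (w t * w t) = 2 * pi * (- y t * (3 / w t))" by (simp add: y_def)
    ultimately show ?thesis by (simp only:)
  qed
  have dy: "(y has_real_derivative 2 * pi * (x t * (3 / w t))) (at t within A)" for t A
  proof -
    have d: "((\<lambda>t. 3 * sin (\<theta> t)) has_real_derivative 3 * cos (\<theta> t) * (2 * pi)) (at t within A)"
      unfolding \<theta>_def by (auto intro!: derivative_eq_intros)
    have "(y has_real_derivative ((3 * cos (\<theta> t) * (2 * pi)) * w t - (3 * sin (\<theta> t)) * (- 4 * sin (\<theta> t) * (2 * pi))) / (w t * w t)) (at t within A)"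
      unfolding y_def by (rule DERIV_divide[OF d dw]) (use w[of t] in simp)
    moreover have "(3 * cos (\<theta> t) * (2 * pi)) * w t - (3 * sin (\<theta> t)) * (- 4 * sin (\<theta> t) * (2 * pi)) = 2 * pi * ((5 * cos (\<theta> t) + 4) * 3)"
    proof -
      have "(3 * cos (\<theta> t) * (2 * pi)) * w t - (3 * sin (\<theta> t)) * (- 4 * sin (\<theta> t) * (2 * pi)) = 2 * pi * (3 * cos (\<theta> t) * w t + 12 * (sin (\<theta> t))\<^sup>2)"
        by (simp add: power2_eq_square algebra_simps)
      also have "3 * cos (\<theta> t) * w t + 12 * (sin (\<theta> t))\<^sup>2 = (5 * cos (\<theta> t) + 4) * 3"
        unfolding sc w_def by (simp add: power2_eq_square algebra_simps)
      finally show ?thesis .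
    qed
    ultimately have "(y has_real_derivative 2 * pi * ((5 * cos (\<theta> t) + 4) * 3) / (w t * w t)) (at t within A)" by (simp only:)
    moreover have "2 * pi * ((5 * cos (\<theta> t) + 4) * 3) / (w t * w t) = 2 * pi * (x t * (3 / w t))" by (simp add: x_def)
    ultimately show ?thesis by (simp only:)
  qed
  define X where "X = (\<lambda>t. (x t, y t))"
  have Fx: "?F (X t) = (- y t * (3 / w t), x t * (3 / w t))" for t
  proof -
    have "- (5/3) * y t + 4/3 * x t * y t + ((x t)\<^sup>2 + (y t)\<^sup>2 - 1) = - y t * (5/3 - 4/3 * x t)"
      unfolding circ by (simp add: algebra_simps)
    moreover have "5/3 * x t - 4/3 * (x t)\<^sup>2 = x t * (5/3 - 4/3 * x t)" by (simp add: power2_eq_square algebra_simps)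
    ultimately show ?thesis unfolding x54 by (simp add: F X_def)
  qed
  have "ode_sol (\<lambda>z. (2 * pi) *\<^sub>R ?F z) X" unfolding ode_sol_def
  proof
    fix t :: real
    show "(X has_vector_derivative (2 * pi) *\<^sub>R ?F (X t)) (at t within {0..1})"
      unfolding Fx scaleR_Pair real_scaleR_def unfolding X_def
      by (intro has_vector_derivative_Pair dx[unfolded has_real_derivative_iff_has_vector_derivative] dy[unfolded has_real_derivative_iff_has_vector_derivative])
  qed
  moreover have "X 0 = X 1" by (simp add: X_def x_def y_def w_def c01)
  moreover have "?F (X 0) \<noteq> 0" unfolding Fx by (simp add: x_def y_def w_def c01 zero_prod_def)
  ultimately have cs: "closed_sol ?F (2 * pi) X" by (simp add: closed_sol_def)
  have xc: "continuous_on {0..1} x" by (rule DERIV_continuous_on[OF dx])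
  define A where "A = integral {0..1} (\<lambda>t. (x t)\<^sup>2)"
  have iA: "((\<lambda>t. (x t)\<^sup>2) has_integral A) {0..1}" unfolding A_def
    by (intro integrable_integral integrable_continuous_real continuous_intros xc)
  \<comment> \<open>Integrating the equation for y over a turn expresses the integral of x through
    that of x^2, so its sign is known without evaluating it.\<close>
  have ix: "((\<lambda>t. x t) has_integral 4/5 * A) {0..1}"
  proof -
    have "((\<lambda>t. 2 * pi * (x t * (3 / w t))) has_integral y 1 - y 0) {0..1}"
      using dy by (intro fundamental_theorem_of_calculus) (auto simp: has_real_derivative_iff_has_vector_derivative)
    then have "((\<lambda>t. (3 / (10 * pi)) * (2 * pi * (x t * (3 / w t)))) has_integral (3 / (10 * pi)) * (y 1 - y 0)) {0..1}"
      by (rule has_integral_mult_right)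
    moreover have "(3 / (10 * pi)) * (2 * pi * (x t * (3 / w t))) = x t - 4/5 * (x t)\<^sup>2" for t
    proof -
      have "(3 / (10 * pi)) * (2 * pi * (x t * (3 / w t))) = 3/5 * (x t * (3 / w t))" by simp
      also have "\<dots> = 3/5 * (x t * (5/3 - 4/3 * x t))" unfolding x54 ..
      also have "\<dots> = x t - 4/5 * (x t)\<^sup>2" by (simp add: power2_eq_square algebra_simps)
      finally show ?thesis .
    qed
    moreover have "y 1 - y 0 = 0" by (simp add: y_def c01)
    ultimately have "((\<lambda>t. x t - 4/5 * (x t)\<^sup>2) has_integral 0) {0..1}" by simp
    from has_integral_add[OF this has_integral_mult_right[OF iA, of "4/5"]] show ?thesis by simp
  qed
  \<comment> \<open>On the circle y is a constant multiple of the logarithmic derivative of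
    w.\<close>
  have iy: "((\<lambda>t. y t) has_integral 0) {0..1}"
  proof -
    have "((\<lambda>t. - (3 / (8 * pi)) * ln (w t)) has_real_derivative y t) (at t within {0..1})" for t
    proof -
      have "((\<lambda>t. ln (w t)) has_real_derivative (1 / w t) * (- 4 * sin (\<theta> t) * (2 * pi))) (at t within {0..1})"
        using DERIV_chain2[OF DERIV_ln_divide[OF w[of t]] dw] .
      moreover have "- (3 / (8 * pi)) * ((1 / w t) * (- 4 * sin (\<theta> t) * (2 * pi))) = y t" by (simp add: y_def)
      ultimately show ?thesis by (metis DERIV_cmult)
    qed
    then have "((\<lambda>t. y t) has_integral - (3 / (8 * pi)) * ln (w 1) - - (3 / (8 * pi)) * ln (w 0)) {0..1}"
      by (intro fundamental_theorem_of_calculus) (auto simp: has_real_derivative_iff_has_vector_derivative)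
    moreover have "w 1 = w 0" by (simp add: w_def c01)
    ultimately show ?thesis by simp
  qed
  have A0: "A \<noteq> 0"
  proof
    assume "A = 0"
    then have "x 0 = 0"
      using has_integral_0_cbox_imp_0[of 0 1 "\<lambda>t. (x t)\<^sup>2" 0] iA xc by (auto intro!: continuous_intros)
    then show False by (simp add: x_def w_def c01)
  qed
  have "((\<lambda>t. tr2 (D (X t))) has_integral 4/3 * 0 + 2 * (4/5 * A)) {0..1}"
    unfolding tr X_def fst_conv snd_conv by (intro has_integral_add has_integral_mult_right ix iy)
  then have "integral {0..1} (\<lambda>t. tr2 (D (X t))) \<noteq> 0" using A0 by (simp add: integral_unique)
  then have "hyp_orbit ?F (X ` {0..1})" unfolding hyp_orbit_def using D cs by blast
  then show ?thesis using pd hyp_orbit_limit_cycle by blast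
qed

text \<open>This is \<mu>^(8 n) times the polynomial at x = \<mu>^(-8) (1 + \<mu> \<xi>), y =
  \<mu>^(-6) \<eta>, cleared of denominators so that it makes sense at \<mu> = 0. Each missing
  degree costs a factor \<mu>^8 and each power of y a factor \<mu>^2, so only the term x^n survives
  there.\<close>

definition zoomed :: "(nat \<Rightarrow> nat \<Rightarrow> real) \<Rightarrow> nat \<Rightarrow> real \<Rightarrow> real \<Rightarrow> real \<Rightarrow> real" where
  "zoomed c n \<mu> \<xi> \<eta> = (\<Sum>i\<le>n. \<Sum>j\<le>n - i. c i j * \<mu> ^ (8 * (n - i - j)) * (1 + \<mu> * \<xi>) ^ i * (\<mu>\<^sup>2 * \<eta>) ^ j)"

lemma zoomed_eq:
  assumes "\<mu> \<noteq> 0"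
  shows "\<mu> ^ (8 * n) * (\<Sum>i\<le>n. \<Sum>j\<le>n - i. c i j * ((1 + \<mu> * \<xi>) / \<mu> ^ 8) ^ i * (\<eta> / \<mu> ^ 6) ^ j) = zoomed c n \<mu> \<xi> \<eta>"
  unfolding zoomed_def sum_distrib_left
proof (intro sum.cong refl)
  fix i j assume ij: "i \<in> {..n}" "j \<in> {..n - i}"
  have "8 * n = 8 * (n - i - j) + (8 * i + 8 * j)" using ij by auto
  then have p: "\<mu> ^ (8 * n) = \<mu> ^ (8 * (n - i - j)) * ((\<mu> ^ 8) ^ i * (\<mu> ^ 8) ^ j)" by (simp only: power_add power_mult)
  have x: "(\<mu> ^ 8) ^ i * ((1 + \<mu> * \<xi>) / \<mu> ^ 8) ^ i = (1 + \<mu> * \<xi>) ^ i"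
    using assms by (simp flip: power_mult_distrib)
  have "\<mu> ^ 8 * (\<eta> / \<mu> ^ 6) = \<mu>\<^sup>2 * \<eta>" using assms by (simp add: field_simps flip: power_add)
  then have y: "(\<mu> ^ 8) ^ j * (\<eta> / \<mu> ^ 6) ^ j = (\<mu>\<^sup>2 * \<eta>) ^ j" by (simp only: power_mult_distrib[symmetric])
  have "\<mu> ^ (8 * n) * (c i j * ((1 + \<mu> * \<xi>) / \<mu> ^ 8) ^ i * (\<eta> / \<mu> ^ 6) ^ j)
    = c i j * \<mu> ^ (8 * (n - i - j)) * ((\<mu> ^ 8) ^ i * ((1 + \<mu> * \<xi>) / \<mu> ^ 8) ^ i) * ((\<mu> ^ 8) ^ j * (\<eta> / \<mu> ^ 6) ^ j)"
    unfolding p by (simp only: mult_ac)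
  then show "\<mu> ^ (8 * n) * (c i j * ((1 + \<mu> * \<xi>) / \<mu> ^ 8) ^ i * (\<eta> / \<mu> ^ 6) ^ j)
    = c i j * \<mu> ^ (8 * (n - i - j)) * (1 + \<mu> * \<xi>) ^ i * (\<mu>\<^sup>2 * \<eta>) ^ j" unfolding x y .
qed

lemma zoomed_0: "zoomed c n 0 \<xi> \<eta> = c n 0"
proof -
  have "(\<Sum>j\<le>n - i. c i j * 0 ^ (8 * (n - i - j)) * (1 + 0 * \<xi>) ^ i * (0\<^sup>2 * \<eta>) ^ j) = (if i = n then c n 0 else 0)" if "i \<le> n" for i
  proof -
    have "(\<Sum>j\<le>n - i. c i j * 0 ^ (8 * (n - i - j)) * (1 + 0 * \<xi>) ^ i * (0\<^sup>2 * \<eta>) ^ j)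
       = (\<Sum>j\<le>n - i. if j = 0 then c i 0 * 0 ^ (8 * (n - i)) else 0)"
      by (intro sum.cong refl) (simp add: power_0_left)
    also have "\<dots> = c i 0 * 0 ^ (8 * (n - i))" by (subst sum.delta) auto
    finally show ?thesis using that by (simp add: power_0_left)
  qed
  then have "zoomed c n 0 \<xi> \<eta> = (\<Sum>i\<le>n. if i = n then c n 0 else 0)" unfolding zoomed_def by (intro sum.cong) auto
  then show ?thesis by (simp add: sum.delta)
qed

lemma smooth_zoomed:
  assumes "smooth f" "smooth g" "smooth h" shows "smooth (\<lambda>z. zoomed c n (f z) (g z) (h z))"
  unfolding zoomed_def by (intro smooth_intros assms)

text \<open>Multiplying the field by \<open>1 - \<mu>\<^sup>8 x\<close> creates a distant line of singularities. Near its point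
  \<open>(\<mu>\<^sup>-\<^sup>8, 0)\<close>, in the coordinates \<open>x = \<mu>\<^sup>-\<^sup>8 (1 + \<mu> \<xi>)\<close>, \<open>y = \<mu>\<^sup>-\<^sup>6 \<eta>\<close>, the perturbed field below tends,
  up to a constant factor, to a van der Pol field, while on bounded sets it tends to the given field.\<close>

lemma add_limit_cycle:
  assumes n: "n \<ge> 2" and P: "\<And>x y. P x y = (\<Sum>i\<le>n. \<Sum>j\<le>n - i. c i j * x ^ i * y ^ j)"
    and Q: "\<And>x y. Q x y = (\<Sum>i\<le>n. \<Sum>j\<le>n - i. d i j * x ^ i * y ^ j)" and g: "d n 0 \<noteq> 0"
    and fin: "finite S" and S: "\<And>\<Gamma>. \<Gamma> \<in> S \<Longrightarrow> hyp_orbit (vfield P Q) \<Gamma>"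
  shows "\<exists>P' Q' S'. poly2_deg_le (Suc n) P' \<and> poly2_deg_le (Suc n) Q' \<and> finite S' \<and> card S' = Suc (card S) \<and>
    (\<forall>\<Gamma>\<in>S'. limit_cycle (vfield P' Q') \<Gamma>)"
proof -
  obtain l k \<Gamma>v where v: "hyp_orbit (vdp l k) \<Gamma>v" using vdp_hyp_orbit by blast
  define g where "g = d n 0"
  have g0: "g \<noteq> 0" using g by (simp add: g_def)
  have pP: "poly2_deg_le n P" and pQ: "poly2_deg_le n Q" using P Q unfolding poly2_deg_le_def by blast+
  \<comment> \<open>Let x have size \<mu>^(-a) and y size \<mu>^(-b), and let x vary on the scale
    \<mu>^(1-a), so that the linear factor is - \<mu> \<xi>. The two rotation terms get a common
    time factor when b = a - 2. The coefficients added here then have the orders \<mu>^b,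
    \<mu>^(b+1) and \<mu>^(a-5), so every a > 5 makes them tend to 0; a = 8 is used.\<close>
  define P' where "P' = (\<lambda>\<mu> x y. P x y + - (\<mu> ^ 8) * (x * P x y) + (g * \<mu> ^ 6) * x ^ n * y ^ 1)"
  define Q' where "Q' = (\<lambda>\<mu> x y. Q x y + - (\<mu> ^ 8) * (x * Q x y) + (g * l * \<mu> ^ 7) * x ^ n * y ^ 1 + (- (g * k * \<mu> ^ 3)) * x ^ (n - 2) * y ^ 3)"
  have dP': "poly2_deg_le (Suc n) (P' \<mu>)" and dQ': "poly2_deg_le (Suc n) (Q' \<mu>)" for \<mu>
    unfolding P'_def Q'_def
    by (rule poly2_add | rule poly2_mono[OF pP] poly2_mono[OF pQ] | rule poly2_cmult[OF poly2_times_x[OF pP]] poly2_cmult[OF poly2_times_x[OF pQ]]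
      | rule poly2_monom | (use n in simp))+
  define F where "F = (\<lambda>z::plane \<times> real. (P' (snd z) (fst (fst z)) (snd (fst z)), Q' (snd z) (fst (fst z)) (snd (fst z))))"
  have sP: "smooth (\<lambda>z::plane \<times> real. P (fst (fst z)) (snd (fst z)))" by (rule poly2_smooth[OF pP]) (intro smooth_intros)+
  have sQ: "smooth (\<lambda>z::plane \<times> real. Q (fst (fst z)) (snd (fst z)))" by (rule poly2_smooth[OF pQ]) (intro smooth_intros)+
  have sF: "smooth F" unfolding F_def P'_def Q'_def by (intro smooth_Pair smooth_add smooth_mult sP sQ smooth_minus smooth_power smooth_fst smooth_snd smooth_ident smooth_const)
  have F0: "(\<lambda>z. F (z, 0)) = vfield P Q" unfolding vfield_eq F_def P'_def Q'_def by simp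
  have FV: "(\<lambda>z. F (z, \<mu>)) = vfield (P' \<mu>) (Q' \<mu>)" for \<mu> unfolding vfield_eq F_def by simp
  \<comment> \<open>The perturbed field in the zoomed coordinates, divided by the common factor
    \<open>w\<close> defined below. Written without negative powers of \<mu> it is smooth up to
    \<mu> = 0. The contribution of P keeps an extra factor \<mu> and drops out there, while that of
    Q leaves the restoring force.\<close>
  define G where "G = (\<lambda>z::plane \<times> real.
     (- (1 / g) * (snd z * fst (fst z) * zoomed c n (snd z) (fst (fst z)) (snd (fst z))) + (1 + snd z * fst (fst z)) ^ n * snd (fst z),
      - (1 / g) * (fst (fst z) * zoomed d n (snd z) (fst (fst z)) (snd (fst z))) + l * ((1 + snd z * fst (fst z)) ^ n * snd (fst z))
        - k * ((1 + snd z * fst (fst z)) ^ (n - 2) * snd (fst z) ^ 3)))"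
  have sz: "smooth (\<lambda>z::plane \<times> real. zoomed e n (snd z) (fst (fst z)) (snd (fst z)))" for e
    by (rule smooth_zoomed) (intro smooth_intros)+
  have sG: "smooth G" unfolding G_def
    by (intro smooth_Pair smooth_add smooth_diff smooth_mult sz smooth_minus smooth_power smooth_fst smooth_snd smooth_ident smooth_const)
  have G0: "(\<lambda>z. G (z, 0)) = vdp l k"
    using g0 by (auto simp: G_def vdp_def zoomed_0 g_def)
  obtain \<delta>1 R1 where \<delta>1: "\<delta>1 > 0" and R1: "\<And>b. \<bar>b\<bar> < \<delta>1 \<Longrightarrow> \<exists>S'. finite S' \<and> card S' = card S \<and>
    (\<forall>\<Gamma>\<in>S'. hyp_orbit (\<lambda>x. F (x, b)) \<Gamma> \<and> (\<forall>q\<in>\<Gamma>. norm q \<le> R1))"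
  proof (rule hyp_persist_set[OF sF fin])
    show "hyp_orbit (\<lambda>x. F (x, 0)) \<Gamma>" if "\<Gamma> \<in> S" for \<Gamma> unfolding F0 by (rule S[OF that])
  qed (rule that; assumption)
  obtain \<delta>2 R2 where \<delta>2: "\<delta>2 > 0" and R2: "\<And>b. \<bar>b\<bar> < \<delta>2 \<Longrightarrow> \<exists>S'. finite S' \<and> card S' = card {\<Gamma>v} \<and>
    (\<forall>\<Gamma>\<in>S'. hyp_orbit (\<lambda>x. G (x, b)) \<Gamma> \<and> (\<forall>q\<in>\<Gamma>. norm q \<le> R2))"
  proof (rule hyp_persist_set[OF sG, of "{\<Gamma>v}"])
    show "hyp_orbit (\<lambda>x. G (x, 0)) \<Gamma>" if "\<Gamma> \<in> {\<Gamma>v}" for \<Gamma> unfolding G0 using v that by simp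
    show "finite {\<Gamma>v}" by simp
  qed (rule that; assumption)
  \<comment> \<open>Half of r exceeds both radii. As \<mu> is at most 1/r, the product \<mu> \<xi>
    has size at most 1/2 on the new cycle, and \<mu>^8 is at most 1/r; hence the new cycle has first
    coordinate at least r / 2, outside the ball of the old ones.\<close>
  define r where "r = 2 * (\<bar>R1\<bar> + \<bar>R2\<bar> + 1)"
  have r: "r \<ge> 2" by (simp add: r_def)
  define \<mu> where "\<mu> = min (min (\<delta>1 / 2) (\<delta>2 / 2)) (1 / r)"
  have \<mu>: "\<mu> > 0" "\<bar>\<mu>\<bar> < \<delta>1" "\<bar>\<mu>\<bar> < \<delta>2" "\<mu> \<le> 1 / r" using \<delta>1 \<delta>2 r by (auto simp: \<mu>_def min_def)
  have \<mu>r: "\<mu> * r \<le> 1" using \<mu>(4) r by (simp add: pos_le_divide_eq)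
  obtain S1 where S1: "finite S1" "card S1 = card S" "\<And>\<Gamma>. \<Gamma> \<in> S1 \<Longrightarrow> hyp_orbit (\<lambda>x. F (x, \<mu>)) \<Gamma>"
    "\<And>\<Gamma> q. \<Gamma> \<in> S1 \<Longrightarrow> q \<in> \<Gamma> \<Longrightarrow> norm q \<le> R1" using R1[OF \<mu>(2)] by blast
  obtain S2 where S2: "card S2 = 1" "\<forall>\<Gamma>\<in>S2. hyp_orbit (\<lambda>x. G (x, \<mu>)) \<Gamma> \<and> (\<forall>q\<in>\<Gamma>. norm q \<le> R2)" using R2[OF \<mu>(3)] by auto
  then obtain \<Gamma>2 where "S2 = {\<Gamma>2}" by (auto simp: card_1_singleton_iff)
  then have \<Gamma>2: "hyp_orbit (\<lambda>x. G (x, \<mu>)) \<Gamma>2" "\<And>q. q \<in> \<Gamma>2 \<Longrightarrow> norm q \<le> R2" using S2(2) by auto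
  define A where "A = aff (1 / \<mu> ^ 8, 0) (1 / \<mu> ^ 7) (1 / \<mu> ^ 6)"
  define w where "w = g * \<mu> ^ 7 / \<mu> ^ (8 * n)"
  have rel: "F (A z, \<mu>) = w *\<^sub>R (1 / \<mu> ^ 7 * fst (G (z, \<mu>)), 1 / \<mu> ^ 6 * snd (G (z, \<mu>)))" for z
  proof -
    define \<xi> where "\<xi> = fst z"
    define \<eta> where "\<eta> = snd z"
    define x where "x = (1 + \<mu> * \<xi>) / \<mu> ^ 8"
    define y where "y = \<eta> / \<mu> ^ 6"
    have Az: "A z = (x, y)"
    proof -
      have "1 / \<mu> ^ 8 + 1 / \<mu> ^ 7 * \<xi> = x" using \<mu>(1) by (simp add: x_def add_divide_distrib power_Suc[symmetric] eval_nat_numeral)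
      then show ?thesis by (simp add: A_def aff_def \<xi>_def y_def \<eta>_def)
    qed
    define N where "N = \<mu> ^ (8 * n)"
    have N: "N \<noteq> 0" using \<mu>(1) by (simp add: N_def)
    have zP: "N * P x y = zoomed c n \<mu> \<xi> \<eta>" and zQ: "N * Q x y = zoomed d n \<mu> \<xi> \<eta>"
      unfolding P Q N_def x_def y_def using \<mu>(1) by (intro zoomed_eq; simp)+
    have x8: "\<mu> ^ 8 * x = 1 + \<mu> * \<xi>" using \<mu>(1) by (simp add: x_def)
    have y6: "\<mu> ^ 6 * y = \<eta>" using \<mu>(1) by (simp add: y_def)
    have xn: "N * x ^ n = (1 + \<mu> * \<xi>) ^ n" unfolding N_def power_mult x8[symmetric] power_mult_distrib ..
    have xn2: "N * x ^ (n - 2) = \<mu> ^ 16 * (1 + \<mu> * \<xi>) ^ (n - 2)"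
    proof -
      have "8 * n = 16 + 8 * (n - 2)" using n by simp
      then have "N = \<mu> ^ 16 * (\<mu> ^ 8) ^ (n - 2)" unfolding N_def by (simp only: power_add power_mult)
      then show ?thesis unfolding x8[symmetric] power_mult_distrib by simp
    qed
    have G1: "fst (G (z, \<mu>)) = - (1 / g) * (\<mu> * \<xi> * zoomed c n \<mu> \<xi> \<eta>) + (1 + \<mu> * \<xi>) ^ n * \<eta>"
      by (simp only: G_def \<xi>_def \<eta>_def fst_conv snd_conv)
    have G2: "snd (G (z, \<mu>)) = - (1 / g) * (\<xi> * zoomed d n \<mu> \<xi> \<eta>) + l * ((1 + \<mu> * \<xi>) ^ n * \<eta>) - k * ((1 + \<mu> * \<xi>) ^ (n - 2) * \<eta> ^ 3)"
      by (simp only: G_def \<xi>_def \<eta>_def fst_conv snd_conv)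
    have cancel: "g * (- (1 / g) * a + b) = - a + g * b" "g * m * (- (1 / g) * a + b - c) = - (m * a) + g * m * b - g * m * c" for a b c m :: real
      using g0 by (simp_all add: field_simps)
    have f1: "N * P' \<mu> x y = g * fst (G (z, \<mu>))"
    proof -
      have "N * P' \<mu> x y = (1 - \<mu> ^ 8 * x) * (N * P x y) + g * (N * x ^ n) * (\<mu> ^ 6 * y)"
        by (simp add: P'_def algebra_simps)
      also have "\<dots> = - (\<mu> * \<xi>) * zoomed c n \<mu> \<xi> \<eta> + g * (1 + \<mu> * \<xi>) ^ n * \<eta>" unfolding zP x8 xn y6 by simp
      also have "\<dots> = g * fst (G (z, \<mu>))" unfolding G1 cancel by (simp add: mult.assoc)
      finally show ?thesis .
    qed
    have f2: "N * Q' \<mu> x y = g * \<mu> * snd (G (z, \<mu>))"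
    proof -
      have "N * Q' \<mu> x y = (1 - \<mu> ^ 8 * x) * (N * Q x y) + g * l * \<mu> * (N * x ^ n) * (\<mu> ^ 6 * y) - g * k * \<mu> ^ 3 * (N * x ^ (n - 2)) * y ^ 3"
        by (simp add: Q'_def algebra_simps eval_nat_numeral)
      also have "\<dots> = - (\<mu> * \<xi>) * zoomed d n \<mu> \<xi> \<eta> + g * l * \<mu> * (1 + \<mu> * \<xi>) ^ n * \<eta> - g * k * \<mu> * (1 + \<mu> * \<xi>) ^ (n - 2) * \<eta> ^ 3"
      proof -
        have "\<mu> ^ 3 * \<mu> ^ 16 * y ^ 3 = \<mu> * (\<mu> ^ 6 * y) ^ 3"
        proof -
          have "\<mu> ^ 3 * \<mu> ^ 16 = \<mu> ^ (Suc (6 * 3))" unfolding power_add[symmetric] by simp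
          then show ?thesis unfolding power_mult_distrib power_Suc power_mult by (simp only: mult.assoc)
        qed
        then have y3: "\<mu> ^ 3 * \<mu> ^ 16 * y ^ 3 = \<mu> * \<eta> ^ 3" unfolding y6 .
        have "g * k * \<mu> ^ 3 * (\<mu> ^ 16 * (1 + \<mu> * \<xi>) ^ (n - 2)) * y ^ 3 = g * k * (1 + \<mu> * \<xi>) ^ (n - 2) * (\<mu> ^ 3 * \<mu> ^ 16 * y ^ 3)"
          by (simp only: mult_ac)
        also have "\<dots> = g * k * \<mu> * (1 + \<mu> * \<xi>) ^ (n - 2) * \<eta> ^ 3" unfolding y3 by (simp only: mult_ac)
        finally show ?thesis unfolding zQ x8 xn y6 xn2 by simp
      qed
      also have "\<dots> = g * \<mu> * snd (G (z, \<mu>))" unfolding G2 cancel by (simp add: mult_ac)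
      finally show ?thesis .
    qed
    have q1: "P' \<mu> x y = w * (1 / \<mu> ^ 7 * fst (G (z, \<mu>)))"
    proof -
      have "w * (1 / \<mu> ^ 7 * fst (G (z, \<mu>))) = (g * fst (G (z, \<mu>))) / N" using \<mu>(1) by (simp add: w_def N_def)
      also have "\<dots> = P' \<mu> x y" unfolding f1[symmetric] using N by simp
      finally show ?thesis by simp
    qed
    have q2: "Q' \<mu> x y = w * (1 / \<mu> ^ 6 * snd (G (z, \<mu>)))"
    proof -
      have "\<mu> ^ 7 / \<mu> ^ 6 = \<mu>" using \<mu>(1) by (simp add: eval_nat_numeral)
      have "w * (1 / \<mu> ^ 6 * snd (G (z, \<mu>))) = (g * (\<mu> ^ 7 / \<mu> ^ 6) * snd (G (z, \<mu>))) / N"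
        unfolding w_def N_def by simp
      also have "\<dots> = (g * \<mu> * snd (G (z, \<mu>))) / N" unfolding \<open>\<mu> ^ 7 / \<mu> ^ 6 = \<mu>\<close> ..
      also have "\<dots> = Q' \<mu> x y" unfolding f2[symmetric] using N by simp
      finally show ?thesis by simp
    qed
    show ?thesis unfolding Az using q1 q2 by (simp add: F_def)
  qed
  have new: "limit_cycle (\<lambda>x. F (x, \<mu>)) (A ` \<Gamma>2)"
    unfolding A_def
    by (rule limit_cycle_aff[where \<omega>=w and G="\<lambda>x. G (x, \<mu>)"])
      (use \<mu>(1) g0 rel hyp_orbit_limit_cycle[OF \<Gamma>2(1)] in \<open>auto simp: w_def A_def\<close>)
  have "A ` \<Gamma>2 \<notin> S1"
  proof
    assume "A ` \<Gamma>2 \<in> S1"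
    have "\<Gamma>2 \<noteq> {}" using \<Gamma>2(1) unfolding hyp_orbit_def by auto
    then obtain q where q: "q \<in> \<Gamma>2" by blast
    then have "norm (A q) \<le> R1" using S1(4)[OF \<open>A ` \<Gamma>2 \<in> S1\<close>] by blast
    moreover have "fst (A q) \<le> norm (A q)" using norm_fst_le[of "fst (A q)" "snd (A q)"] by simp
    moreover have "fst (A q) \<ge> r / 2"
    proof -
      have "\<bar>fst q\<bar> \<le> R2" using norm_fst_le[of "fst q" "snd q"] \<Gamma>2(2)[OF q] by simp
      then have "\<mu> * \<bar>fst q\<bar> \<le> \<mu> * (r / 2)" using \<mu>(1) by (intro mult_left_mono) (auto simp: r_def)
      also have "\<dots> \<le> 1/2" using \<mu>r by simp
      finally have "\<bar>\<mu> * fst q\<bar> \<le> 1/2" using \<mu>(1) unfolding abs_mult by simp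
      then have h: "1/2 \<le> 1 + \<mu> * fst q" by linarith
      have m1: "\<mu> \<le> 1" using \<mu>(4) r by (smt (verit) divide_le_eq_1)
      have "\<mu> ^ 8 \<le> \<mu> ^ 1" using \<mu>(1) m1 by (intro power_decreasing) auto
      then have "r * \<mu> ^ 8 \<le> r * \<mu>" using r by (intro mult_left_mono) auto
      then have "r / 2 * \<mu> ^ 8 \<le> 1 + \<mu> * fst q" using h \<mu>r by (simp add: mult.commute)
      then have "r / 2 \<le> (1 + \<mu> * fst q) / \<mu> ^ 8" using \<mu>(1) by (simp add: pos_le_divide_eq)
      also have "\<dots> = fst (A q)" using \<mu>(1) by (simp add: A_def aff_def add_divide_distrib eval_nat_numeral)
      finally show ?thesis .
    qed
    ultimately show False by (simp add: r_def)
  qed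
  then have "card (insert (A ` \<Gamma>2) S1) = Suc (card S)" using S1(1,2) by simp
  moreover have "limit_cycle (vfield (P' \<mu>) (Q' \<mu>)) \<Gamma>" if "\<Gamma> \<in> insert (A ` \<Gamma>2) S1" for \<Gamma>
    using that new hyp_orbit_limit_cycle[OF S1(3)] unfolding FV by blast
  ultimately show ?thesis using dP' dQ' S1(1) by (intro exI[of _ "P' \<mu>"] exI[of _ "Q' \<mu>"] exI[of _ "insert (A ` \<Gamma>2) S1"]) auto
qed

text \<open>The blow-up needs a nonzero coefficient of x^n in the second component, since this
  supplies the restoring force. If it is zero after the rotation, a small multiple of x^n is added,
  which the hyperbolic cycles survive and which does not raise the degree.\<close>

lemma limit_cycle_step:
  assumes n: "n \<ge> 1" and P: "poly2_deg_le n P" and Q: "poly2_deg_le n Q"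
    and fin: "finite S" and S: "\<And>\<Gamma>. \<Gamma> \<in> S \<Longrightarrow> limit_cycle (vfield P Q) \<Gamma>"
  shows "\<exists>P' Q' S'. poly2_deg_le (Suc n) P' \<and> poly2_deg_le (Suc n) Q' \<and> finite S' \<and> card S' = Suc (card S) \<and>
    (\<forall>\<Gamma>\<in>S'. limit_cycle (vfield P' Q') \<Gamma>)"
proof (cases "n = 1")
  case True
  have "S = {}"
  proof (rule ccontr)
    assume "S \<noteq> {}"
    then obtain \<Gamma> where "\<Gamma> \<in> S" by blast
    from S[OF this] show False using linear_no_limit_cycle P Q True by blast
  qed
  moreover obtain P' Q' \<Gamma> where "poly2_deg_le 2 P'" "poly2_deg_le 2 Q'" "limit_cycle (vfield P' Q') \<Gamma>"
    using quadratic_limit_cycle by blast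
  ultimately show ?thesis using True by (intro exI[of _ P'] exI[of _ Q'] exI[of _ "{\<Gamma>}"]) (simp add: numeral_2_eq_2)
next
  case False
  then have n2: "n \<ge> 2" using n by simp
  obtain \<epsilon> S1 where S1: "finite S1" "card S1 = card S" "\<And>\<Gamma>. \<Gamma> \<in> S1 \<Longrightarrow> hyp_orbit (rotated (vfield P Q) \<epsilon>) \<Gamma>"
    by (rule hyperbolize[OF vfield_smooth[OF P Q] fin S], assumption) (rule that; assumption)
  define P1 where "P1 = (\<lambda>x y. P x y + - \<epsilon> * Q x y)"
  define Q1 where "Q1 = (\<lambda>x y. Q x y + \<epsilon> * P x y)"
  have p1: "poly2_deg_le n P1" "poly2_deg_le n Q1" unfolding P1_def Q1_def by (intro poly2_add poly2_cmult P Q)+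
  have hyp1: "hyp_orbit (vfield P1 Q1) \<Gamma>" if "\<Gamma> \<in> S1" for \<Gamma> using S1(3)[OF that] unfolding rotated_vfield P1_def Q1_def .
  obtain c where c: "\<And>x y. P1 x y = (\<Sum>i\<le>n. \<Sum>j\<le>n - i. c i j * x ^ i * y ^ j)" using p1(1) unfolding poly2_deg_le_def by blast
  obtain d where d: "\<And>x y. Q1 x y = (\<Sum>i\<le>n. \<Sum>j\<le>n - i. d i j * x ^ i * y ^ j)" using p1(2) unfolding poly2_deg_le_def by blast
  show ?thesis
  proof (cases "d n 0 = 0")
    case False
    from add_limit_cycle[OF n2 c d False S1(1) hyp1] show ?thesis unfolding S1(2) .
  next
    case True
    define F where "F = (\<lambda>z::plane \<times> real. (P1 (fst (fst z)) (snd (fst z)), Q1 (fst (fst z)) (snd (fst z)) + snd z * fst (fst z) ^ n))"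
    have sP: "smooth (\<lambda>z::plane \<times> real. P1 (fst (fst z)) (snd (fst z)))" by (rule poly2_smooth[OF p1(1)]) (intro smooth_intros)+
    have sQ: "smooth (\<lambda>z::plane \<times> real. Q1 (fst (fst z)) (snd (fst z)))" by (rule poly2_smooth[OF p1(2)]) (intro smooth_intros)+
    have sF: "smooth F" unfolding F_def by (intro smooth_Pair smooth_add smooth_mult sP sQ smooth_power smooth_fst smooth_snd smooth_ident)
    have F0: "(\<lambda>z. F (z, 0)) = vfield P1 Q1" unfolding vfield_eq F_def by simp
    obtain \<delta> R where \<delta>: "\<delta> > 0" and R: "\<And>b. \<bar>b\<bar> < \<delta> \<Longrightarrow> \<exists>S'. finite S' \<and> card S' = card S1 \<and>
      (\<forall>\<Gamma>\<in>S'. hyp_orbit (\<lambda>x. F (x, b)) \<Gamma> \<and> (\<forall>q\<in>\<Gamma>. norm q \<le> R))"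
    proof (rule hyp_persist_set[OF sF S1(1)])
      show "hyp_orbit (\<lambda>x. F (x, 0)) \<Gamma>" if "\<Gamma> \<in> S1" for \<Gamma> unfolding F0 by (rule hyp1[OF that])
    qed (rule that; assumption)
    define b where "b = \<delta> / 2"
    have b: "\<bar>b\<bar> < \<delta>" "b \<noteq> 0" using \<delta> by (auto simp: b_def)
    obtain S2 where S2: "finite S2" "card S2 = card S1" "\<And>\<Gamma>. \<Gamma> \<in> S2 \<Longrightarrow> hyp_orbit (\<lambda>x. F (x, b)) \<Gamma>" using R[OF b(1)] by blast
    define Q2 where "Q2 = (\<lambda>x y. Q1 x y + b * x ^ n * y ^ 0)"
    have FV: "(\<lambda>z. F (z, b)) = vfield P1 Q2" unfolding vfield_eq F_def Q2_def by simp
    define d' where "d' = (\<lambda>i j. d i j + (if i = n then if j = 0 then b else 0 else 0))"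
    have Q2: "Q2 x y = (\<Sum>i\<le>n. \<Sum>j\<le>n - i. d' i j * x ^ i * y ^ j)" for x y
    proof -
      have "n + 0 \<le> n" by simp
      from monom_sum[OF this, of b x y] show ?thesis unfolding Q2_def d d'_def distrib_right sum.distrib by simp
    qed
    have "d' n 0 \<noteq> 0" using True b by (simp add: d'_def)
    from add_limit_cycle[OF n2 c Q2 this S2(1) S2(3)[unfolded FV]] show ?thesis unfolding S2(2) S1(2) .
  qed
qed

section \<open>Counting limit cycles with values in the extended naturals\<close>

lemma enat_le_num_limit_cycles:
  "enat k \<le> num_limit_cycles F \<longleftrightarrow> (\<exists>S. finite S \<and> card S = k \<and> (\<forall>\<Gamma>\<in>S. limit_cycle F \<Gamma>))"
proof (cases "finite {\<Gamma>. limit_cycle F \<Gamma>}")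
  case True
  show ?thesis
  proof
    assume "enat k \<le> num_limit_cycles F"
    then have "k \<le> card {\<Gamma>. limit_cycle F \<Gamma>}" using True by (simp add: num_limit_cycles_def)
    then obtain S where "S \<subseteq> {\<Gamma>. limit_cycle F \<Gamma>}" "card S = k" using obtain_subset_with_card_n by metis
    then show "\<exists>S. finite S \<and> card S = k \<and> (\<forall>\<Gamma>\<in>S. limit_cycle F \<Gamma>)" using True finite_subset by blast
  next
    assume "\<exists>S. finite S \<and> card S = k \<and> (\<forall>\<Gamma>\<in>S. limit_cycle F \<Gamma>)"
    then obtain S where "card S = k" "S \<subseteq> {\<Gamma>. limit_cycle F \<Gamma>}" by blast
    then show "enat k \<le> num_limit_cycles F" using card_mono[OF True] True by (auto simp: num_limit_cycles_def)
  qed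
next
  case False
  \<comment> \<open>An infinite set of cycles has finite subsets of every size, so both sides of the
    equivalence hold.\<close>
  then obtain S where "finite S" "card S = k" "S \<subseteq> {\<Gamma>. limit_cycle F \<Gamma>}" using infinite_arbitrarily_large by metis
  then show ?thesis using False by (auto simp: num_limit_cycles_def)
qed

lemma hilbert_number_mono: "n \<le> m \<Longrightarrow> hilbert_number n \<le> hilbert_number m"
  unfolding hilbert_number_def by (rule SUP_subset_mono) (auto intro: poly2_mono)

text \<open>A finite lower bound of a supremum of extended naturals is reached by a single field:
  some value exceeds k - 1, hence is at least k. For k = 0 the zero field is taken.\<close>

lemma hilbert_number_attained:
  assumes "enat k \<le> hilbert_number n"
  obtains P Q where "poly2_deg_le n P" "poly2_deg_le n Q" "enat k \<le> num_limit_cycles (vfield P Q)"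
proof (cases k)
  case 0
  have "poly2_deg_le n (\<lambda>x y. 0 * x ^ 0 * y ^ 0)" by (rule poly2_monom) simp
  from that[OF this this] 0 show thesis by (simp add: zero_enat_def[symmetric])
next
  case (Suc m)
  then have "enat m < hilbert_number n" using assms by (meson enat_ord_simps(2) lessI order_less_le_trans)
  then obtain PQ where "PQ \<in> {(P, Q). poly2_deg_le n P \<and> poly2_deg_le n Q}" "enat m < num_limit_cycles (vfield (fst PQ) (snd PQ))"
    unfolding hilbert_number_def less_SUP_iff by blast
  then show thesis using that[of "fst PQ" "snd PQ"] ileI1[of "enat m"] by (auto simp: eSuc_enat Suc)
qed

lemma hilbert_number_Suc:
  assumes n: "n \<ge> 1" and k: "enat k \<le> hilbert_number n" shows "enat (Suc k) \<le> hilbert_number (Suc n)"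
proof -
  obtain P Q where PQ: "poly2_deg_le n P" "poly2_deg_le n Q" "enat k \<le> num_limit_cycles (vfield P Q)"
    using hilbert_number_attained[OF k] by metis
  then obtain S where S: "finite S" "card S = k" "\<forall>\<Gamma>\<in>S. limit_cycle (vfield P Q) \<Gamma>" unfolding enat_le_num_limit_cycles by blast
  obtain P' Q' S' where P': "poly2_deg_le (Suc n) P'" "poly2_deg_le (Suc n) Q'" "finite S'" "card S' = Suc k"
    "\<forall>\<Gamma>\<in>S'. limit_cycle (vfield P' Q') \<Gamma>"
    using limit_cycle_step[OF n PQ(1,2) S(1)] S(2,3) by blast
  then have "enat (Suc k) \<le> num_limit_cycles (vfield P' Q')" unfolding enat_le_num_limit_cycles by blast
  also have "\<dots> \<le> hilbert_number (Suc n)" unfolding hilbert_number_def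
    using P'(1,2) by (intro SUP_upper2[of "(P', Q')"]) auto
  finally show ?thesis .
qed

theorem theorem1:
  fixes n n0 :: nat
  assumes "n \<ge> 1"
  shows "hilbert_number (Suc n) \<ge> hilbert_number n + 1
    \<and> (hilbert_number n0 = \<infinity> \<longrightarrow> (\<forall>m \<ge> n0. hilbert_number m = \<infinity>))"
proof
  show "hilbert_number (Suc n) \<ge> hilbert_number n + 1"
  proof (cases "hilbert_number n")
    case (enat k)
    then show ?thesis using hilbert_number_Suc[OF assms, of k] by (simp add: plus_1_eSuc eSuc_enat)
  next
    case infinity
    then show ?thesis using hilbert_number_mono[of n "Suc n"] by simp
  qed
  show "hilbert_number n0 = \<infinity> \<longrightarrow> (\<forall>m \<ge> n0. hilbert_number m = \<infinity>)"
    using hilbert_number_mono[of n0] by auto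
qed

end
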